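(* Let $r\ge 2$ be an integer and let $K=\prod_{i=1}^3(x_i^c-h_i,x_i^c+h_i)\subset\mathbb R^3$ be a box. The following degrees of freedom (DOFs) are unisolvent for the space $\mathcal S^{+,1}_{r-1,r}(K)$, i.e. their number (after choosing bases of the test spaces) equals $\dim\mathcal S^{+,1}_{r-1,r}(K)$, and any $\mathbf u\in\mathcal S^{+,1}_{r-1,r}(K)$ on which all of them vanish is zero: (1) $\int_e \mathbf u\cdot\boldsymbol\tau_e\, q\,ds$ for all $q\in P_{r-1}(e)$ and all edges $e$ of $K$; (2) $\int_f (\mathbf u\times\mathbf n_f)\cdot\mathbf q\,dA$ for all $\mathbf q\in[P_{r-3}(f)]^2\oplus\operatorname{grad}_f\widetilde P_{r-1}(f)$ and all faces $f$ of $K$; (3) $\int_f(\operatorname{curl}\mathbf u\times\mathbf n_f)\cdot\mathbf q\,dA$ for all $\mathbf q\in[P_{r-2}(f)]^2$ and all faces $f$ of $K$; (4) $\int_K\mathbf u\cdot\mathbf q\,dV$ for all $\mathbf q\in[P_{r-5}(K)]^3\oplus\operatorname{curl}[\widetilde P_{r-3}(K)]^3$.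
   Context: Conventions: $P_k$ = polynomials of total degree at most $k$, $\widetilde P_k$ = homogeneous polynomials of degree $k$ (both $\{0\}$ if $k<0$). $\boldsymbol\tau_e$ is a unit tangent of the edge $e$, $\mathbf n_f$ the unit outward normal of the face $f$ of $K$; $[P_k(f)]^2$ is identified with tangential polynomial vector fields on $f$, and $\operatorname{grad}_f$ is the surface gradient. For a vector $\mathbf a$, $[P_k(K)]^3\times\mathbf a=\{\mathbf p\times\mathbf a:\mathbf p\in[P_k(K)]^3\}$. $(\cdot,\cdot)_K$ is the $L^2(K)$ inner product. $\mathcal S^0_r(K)$ (serendipity space): all polynomials of superlinear degree at most $r$, where the superlinear degree of a monomial is its total degree ignoring the variables that enter linearly (e.g. $x^2yz^3$ has superlinear degree 5), and that of a polynomial is the maximum over its monomials. $\mathcal S^1_{r-1,r}(K)=\operatorname{grad}\mathcal S^0_r(K)+[P_{r-1}(K)]^3\times\mathbf x+\{(x_2x_3(w_2-w_3),\,x_1x_3(w_3-w_1),\,x_1x_2(w_1-w_2))^{T}\}$, where $\mathbf x=(x_1,x_2,x_3)^T$ and each $w_i$ ranges over the polynomials in $\widetilde P_{r-1}(K)$ independent of $x_i$. Bubbles: $B_K=\prod_{i=1}^3(x_i-x_i^c+h_i)(x_i^c+h_i-x_i)$, and $B_f=B_K/\lambda_f$, where $\lambda_f$ is the linear factor of $B_K$ vanishing on $f$ (so $\operatorname{grad}\lambda_f=-\mathbf n_f$). $\mathcal V^{r-2}_f(K)=\{\mathbf q\in[P_{r-2}(K)]^3\times\mathbf n_f:(\mathbf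 q,B_KB_f\mathbf w)_K=0\ \ \forall\,\mathbf w\in[P_{r-3}(K)]^3\times\mathbf n_f\}$, and $\mathcal V^{r-2}(K)=B_K\sum_{f}B_f\mathcal V^{r-2}_f(K)$, the sum over the six faces $f$ of $K$. $\mathcal S^{+,1}_{r-1,r}(K)=\mathcal S^1_{r-1,r}(K)+\mathcal V^{r-2}(K)$. *)

theory Defs
  imports "HOL-Analysis.Analysis" "HOL-Library.Function_Algebras"
begin

text \<open>
  Polynomials and polynomial vector fields are represented by the corresponding functions on
  \<open>real^3\<close> (over the reals a polynomial, and its restriction to an open box, determine each other).
  With the pointwise operations the function space is a real vector space, so that the
  library's \<open>span\<close> and \<open>dim\<close>, and the sums \<open>A + B\<close> and \<open>\<Sum>i\<in>I. A i\<close> of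
  sets of functions from \<^theory>\<open>HOL-Library.Set_Algebras\<close>, apply to spaces of such functions.
\<close>

instantiation "fun" :: (type, real_vector) real_vector
begin

definition scaleR_fun :: "real \<Rightarrow> ('a \<Rightarrow> 'b) \<Rightarrow> 'a \<Rightarrow> 'b"
  where "scaleR_fun a f = (\<lambda>x. a *\<^sub>R f x)"

instance
  by standard (auto simp: scaleR_fun_def fun_eq_iff algebra_simps)

end

type_synonym scalar_field = "real^3 \<Rightarrow> real"
type_synonym vector_field = "real^3 \<Rightarrow> real^3"

definition monom_fun :: "(3 \<Rightarrow> nat) \<Rightarrow> scalar_field"
  where "monom_fun a = (\<lambda>x. \<Prod>j\<in>UNIV. x $ j ^ a j)"

text \<open>
  \<open>poly_space J k\<close> and \<open>hom_space J k\<close> are \<open>P\<^sub>k\<close> and its homogeneous analogue, in the variables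
  \<open>x $ j\<close> with \<open>j \<in> J\<close> only: \<open>J = UNIV\<close> for the box, the two tangential
  coordinates for a face, the one tangential coordinate for an edge. A polynomial on a face or
  edge is thus a polynomial in the coordinates of that face or edge.
  Degrees are integers; both spaces are \<open>{0}\<close> if \<open>k < 0\<close>.
\<close>

definition poly_space :: "3 set \<Rightarrow> int \<Rightarrow> scalar_field set"
  where "poly_space J k =
    span {monom_fun a |a. (\<forall>j. j \<notin> J \<longrightarrow> a j = 0) \<and> int (\<Sum>j\<in>UNIV. a j) \<le> k}"

definition hom_space :: "3 set \<Rightarrow> int \<Rightarrow> scalar_field set"
  where "hom_space J k =
    span {monom_fun a |a. (\<forall>j. j \<notin> J \<longrightarrow> a j = 0) \<and> int (\<Sum>j\<in>UNIV. a j) = k}"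

definition cube :: "scalar_field set \<Rightarrow> vector_field set"
  where "cube A = {v. \<forall>j. (\<lambda>x. v x $ j) \<in> A}"

definition cross_space :: "vector_field set \<Rightarrow> vector_field \<Rightarrow> vector_field set"
  where "cross_space V w = (\<lambda>v x. cross3 (v x) (w x)) ` V"

definition grad :: "scalar_field \<Rightarrow> vector_field"
  where "grad p = (\<lambda>x. \<chi> j. frechet_derivative p (at x) (axis j 1))"

definition curl :: "vector_field \<Rightarrow> vector_field"
  where "curl u = (\<lambda>x. let D = jacobian u (at x) in
    vector [D$3$2 - D$2$3, D$1$3 - D$3$1, D$2$1 - D$1$2])"

text \<open>
  The box is \<open>box (c - h) (c + h)\<close>. Its face \<open>(i, s)\<close> is where
  \<open>x $ i = c $ i + s * h $ i\<close>. Its edge \<open>(i, s, t)\<close> is parallel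
  to the axis \<open>i\<close>, and on it \<open>x $ (i + 1) = c $ (i + 1) + s * h $ (i + 1)\<close> and
  \<open>x $ (i + 2) = c $ (i + 2) + t * h $ (i + 2)\<close>.
  Arithmetic on the index type \<open>3\<close> is modulo 3, hence \<open>i\<close>, \<open>i + 1\<close>, \<open>i + 2\<close> are the three axes.
\<close>

type_synonym face = "3 \<times> real"
type_synonym edge = "3 \<times> real \<times> real"

definition faces :: "face set"
  where "faces = {(i, s). s \<in> {-1, 1}}"

definition edges :: "edge set"
  where "edges = {(i, s, t). s \<in> {-1, 1} \<and> t \<in> {-1, 1}}"

fun face_normal :: "face \<Rightarrow> real^3"
  where "face_normal (i, s) = s *\<^sub>R axis i 1"

fun edge_tangent :: "edge \<Rightarrow> real^3"
  where "edge_tangent (i, s, t) = axis i 1"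

fun face_integral :: "real^3 \<Rightarrow> real^3 \<Rightarrow> face \<Rightarrow> scalar_field \<Rightarrow> real"
  where "face_integral c h (i, s) g =
    integral (cbox (c $ (i+1) - h $ (i+1), c $ (i+2) - h $ (i+2))
                   (c $ (i+1) + h $ (i+1), c $ (i+2) + h $ (i+2)))
      (\<lambda>(a, b). g (\<chi> j. if j = i then c $ i + s * h $ i else if j = i + 1 then a else b))"

fun edge_integral :: "real^3 \<Rightarrow> real^3 \<Rightarrow> edge \<Rightarrow> scalar_field \<Rightarrow> real"
  where "edge_integral c h (i, s, t) g =
    integral {c $ i - h $ i .. c $ i + h $ i}
      (\<lambda>a. g (\<chi> j. if j = i then a
                  else if j = i + 1 then c $ (i+1) + s * h $ (i+1)
                  else c $ (i+2) + t * h $ (i+2)))"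

definition box_integral :: "real^3 \<Rightarrow> real^3 \<Rightarrow> scalar_field \<Rightarrow> real"
  where "box_integral c h g = integral (box (c - h) (c + h)) g"

fun edge_poly :: "edge \<Rightarrow> int \<Rightarrow> scalar_field set"
  where "edge_poly (i, s, t) k = poly_space {i} k"

fun face_poly :: "face \<Rightarrow> int \<Rightarrow> scalar_field set"
  where "face_poly (i, s) k = poly_space (- {i}) k"

fun face_hom :: "face \<Rightarrow> int \<Rightarrow> scalar_field set"
  where "face_hom (i, s) k = hom_space (- {i}) k"

definition face_tangential_poly :: "face \<Rightarrow> int \<Rightarrow> vector_field set"
  where "face_tangential_poly f k =
    {v \<in> cube (face_poly f k). \<forall>x. v x \<bullet> face_normal f = 0}"

definition surface_grad :: "face \<Rightarrow> scalar_field \<Rightarrow> vector_field"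
  where "surface_grad f p =
    (\<lambda>x. grad p x - (grad p x \<bullet> face_normal f) *\<^sub>R face_normal f)"

definition superlinear_degree :: "(3 \<Rightarrow> nat) \<Rightarrow> nat"
  where "superlinear_degree a = (\<Sum>j | a j \<noteq> 1. a j)"

definition S0 :: "int \<Rightarrow> scalar_field set"
  where "S0 r = span {monom_fun a |a. int (superlinear_degree a) \<le> r}"

text \<open>\<open>S1 r\<close> is \<open>\<S>\<^sup>1\<close> with the indices \<open>r - 1, r\<close>; likewise \<open>Splus1\<close> below.\<close>

definition S1 :: "int \<Rightarrow> vector_field set"
  where "S1 r = grad ` S0 r + cross_space (cube (poly_space UNIV (r - 1))) (\<lambda>x. x) +
    {(\<lambda>x. vector [x$2 * x$3 * (w 2 x - w 3 x),
                  x$1 * x$3 * (w 3 x - w 1 x),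
                  x$1 * x$2 * (w 1 x - w 2 x)]) |w.
      \<forall>i. w i \<in> hom_space (- {i}) (r - 1)}"

definition bubble_box :: "real^3 \<Rightarrow> real^3 \<Rightarrow> scalar_field"
  where "bubble_box c h = (\<lambda>x. \<Prod>i\<in>UNIV. (x$i - c$i + h$i) * (c$i + h$i - x$i))"

fun face_factor :: "real^3 \<Rightarrow> real^3 \<Rightarrow> face \<Rightarrow> scalar_field"
  where "face_factor c h (i, s) = (\<lambda>x. h $ i - s * (x $ i - c $ i))"

text \<open>
  \<open>bubble_face c h f\<close> is the polynomial quotient of \<open>bubble_box c h\<close> by \<open>face_factor c h f\<close>, the
  linear factor vanishing on \<open>f\<close>. It is written as the product of the other five factors because
  a pointwise quotient would be \<open>0\<close> on \<open>f\<close>.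
\<close>

definition bubble_face :: "real^3 \<Rightarrow> real^3 \<Rightarrow> face \<Rightarrow> scalar_field"
  where "bubble_face c h f = (\<lambda>x. \<Prod>g \<in> faces - {f}. face_factor c h g x)"

lemma bubble_box_eq_factor_times_bubble_face:
  assumes "f \<in> faces"
  shows "bubble_box c h x = face_factor c h f x * bubble_face c h f x"
proof -
  have faces_eq: "faces = UNIV \<times> {-1, 1}"
    by (auto simp: faces_def)
  have "(\<Prod>g\<in>faces. face_factor c h g x)
      = (\<Prod>i\<in>UNIV. \<Prod>s\<in>{-1, 1}. face_factor c h (i, s) x)"
    unfolding faces_eq by (subst prod.cartesian_product) (auto intro!: prod.cong)
  also have "\<dots> = bubble_box c h x"
    unfolding bubble_box_def by (intro prod.cong) (auto simp: algebra_simps)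
  finally show ?thesis
    using assms prod.remove[of faces f "\<lambda>g. face_factor c h g x"]
    by (simp add: bubble_face_def faces_eq)
qed

definition Vf :: "real^3 \<Rightarrow> real^3 \<Rightarrow> int \<Rightarrow> face \<Rightarrow> vector_field set"
  where "Vf c h r f =
    {q \<in> cross_space (cube (poly_space UNIV (r - 2))) (\<lambda>x. face_normal f).
      \<forall>w \<in> cross_space (cube (poly_space UNIV (r - 3))) (\<lambda>x. face_normal f).
        box_integral c h
          (\<lambda>x. q x \<bullet> ((bubble_box c h x * bubble_face c h f x) *\<^sub>R w x)) = 0}"

definition V :: "real^3 \<Rightarrow> real^3 \<Rightarrow> int \<Rightarrow> vector_field set"
  where "V c h r =
    (\<lambda>v x. bubble_box c h x *\<^sub>R v x) `
      (\<Sum>f\<in>faces. (\<lambda>q x. bubble_face c h f x *\<^sub>R q x) ` Vf c h r f)"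

definition Splus1 :: "real^3 \<Rightarrow> real^3 \<Rightarrow> int \<Rightarrow> vector_field set"
  where "Splus1 c h r = S1 r + V c h r"

text \<open>
  The sums in the two test spaces below are direct: the first summands contain fields of
  lower degree only. Changing the origin of the coordinates used for the homogeneous polynomials does not change the sums.
\<close>

definition face_test :: "int \<Rightarrow> face \<Rightarrow> vector_field set"
  where "face_test r f =
    face_tangential_poly f (r - 3) + surface_grad f ` face_hom f (r - 1)"

definition interior_test :: "int \<Rightarrow> vector_field set"
  where "interior_test r =
    cube (poly_space UNIV (r - 5)) + curl ` cube (hom_space UNIV (r - 3))"

end

theory Submission
  imports Defs "HOL-Computational_Algebra.Polynomial"
begin

text \<open>
  The two halves of unisolvence are proved separately: a field in \<open>Splus1 c h r\<close> on which all degrees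
  of freedom vanish is zero, and the number of degrees of freedom is the dimension of the space.

  \<^bold>\<open>Vanishing.\<close> Write \<open>u = s + v\<close> with \<open>s\<close> in \<open>S1 r\<close> and \<open>v\<close> in \<open>V c h r\<close>. The bubble field \<open>v\<close> vanishes on the
  boundary of the box, and the orthogonality condition in the definition of \<open>Vf\<close> makes it orthogonal
  to the interior test fields. So the edge, face and interior moments of \<open>u\<close> are those of \<open>s\<close>, and these
  alone determine \<open>s\<close> (\<open>S1_unisolvent\<close>). On an edge the tangential component of \<open>s\<close> is one of the test
  polynomials. On a face, the surface rotation of the tangential trace has degree at most \<open>r - 1\<close>, and
  integration by parts shows that it is orthogonal to all such polynomials; the trace is then a
  surface gradient with a potential that is constant on the boundary (\<open>face_trace_eq_0\<close>). In the box
  the components of the curl are divisible by bubbles, the top-degree terms exclude the extra fields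
  with the functions \<open>w\<close>, and integration by parts shows that the curl is zero (\<open>interior_eq_0\<close>). What is
  left, on a face as well as in the box, is a gradient with vanishing tangential trace, which is
  excluded by \<open>gradient_bubble_eq_0\<close>: its potential is a bubble times a polynomial of so low degree that
  it can be tested against itself. Here superlinear degree matters, since the leading terms of bubbles
  contain no variable that enters linearly. With \<open>s = 0\<close>, the tangential curl of \<open>v\<close> on a face \<open>f\<close> is,
  up to a rotation, \<open>B\<^sub>f\<^sup>2 q\<^sub>f\<close>. The curl moments show that \<open>q\<^sub>f\<close> vanishes on \<open>f\<close>, and then its
  orthogonality condition shows that it is zero (\<open>bubble_field_unisolvent\<close>).

  \<^bold>\<open>Dimension.\<close> Since the degrees of freedom separate the points of the space, there are at least as
  many of them as its dimension (\<open>dim_Splus1_le\<close>). Conversely (\<open>dim_Splus1_ge\<close>), the sums defining the space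
  are direct, by the injectivity of the curl on fields \<open>q \<times> x\<close>, by homogeneity, and by the vanishing
  result itself. This bounds its dimension from below by a cubic polynomial in \<open>r\<close>, which is also an
  upper bound for the number of degrees of freedom.

  \<^bold>\<open>Representation.\<close> Monomials are linearly independent functions, so degree conditions are conditions
  on coefficients. Functions on faces and edges are represented by functions on the whole space
  with one or two coordinates frozen, and face and edge integrals are multiples of box integrals of
  such functions. Integration by parts and positivity are thus used for the box only.
\<close>

section \<open>Linear algebra on subspaces\<close>

lemma fun_sum_apply: "(\<Sum>i\<in>I. f i) x = (\<Sum>i\<in>I. f i x)" for f :: "'i \<Rightarrow> 'x \<Rightarrow> 'y::comm_monoid_add"
  by (induction I rule: infinite_finite_induct) auto

text \<open>
  Differentiation and integration are linear on polynomial functions only, so linearity is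
  recorded relative to a subspace.
\<close>

definition linear_on :: "'a::real_vector set \<Rightarrow> ('a \<Rightarrow> 'b::real_vector) \<Rightarrow> bool"
  where "linear_on W f \<longleftrightarrow>
    (\<forall>x\<in>W. \<forall>y\<in>W. f (x + y) = f x + f y) \<and> (\<forall>c. \<forall>x\<in>W. f (c *\<^sub>R x) = c *\<^sub>R f x)"

lemma linear_onI:
  assumes "\<And>x y. x \<in> W \<Longrightarrow> y \<in> W \<Longrightarrow> f (x + y) = f x + f y"
    and "\<And>c x. x \<in> W \<Longrightarrow> f (c *\<^sub>R x) = c *\<^sub>R f x"
  shows "linear_on W f"
  using assms by (auto simp: linear_on_def)

lemma linear_on_add: "linear_on W f \<Longrightarrow> x \<in> W \<Longrightarrow> y \<in> W \<Longrightarrow> f (x + y) = f x + f y"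
  by (auto simp: linear_on_def)

lemma linear_on_scale: "linear_on W f \<Longrightarrow> x \<in> W \<Longrightarrow> f (c *\<^sub>R x) = c *\<^sub>R f x"
  by (auto simp: linear_on_def)

lemma linear_on_0: "linear_on W f \<Longrightarrow> subspace W \<Longrightarrow> f 0 = 0"
  using linear_on_scale[of W f 0 0] by (auto simp: subspace_0)

lemma linear_on_subset: "linear_on W f \<Longrightarrow> U \<subseteq> W \<Longrightarrow> linear_on U f"
  unfolding linear_on_def by blast

lemma linear_imp_linear_on: "linear f \<Longrightarrow> linear_on W f"
  by (auto simp: linear_on_def linear_add linear_scale)

text \<open>
  A map that is linear on a subspace agrees there with a globally linear one, namely the extension
  of its values on a basis of the subspace. This makes all results on linear maps available.
\<close>

lemma linear_on_extend:
  assumes W: "subspace W" and f: "linear_on W f"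
  obtains g where "linear g" "\<And>x. x \<in> W \<Longrightarrow> g x = f x"
proof -
  obtain B where B: "B \<subseteq> W" "independent B" "W \<subseteq> span B"
    using maximal_independent_subset by blast
  obtain g where g: "linear g" "\<forall>x\<in>B. g x = f x"
    using linear_independent_extend[OF B(2)] by blast
  have "x \<in> W \<and> g x = f x" if "x \<in> span B" for x
    using that
  proof (induction rule: span_induct_alt)
    case base
    then show ?case using W f g by (auto simp: subspace_0 linear_on_0 linear_0)
  next
    case (step c b y)
    then have "b \<in> W" "c *\<^sub>R b \<in> W" using B W by (auto simp: subspace_scale)
    with step show ?case
      using g W by (auto simp: subspace_add linear_add linear_scale linear_on_add[OF f] linear_on_scale[OF f])
  qed
  with B(3) g(1) that show thesis by blast
qed

lemma subspace_linear_on_image: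
  assumes "subspace W" "linear_on W f"
  shows "subspace (f ` W)"
proof -
  obtain g where g: "linear g" "\<And>x. x \<in> W \<Longrightarrow> g x = f x"
    using linear_on_extend[OF assms] by blast
  then have "f ` W = g ` W" by simp
  then show ?thesis using linear_subspace_image[OF g(1) assms(1)] by simp
qed

lemma dim_zero: "dim {0::'a::real_vector} = 0"
  using dim_le_card[of "{0::'a}" "{}"] by simp

text \<open>
  Function spaces are infinite-dimensional, and \<open>dim\<close> is \<open>0\<close> for subspaces without a finite basis;
  statements about \<open>dim\<close> therefore carry this finiteness condition.
\<close>

definition fin_dim :: "'a::real_vector set \<Rightarrow> bool"
  where "fin_dim S \<longleftrightarrow> (\<exists>B. finite B \<and> S \<subseteq> span B)"

lemma fin_dim_subset: "fin_dim T \<Longrightarrow> S \<subseteq> T \<Longrightarrow> fin_dim S"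
  by (auto simp: fin_dim_def)

lemma fin_dim_span: "finite B \<Longrightarrow> fin_dim (span B)"
  by (auto simp: fin_dim_def)

lemma fin_dim_basis:
  assumes "fin_dim S"
  obtains B where "B \<subseteq> S" "independent B" "finite B" "S \<subseteq> span B" "card B = dim S"
proof -
  obtain C where C: "finite C" "S \<subseteq> span C" using assms by (auto simp: fin_dim_def)
  obtain B where B: "B \<subseteq> S" "independent B" "S \<subseteq> span B" "card B = dim S"
    using basis_exists by blast
  moreover have "finite B"
    using independent_span_bound[OF C(1) B(2)] B(1) C(2) by auto
  ultimately show thesis using that by blast
qed

lemma card_le_dim:
  assumes "fin_dim S" "B \<subseteq> S" "independent B"
  shows "finite B \<and> card B \<le> dim S"
proof -
  obtain C where C: "C \<subseteq> S" "independent C" "finite C" "S \<subseteq> span C" "card C = dim S"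
    using fin_dim_basis[OF assms(1)] by blast
  show ?thesis using independent_span_bound[OF C(3) assms(3)] assms(2) C(4,5) by auto
qed

lemma dim_mono:
  assumes "fin_dim T" "S \<subseteq> T" shows "dim S \<le> dim T"
  using fin_dim_basis[OF fin_dim_subset[OF assms]] card_le_dim[OF assms(1)] assms(2)
  by (metis subset_trans)

lemma fin_dim_linear_on_image:
  assumes "subspace W" "linear_on W f" "fin_dim W"
  shows "fin_dim (f ` W)"
proof -
  obtain g where g: "linear g" "\<And>x. x \<in> W \<Longrightarrow> g x = f x"
    using linear_on_extend[OF assms(1,2)] by blast
  obtain B where "finite B" "W \<subseteq> span B" using assms(3) by (auto simp: fin_dim_def)
  then have "g ` W \<subseteq> span (g ` B)" by (auto simp: linear_span_image[OF g(1)])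
  with g(2) \<open>finite B\<close> show ?thesis by (auto simp: fin_dim_def intro!: exI[of _ "g ` B"])
qed

text \<open>
  Extend a basis of the kernel to a basis of the space: the images of the added vectors span the
  range, which gives one inequality. Conversely, preimages of a basis of the range together with a
  basis of the kernel span the space.
\<close>

lemma rank_nullity:
  assumes W: "subspace W" and fin: "fin_dim W" and f: "linear_on W f"
  shows "dim {v \<in> W. f v = 0} + dim (f ` W) = dim W"
proof -
  let ?K = "{v \<in> W. f v = 0}"
  obtain g where g: "linear g" "\<And>x. x \<in> W \<Longrightarrow> g x = f x"
    using linear_on_extend[OF W f] by blast
  have fg: "f ` W = g ` W" using g by simp
  have spanV: "span W = W" using W by (simp add: span_eq_iff)
  obtain C where C: "C \<subseteq> ?K" "independent C" "finite C" "?K \<subseteq> span C" "card C = dim ?K"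
    using fin_dim_basis[OF fin_dim_subset[OF fin, of ?K]] by auto
  obtain B where B: "C \<subseteq> B" "B \<subseteq> W" "independent B" "W \<subseteq> span B"
    using maximal_independent_subset_extend[of C W] C(1,2) by auto
  have finB: "finite B" and cardB: "card B \<le> dim W" using card_le_dim[OF fin B(2,3)] by auto
  \<comment> \<open>a basis vector of the kernel contributes nothing to the image\<close>
  have "g ` W \<subseteq> span (g ` (B - C))"
  proof
    fix y assume "y \<in> g ` W"
    then obtain x where x: "x \<in> span B" "y = g x" using B(4) by auto
    have "span B = span (C \<union> (B - C))" using B(1) by (simp add: Un_absorb1)
    then obtain x1 x2 where xx: "x1 \<in> span C" "x2 \<in> span (B - C)" "x = x1 + x2"
      using x(1) span_Un[of C "B - C"] by auto
    have "g x1 = 0"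
      using xx(1)
    proof (induction rule: span_induct_alt)
      case base then show ?case using g(1) by (simp add: linear_0)
    next
      case (step c b y)
      then have "g b = 0" using C(1) g(2) by auto
      with step show ?case using g(1) by (simp add: linear_add linear_scale)
    qed
    then have "y = g x2" using x xx g(1) by (simp add: linear_add)
    then show "y \<in> span (g ` (B - C))" using xx(2) by (auto simp: linear_span_image[OF g(1)])
  qed
  then have "dim (g ` W) \<le> card (g ` (B - C))" by (rule dim_le_card) (use finB in auto)
  also have "\<dots> \<le> card (B - C)" by (rule card_image_le) (use finB in auto)
  also have "\<dots> = card B - card C" using B(1) finB by (simp add: card_Diff_subset C(3))
  finally have le: "dim ?K + dim (f ` W) \<le> dim W"
    using cardB C(5) card_mono[OF finB B(1)] fg by simp
  obtain D where D: "D \<subseteq> f ` W" "independent D" "finite D" "f ` W \<subseteq> span D" "card D = dim (f ` W)"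
    using fin_dim_basis[OF fin_dim_linear_on_image[OF W f fin]] by auto
  obtain D' where D': "D' \<subseteq> W" "D = f ` D'" "inj_on f D'"
    using D(1) by (auto simp: subset_image_inj)
  have finD': "finite D'" using D' D(3) finite_imageD by blast
  have "W \<subseteq> span (C \<union> D')"
  proof
    fix v assume v: "v \<in> W"
    have "g ` D' = D" using D' g by (auto simp: image_iff subset_eq)
    then have "g v \<in> g ` span D'" using v D(4) g(2) by (auto simp: linear_span_image[OF g(1)] subset_eq)
    then obtain d where d: "d \<in> span D'" "g v = g d" by auto
    have dV: "d \<in> W" using d(1) span_mono[OF D'(1)] spanV by auto
    have "v - d \<in> ?K" using d v dV W g linear_diff[OF g(1), of v d] by (auto simp: subspace_diff)
    then have "v - d \<in> span C" using C(4) by auto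
    then have "v - d + d \<in> span (C \<union> D')"
      using d(1) by (intro span_add) (meson span_mono subsetD sup_ge1 sup_ge2)+
    then show "v \<in> span (C \<union> D')" by simp
  qed
  then have "dim W \<le> card (C \<union> D')" by (rule dim_le_card) (use finD' C in auto)
  also have "\<dots> \<le> card C + card D'" by (rule card_Un_le)
  also have "card D' = card D" using D'(2,3) by (simp add: card_image)
  finally show ?thesis using le C(5) D(5) by simp
qed

lemma dim_injective_image:
  assumes "subspace W" "fin_dim W" "linear_on W f" "\<And>v. v \<in> W \<Longrightarrow> f v = 0 \<Longrightarrow> v = 0"
  shows "dim (f ` W) = dim W"
proof -
  have "{v \<in> W. f v = 0} = {0}" using assms by (auto simp: subspace_0 linear_on_0)
  then have "dim {v \<in> W. f v = 0} = 0" by (simp only: dim_zero)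
  then show ?thesis using rank_nullity[OF assms(1-3)] by simp
qed

lemma dim_image_le:
  assumes "subspace W" "fin_dim W" "linear_on W f"
  shows "dim (f ` W) \<le> dim W"
  using rank_nullity[OF assms] by simp

lemma fin_dim_plus:
  fixes A B :: "'a::real_vector set"
  assumes "fin_dim A" "fin_dim B"
  shows "fin_dim (A + B)"
proof -
  obtain C D where C: "finite C" "A \<subseteq> span C" and D: "finite D" "B \<subseteq> span D"
    using assms by (auto simp: fin_dim_def)
  have "A + B \<subseteq> span (C \<union> D)"
    using C(2) D(2) by (auto simp: set_plus_def span_Un)
  with C(1) D(1) show ?thesis by (auto simp: fin_dim_def intro!: exI[of _ "C \<union> D"])
qed

lemma subspace_plus: "subspace A \<Longrightarrow> subspace B \<Longrightarrow> subspace (A + B)"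
  for A B :: "'a::real_vector set"
proof -
  assume *: "subspace A" "subspace B"
  have "A + B = {x + y |x y. x \<in> A \<and> y \<in> B}" by (auto simp: set_plus_def)
  then show "subspace (A + B)" using subspace_sums[OF *] by simp
qed

lemma dim_plus_le:
  fixes A B :: "'a::real_vector set"
  assumes "fin_dim A" "fin_dim B"
  shows "dim (A + B) \<le> dim A + dim B"
proof -
  obtain C where C: "finite C" "A \<subseteq> span C" "card C = dim A"
    using fin_dim_basis[OF assms(1)] by metis
  obtain D where D: "finite D" "B \<subseteq> span D" "card D = dim B"
    using fin_dim_basis[OF assms(2)] by metis
  have "A + B \<subseteq> span (C \<union> D)"
    using C(2) D(2) by (auto simp: set_plus_def span_Un)
  then have "dim (A + B) \<le> card (C \<union> D)" by (rule dim_le_card) (use C D in auto)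
  also have "\<dots> \<le> dim A + dim B" using card_Un_le[of C D] C D by simp
  finally show ?thesis .
qed

text \<open>
  The vectors of a basis of \<open>B\<close> are added one by one to a basis of \<open>A\<close>; the set stays independent
  because a dependency would produce a nonzero common vector of \<open>A\<close> and \<open>B\<close>.
\<close>

lemma dim_plus_direct:
  fixes A B :: "'a::real_vector set"
  assumes A: "subspace A" "fin_dim A" and B: "subspace B" "fin_dim B" and AB: "A \<inter> B \<subseteq> {0}"
  shows "dim (A + B) = dim A + dim B"
proof -
  obtain C where C: "C \<subseteq> A" "independent C" "finite C" "A \<subseteq> span C" "card C = dim A"
    using fin_dim_basis[OF A(2)] by metis
  obtain D where D: "D \<subseteq> B" "independent D" "finite D" "B \<subseteq> span D" "card D = dim B"
    using fin_dim_basis[OF B(2)] by metis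
  have CA: "span C \<subseteq> A" using C(1) A(1) by (simp add: span_minimal)
  have "independent (C \<union> E) \<and> C \<inter> E = {}" if "E \<subseteq> D" for E
    using finite_subset[OF that D(3)] that
  proof (induction E rule: finite_induct)
    case empty then show ?case using C by simp
  next
    case (insert b E)
    have EB: "span E \<subseteq> B" using insert.prems D(1) B(1) by (intro span_minimal) auto
    have bB: "b \<in> B" using insert.prems D(1) by auto
    have "independent (insert b E)" using insert.prems D(2) independent_mono by blast
    then have bE: "b \<notin> span E" using insert.hyps by (simp add: independent_insert)
    have "b \<notin> span (C \<union> E)"
    proof
      assume "b \<in> span (C \<union> E)"
      then obtain x y where xy: "x \<in> span C" "y \<in> span E" "b = x + y" by (auto simp: span_Un)
      then have "x = b - y" by simp
      then have "x \<in> B" using bB EB xy(2) B(1) by (auto simp: subspace_diff)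
      then have "x = 0" using xy(1) CA AB by auto
      then show False using xy bE by simp
    qed
    then have "independent (insert b (C \<union> E))" "b \<notin> C"
      using insert by (auto simp: independent_insert span_base)
    then show ?case using insert by auto
  qed
  from this[of D] have ind: "independent (C \<union> D)" "C \<inter> D = {}" by auto
  have "0 \<in> A" "0 \<in> B" using A B by (auto simp: subspace_0)
  then have "C \<union> D \<subseteq> A + B"
    using C(1) D(1) by (auto simp: set_plus_def) (metis add.right_neutral subsetD, metis add.left_neutral subsetD)
  from card_le_dim[OF fin_dim_plus[OF A(2) B(2)] this ind(1)]
  have "dim A + dim B \<le> dim (A + B)" using C D ind(2) by (simp add: card_Un_disjoint)
  with dim_plus_le[OF A(2) B(2)] show ?thesis by simp
qed

lemma subspace_fin_dim_sum:
  assumes "finite I" "\<And>i. i \<in> I \<Longrightarrow> subspace (A i)" "\<And>i. i \<in> I \<Longrightarrow> fin_dim (A i)"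
  shows "subspace (\<Sum>i\<in>I. A i) \<and> fin_dim (\<Sum>i\<in>I. A i)"
  using assms
proof (induction I rule: finite_induct)
  case empty
  have "fin_dim {0::'b}" by (auto simp: fin_dim_def intro!: exI[of _ "{}"])
  then show ?case by (simp add: set_zero)
next
  case (insert i I)
  then show ?case by (auto intro!: subspace_plus fin_dim_plus)
qed

lemma dim_sum_direct:
  assumes "finite I" "\<And>i. i \<in> I \<Longrightarrow> subspace (A i)" "\<And>i. i \<in> I \<Longrightarrow> fin_dim (A i)"
    and "\<And>x. (\<And>i. i \<in> I \<Longrightarrow> x i \<in> A i) \<Longrightarrow> (\<Sum>i\<in>I. x i) = 0 \<Longrightarrow> \<forall>i\<in>I. x i = 0"
  shows "dim (\<Sum>i\<in>I. A i) = (\<Sum>i\<in>I. dim (A i))"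
  using assms
proof (induction I rule: finite_induct)
  case empty
  show ?case by (simp add: dim_zero del: span_empty)
next
  case (insert i I)
  have set_coord: "subspace (\<Sum>i\<in>I. A i)" "fin_dim (\<Sum>i\<in>I. A i)"
    using subspace_fin_dim_sum[of I A] insert by auto
  have IH: "dim (\<Sum>i\<in>I. A i) = (\<Sum>i\<in>I. dim (A i))"
  proof (rule insert.IH)
    fix x assume x: "\<And>i. i \<in> I \<Longrightarrow> x i \<in> A i" "(\<Sum>i\<in>I. x i) = 0"
    let ?y = "\<lambda>j. if j \<in> I then x j else 0"
    have "(\<Sum>j\<in>I. ?y j) = 0" using x(2) by simp
    then have "(\<Sum>j\<in>insert i I. ?y j) = 0" using insert.hyps by simp
    then have "\<forall>j\<in>insert i I. ?y j = 0"
      using x(1) insert.hyps insert.prems(1) by (intro insert.prems(3)) (auto simp: subspace_0)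
    then show "\<forall>j\<in>I. x j = 0" by auto
  qed (use insert in auto)
  have "A i \<inter> (\<Sum>i\<in>I. A i) \<subseteq> {0}"
  proof
    fix a assume a: "a \<in> A i \<inter> (\<Sum>i\<in>I. A i)"
    then obtain x where x: "a = (\<Sum>j\<in>I. x j)" "\<And>j. j \<in> I \<Longrightarrow> x j \<in> A j"
      using set_sum_alt[OF insert.hyps(1), of A] by auto
    let ?y = "\<lambda>j. if j \<in> I then x j else - a"
    have ya: "(\<Sum>j\<in>I. ?y j) = a" using x(1) by simp
    then have y0: "(\<Sum>j\<in>insert i I. ?y j) = 0"
      unfolding sum.insert[OF insert.hyps] by (simp add: insert.hyps)
    have "\<forall>j\<in>insert i I. ?y j = 0"
    proof (rule insert.prems(3))
      fix j assume "j \<in> insert i I"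
      then show "?y j \<in> A j" using x(2) a insert.prems(1) by (auto simp: subspace_neg)
    qed (rule y0)
    then show "a \<in> {0}" using insert.hyps by auto
  qed
  then have "dim (A i + (\<Sum>i\<in>I. A i)) = dim (A i) + dim (\<Sum>i\<in>I. A i)"
    using insert.prems set_coord by (intro dim_plus_direct) auto
  then show ?case using IH insert.hyps by simp
qed

text \<open>
  A finite product is the direct sum of its coordinate axes.
\<close>

lemma dim_product:
  fixes A :: "'i::finite \<Rightarrow> 'v::real_vector set"
  assumes "\<And>i. subspace (A i)" "\<And>i. fin_dim (A i)"
  shows "subspace {w. \<forall>i. w i \<in> A i}" "fin_dim {w. \<forall>i. w i \<in> A i}"
    "dim {w. \<forall>i. w i \<in> A i} = (\<Sum>i\<in>UNIV. dim (A i))"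
proof -
  define emb :: "'i \<Rightarrow> 'v \<Rightarrow> 'i \<Rightarrow> 'v" where "emb = (\<lambda>i a j. if j = i then a else 0)"
  have lin: "linear (emb i)" for i
    by (rule linearI) (auto simp: emb_def fun_eq_iff scaleR_fun_def)
  have set_coord: "subspace (emb i ` A i)" for i
    using linear_subspace_image[OF lin assms(1)] .
  have fin: "fin_dim (emb i ` A i)" for i
    using fin_dim_linear_on_image[OF assms(1) linear_imp_linear_on[OF lin] assms(2)] .
  have dims: "dim (emb i ` A i) = dim (A i)" for i
    using assms lin by (intro dim_injective_image) (auto simp: linear_imp_linear_on emb_def fun_eq_iff split: if_splits)
  have sums: "(\<Sum>i\<in>UNIV. emb i (w i)) = w" for w
  proof
    fix j
    have "(\<Sum>i\<in>UNIV. emb i (w i)) j = (\<Sum>i\<in>UNIV. if j = i then w i else 0)"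
      unfolding fun_sum_apply emb_def ..
    then show "(\<Sum>i\<in>UNIV. emb i (w i)) j = w j" by simp
  qed
  have eq: "{w. \<forall>i. w i \<in> A i} = (\<Sum>i\<in>UNIV. emb i ` A i)"
  proof (intro equalityI subsetI)
    fix w assume "w \<in> {w. \<forall>i. w i \<in> A i}"
    then show "w \<in> (\<Sum>i\<in>UNIV. emb i ` A i)"
      using sums[of w] by (subst set_sum_alt) (auto intro!: exI[of _ "\<lambda>i. emb i (w i)"])
  next
    fix w assume "w \<in> (\<Sum>i\<in>UNIV. emb i ` A i)"
    then obtain s where s: "w = sum s UNIV" "\<And>i. s i \<in> emb i ` A i"
      by (subst (asm) set_sum_alt) auto
    then have "\<forall>i. \<exists>a. a \<in> A i \<and> s i = emb i a" by blast
    then obtain a where a: "\<And>i. a i \<in> A i" "\<And>i. s i = emb i (a i)" by metis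
    then have "w = a" using s(1) sums[of a] by simp
    then show "w \<in> {w. \<forall>i. w i \<in> A i}" using a by simp
  qed
  have "dim (\<Sum>i\<in>UNIV. emb i ` A i) = (\<Sum>i\<in>UNIV. dim (emb i ` A i))"
  proof (rule dim_sum_direct)
    fix x assume x: "\<And>i. i \<in> UNIV \<Longrightarrow> x i \<in> emb i ` A i" "(\<Sum>i\<in>UNIV. x i) = 0"
    then have "\<forall>i. \<exists>a. a \<in> A i \<and> x i = emb i a" by blast
    then obtain a where a: "\<And>i. a i \<in> A i" "\<And>i. x i = emb i (a i)" by metis
    then have "a = 0" using x(2) sums[of a] by simp
    then show "\<forall>i\<in>UNIV. x i = 0" using a(2) by (auto simp: emb_def fun_eq_iff)
  qed (use set_coord fin in auto)
  with eq dims show "dim {w. \<forall>i. w i \<in> A i} = (\<Sum>i\<in>UNIV. dim (A i))" by simp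
  show "subspace {w. \<forall>i. w i \<in> A i}" "fin_dim {w. \<forall>i. w i \<in> A i}"
    using subspace_fin_dim_sum[of UNIV "\<lambda>i. emb i ` A i"] set_coord fin eq by auto
qed

text \<open>
  Evaluating all functionals of \<open>L\<close> maps \<open>W\<close> to a space with at most \<open>card L\<close> dimensions. This
  bounds the dimension of a space from above by the number of functionals that separate its points,
  and the dimension of a subspace cut out by orthogonality conditions from below.
\<close>

lemma dim_le_functionals:
  fixes L :: "('a::real_vector \<Rightarrow> real) set"
  assumes W: "subspace W" "fin_dim W" and L: "finite L" "\<And>l. l \<in> L \<Longrightarrow> linear_on W l"
  shows "dim W \<le> dim {v \<in> W. \<forall>l\<in>L. l v = 0} + card L"
proof -
  define F where "F = (\<lambda>v l. if l \<in> L then l v else 0)"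
  have lin: "linear_on W F"
    using L(2) by (intro linear_onI) (auto simp: F_def fun_eq_iff scaleR_fun_def linear_on_def)
  define d :: "('a \<Rightarrow> real) \<Rightarrow> ('a \<Rightarrow> real) \<Rightarrow> real" where "d = (\<lambda>l k. if k = l then 1 else 0)"
  have "F v \<in> span (d ` L)" for v
  proof -
    have "F v = (\<Sum>l\<in>L. l v *\<^sub>R d l)"
    proof
      fix k
      have "(\<Sum>l\<in>L. l v *\<^sub>R d l) k = (\<Sum>l\<in>L. if k = l then l v else 0)"
        unfolding fun_sum_apply by (intro sum.cong) (auto simp: scaleR_fun_def d_def)
      then show "F v k = (\<Sum>l\<in>L. l v *\<^sub>R d l) k" using L(1) by (simp add: F_def)
    qed
    also have "\<dots> \<in> span (d ` L)" by (intro span_sum span_scale span_base) auto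
    finally show ?thesis .
  qed
  then have "dim (F ` W) \<le> card (d ` L)" using L(1) by (intro dim_le_card) auto
  also have "\<dots> \<le> card L" using L(1) by (rule card_image_le)
  finally have "dim (F ` W) \<le> card L" .
  moreover have "{v \<in> W. F v = 0} = {v \<in> W. \<forall>l\<in>L. l v = 0}"
    by (auto simp: F_def fun_eq_iff)
  ultimately show ?thesis using rank_nullity[OF W lin] by simp
qed

section \<open>Polynomial functions and their coefficients\<close>

definition mspan :: "(3 \<Rightarrow> nat) set \<Rightarrow> scalar_field set"
  where "mspan A = span (monom_fun ` A)"

abbreviation Poly :: "scalar_field set"
  where "Poly \<equiv> mspan UNIV"

lemma subspace_mspan: "subspace (mspan A)"
  by (simp add: mspan_def)

lemma monom_in_mspan: "a \<in> A \<Longrightarrow> monom_fun a \<in> mspan A"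
  by (simp add: mspan_def span_base)

lemma mspan_mono: "A \<subseteq> B \<Longrightarrow> mspan A \<subseteq> mspan B"
  by (auto simp: mspan_def intro!: span_mono image_mono)

lemma mspan_Poly: "p \<in> mspan A \<Longrightarrow> p \<in> Poly"
  using mspan_mono[of A UNIV] by auto

lemma mspan_induct [consumes 1, case_names zero monom add scale]:
  assumes "p \<in> mspan A" "P (\<lambda>x. 0)" "\<And>a. a \<in> A \<Longrightarrow> P (monom_fun a)"
    and "\<And>p q. p \<in> mspan A \<Longrightarrow> q \<in> mspan A \<Longrightarrow> P p \<Longrightarrow> P q \<Longrightarrow> P (\<lambda>x. p x + q x)"
    and "\<And>c p. p \<in> mspan A \<Longrightarrow> P p \<Longrightarrow> P (\<lambda>x. c * p x)"
  shows "P p"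
proof -
  have *: "p \<in> span (monom_fun ` A)" using assms(1) by (simp add: mspan_def)
  have "p \<in> mspan A \<and> P p"
    using *
  proof (induction rule: span_induct_alt)
    case base
    then show ?case using assms(2) using subspace_0[OF subspace_mspan, of A] by (simp add: zero_fun_def)
  next
    case (step c b y)
    then obtain a where a: "a \<in> A" "b = monom_fun a" by auto
    then have b: "b \<in> mspan A" "P b" using assms(3) monom_in_mspan by auto
    have cb: "c *\<^sub>R b = (\<lambda>x. c * b x)" by (simp add: scaleR_fun_def)
    have "c *\<^sub>R b \<in> mspan A" "P (c *\<^sub>R b)"
      using assms(5)[OF b] subspace_scale[OF subspace_mspan b(1), of c] unfolding cb by auto
    then show ?case using step assms(4)[of "c *\<^sub>R b" y]
      by (auto simp: plus_fun_def subspace_add[OF subspace_mspan, unfolded plus_fun_def])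
  qed
  then show ?thesis by simp
qed

lemma mspan_zero: "(\<lambda>x. 0) \<in> mspan A"
  using subspace_0[OF subspace_mspan] by (simp add: zero_fun_def)

lemma mspan_add: "p \<in> mspan A \<Longrightarrow> q \<in> mspan A \<Longrightarrow> (\<lambda>x. p x + q x) \<in> mspan A"
  using subspace_add[OF subspace_mspan] by (simp add: plus_fun_def)

lemma mspan_diff: "p \<in> mspan A \<Longrightarrow> q \<in> mspan A \<Longrightarrow> (\<lambda>x. p x - q x) \<in> mspan A"
  using subspace_diff[OF subspace_mspan, of p A q] by (simp add: fun_diff_def)

lemma mspan_scale: "p \<in> mspan A \<Longrightarrow> (\<lambda>x. c * p x) \<in> mspan A"
  using subspace_scale[OF subspace_mspan, of p A c] by (simp add: scaleR_fun_def)

lemma mspan_uminus: "p \<in> mspan A \<Longrightarrow> (\<lambda>x. - p x) \<in> mspan A"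
  using mspan_scale[of p A "-1"] by simp

lemma mspan_sum: "(\<And>i. i \<in> I \<Longrightarrow> p i \<in> mspan A) \<Longrightarrow> (\<lambda>x. \<Sum>i\<in>I. p i x) \<in> mspan A"
  by (induction I rule: infinite_finite_induct) (auto intro: mspan_zero mspan_add)

lemma monom_fun_mult: "monom_fun a x * monom_fun b x = monom_fun (\<lambda>j. a j + b j) x"
  by (simp add: monom_fun_def power_add prod.distrib)

lemma Poly_mult:
  assumes "p \<in> Poly" "q \<in> Poly"
  shows "(\<lambda>x. p x * q x) \<in> Poly"
  using assms(1)
proof (induction rule: mspan_induct)
  case (monom a)
  show ?case using assms(2)
  proof (induction rule: mspan_induct)
    case (monom b)
    then show ?case by (simp add: monom_fun_mult monom_in_mspan)
  next
    case (add p q)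
    then show ?case using mspan_add by (simp add: distrib_left)
  next
    case (scale c p)
    then show ?case using mspan_scale[of _ UNIV c] by (simp add: mult.left_commute)
  qed (simp add: mspan_zero)
next
  case (add p q)
  then show ?case using mspan_add by (simp add: distrib_right)
next
  case (scale c p)
  then show ?case using mspan_scale[of _ UNIV c] by (simp add: mult.assoc)
qed (simp add: mspan_zero)

lemma monom_fun_0: "monom_fun (\<lambda>j. 0) = (\<lambda>x. 1)"
  by (simp add: monom_fun_def fun_eq_iff)

lemma mspan_const: "(\<lambda>j. 0) \<in> A \<Longrightarrow> (\<lambda>x. k) \<in> mspan A"
  using mspan_scale[OF monom_in_mspan[of "\<lambda>j. 0" A], of k] by (simp add: monom_fun_0)

lemma Poly_const: "(\<lambda>x. k) \<in> Poly"
  by (simp add: mspan_const)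

lemma monom_fun_inc: "monom_fun (a(i := Suc (a i))) x = x $ i * monom_fun a x"
proof -
  have "(\<Prod>j\<in>UNIV. x $ j ^ (a(i := Suc (a i))) j) = (\<Prod>j\<in>UNIV. (if j = i then x $ i else 1) * x $ j ^ a j)"
    by (intro prod.cong) auto
  then show ?thesis by (simp add: monom_fun_def prod.distrib)
qed

lemma mspan_coord_mult:
  assumes "p \<in> mspan A" "\<And>a. a \<in> A \<Longrightarrow> a(i := Suc (a i)) \<in> B"
  shows "(\<lambda>x. x $ i * p x) \<in> mspan B"
  using assms(1)
proof (induction rule: mspan_induct)
  case (monom a)
  then show ?case using assms(2) monom_in_mspan by (simp flip: monom_fun_inc)
next
  case (add p q)
  then show ?case using mspan_add by (simp add: distrib_left)
next
  case (scale c p)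
  then show ?case using mspan_scale[of _ B c] by (simp add: mult.left_commute)
qed (simp add: mspan_zero)

lemma Poly_coord: "(\<lambda>x. x $ i) \<in> Poly"
  using mspan_coord_mult[OF Poly_const[of 1], of i UNIV] by simp

lemmas Poly_intros = mspan_add[where A=UNIV] mspan_diff[where A=UNIV] Poly_mult Poly_const
  Poly_coord mspan_sum[where A=UNIV] mspan_uminus[where A=UNIV]

lemma Poly_prod: "(\<And>i. i \<in> I \<Longrightarrow> p i \<in> Poly) \<Longrightarrow> (\<lambda>x. \<Prod>i\<in>I. p i x) \<in> Poly"
  by (induction I rule: infinite_finite_induct) (auto intro: Poly_intros)

text \<open>
  Restriction to polynomial curves reduces identities between polynomials in three variables to the
  fact that a nonzero univariate polynomial has finitely many zeros. The two curves used are
  \<open>(t, t^N, t^(N\<^sup>2))\<close>, which separates monomials, and straight lines through a point of the box.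
\<close>

lemma Poly_along_curve:
  assumes "p \<in> Poly"
  shows "\<exists>P::real poly. \<forall>t. poly P t = p (\<chi> j. poly (G j) t)"
  using assms
proof (induction rule: mspan_induct)
  case zero
  then show ?case by (intro exI[of _ 0]) simp
next
  case (monom a)
  then show ?case
    by (intro exI[of _ "\<Prod>j\<in>UNIV. G j ^ a j"]) (simp add: monom_fun_def poly_prod poly_power)
next
  case (add p q)
  then obtain P Q where "\<forall>t. poly P t = p (\<chi> j. poly (G j) t)" "\<forall>t. poly Q t = q (\<chi> j. poly (G j) t)"
    by blast
  then show ?case by (intro exI[of _ "P + Q"]) simp
next
  case (scale c p)
  then obtain P where "\<forall>t. poly P t = p (\<chi> j. poly (G j) t)"
    by blast
  then show ?case by (intro exI[of _ "smult c P"]) simp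
qed

lemma prod_over_3: "prod f (UNIV :: 3 set) = f 1 * f 2 * (f 3 :: 'a :: comm_monoid_mult)"
  unfolding UNIV_3 by (simp add: ac_simps)

text \<open>
  Uniqueness of the digits of a number in base \<open>N\<close>.
\<close>

lemma kronecker_exponent_inj:
  fixes a b :: "3 \<Rightarrow> nat"
  assumes "\<And>j. a j < N" "\<And>j. b j < N"
    and "a 1 + N * (a 2 + N * a 3) = b 1 + N * (b 2 + N * b 3)"
  shows "a = b"
proof -
  have 1: "a 1 = b 1"
    using arg_cong[OF assms(3), of "\<lambda>n. n mod N"] assms(1)[of 1] assms(2)[of 1] by simp
  have N: "N > 0" using assms(1)[of 1] by simp
  then have e: "a 2 + N * a 3 = b 2 + N * b 3" using assms(3) 1 by simp
  have 2: "a 2 = b 2"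
    using arg_cong[OF e, of "\<lambda>n. n mod N"] assms(1)[of 2] assms(2)[of 2] by simp
  have 3: "a 3 = b 3" using e 2 N by simp
  show ?thesis using 1 2 3 by (simp add: fun_eq_iff forall_3)
qed

text \<open>
  Kronecker substitution: on the curve \<open>(t, t^N, t^(N\<^sup>2))\<close> with \<open>N\<close> larger than every exponent,
  distinct monomials restrict to distinct powers of \<open>t\<close>.
\<close>

lemma monomials_linear_independent:
  assumes "finite A" "\<And>x. (\<Sum>a\<in>A. f a * monom_fun a x) = 0" "b \<in> A"
  shows "f b = 0"
proof -
  define N where "N = Suc (\<Sum>a\<in>A. \<Sum>j\<in>UNIV. a j)"
  define e where "e = (\<lambda>a::3\<Rightarrow>nat. a 1 + N * (a 2 + N * a 3))"
  have N: "a j < N" if "a \<in> A" for a j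
  proof -
    have "a j \<le> (\<Sum>j\<in>UNIV. a j)" by (rule member_le_sum) auto
    also have "\<dots> \<le> (\<Sum>a\<in>A. \<Sum>j\<in>UNIV. a j)" using assms(1) that by (intro member_le_sum) auto
    finally show ?thesis by (simp add: N_def)
  qed
  have inj: "inj_on e A"
  proof (rule inj_onI)
    fix a b assume ab: "a \<in> A" "b \<in> A" "e a = e b"
    show "a = b"
      by (rule kronecker_exponent_inj[OF N[OF ab(1)] N[OF ab(2)]]) (rule ab(3)[unfolded e_def])
  qed
  define P where "P = (\<Sum>a\<in>A. Polynomial.monom (f a) (e a))"
  have "poly P t = 0" for t
  proof -
    define x :: "real^3" where "x = vector [t, t ^ N, t ^ (N * N)]"
    have "monom_fun a x = t ^ e a" for a
    proof -
      have "monom_fun a x = t ^ a 1 * (t ^ N) ^ a 2 * (t ^ (N * N)) ^ a 3"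
        by (simp only: monom_fun_def prod_over_3 vector_3 x_def)
      also have "\<dots> = t ^ e a"
        by (simp only: e_def distrib_left power_add power_mult mult.assoc)
      finally show ?thesis .
    qed
    then show ?thesis using assms(2)[of x] by (simp add: P_def poly_sum poly_monom)
  qed
  then have "P = 0" using poly_all_0_iff_0 by blast
  then have "0 = coeff P (e b)" by simp
  also have "\<dots> = (\<Sum>a\<in>A. if a = b then f a else 0)"
    unfolding P_def coeff_sum coeff_monom
    using inj assms(3) by (intro sum.cong) (auto simp: inj_on_def)
  also have "\<dots> = f b" using assms by simp
  finally show ?thesis by simp
qed

lemma inj_monom_fun: "inj monom_fun"
proof (rule injI, rule ccontr)
  fix a b :: "3 \<Rightarrow> nat"
  assume e: "monom_fun a = monom_fun b" and ne: "a \<noteq> b"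
  have "(\<Sum>c\<in>{a,b}. (if c = a then 1 else -1) * monom_fun c x) = 0" for x
    using ne by (simp add: e)
  from monomials_linear_independent[OF _ this, of a] show False by simp
qed

lemma independent_monomials: "independent (monom_fun ` A)"
proof (rule independent_mono[of "range monom_fun"])
  show "independent (range monom_fun)"
    unfolding independent_explicit_module
  proof (intro allI impI)
    fix t and u :: "scalar_field \<Rightarrow> real" and v
    assume t: "finite t" "t \<subseteq> range monom_fun" "(\<Sum>v\<in>t. u v *\<^sub>R v) = 0" "v \<in> t"
    obtain A where A: "t = monom_fun ` A"
      using t(2) by (auto simp: subset_image_iff)
    have inj: "inj_on monom_fun A" using inj_monom_fun inj_on_subset by blast
    have finA: "finite A" using t(1) A inj finite_imageD by blast
    obtain a where a: "a \<in> A" "v = monom_fun a" using t A by auto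
    have "(\<Sum>v\<in>t. u v *\<^sub>R v) x = 0" for x using t(3) by simp
    then have "(\<Sum>a\<in>A. u (monom_fun a) * monom_fun a x) = 0" for x
      unfolding A fun_sum_apply by (simp add: sum.reindex[OF inj] scaleR_fun_def)
    from monomials_linear_independent[OF finA this a(1)] show "u v = 0" using a by simp
  qed
qed auto

text \<open>
  Since monomials are linearly independent, the coordinates of a polynomial function with respect to
  them are its coefficients. Membership in all the polynomial spaces is a condition on which
  coefficients may be nonzero (\<open>mspan_iff\<close>).
\<close>

definition mcoeff :: "scalar_field \<Rightarrow> (3 \<Rightarrow> nat) \<Rightarrow> real"
  where "mcoeff p a = representation (range monom_fun) p (monom_fun a)"

lemma mcoeff_monom: "mcoeff (monom_fun a) b = (if b = a then 1 else 0)"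
  using inj_monom_fun
  by (simp add: mcoeff_def real_vector.representation_basis[OF independent_monomials] inj_eq)

lemma mcoeff_add: "p \<in> Poly \<Longrightarrow> q \<in> Poly \<Longrightarrow> mcoeff (\<lambda>x. p x + q x) a = mcoeff p a + mcoeff q a"
  using real_vector.representation_add[OF independent_monomials[of UNIV], of q p]
  by (simp add: mcoeff_def mspan_def plus_fun_def)

lemma mcoeff_scale: "p \<in> Poly \<Longrightarrow> mcoeff (\<lambda>x. k * p x) a = k * mcoeff p a"
  using real_vector.representation_scale[OF independent_monomials[of UNIV], of p k]
  by (simp add: mcoeff_def mspan_def scaleR_fun_def)

lemma mcoeff_zero: "mcoeff (\<lambda>x. 0) a = 0"
  using mcoeff_scale[OF Poly_const[of 1], of 0] by simp

lemma mcoeff_uminus: "p \<in> Poly \<Longrightarrow> mcoeff (\<lambda>x. - p x) a = - mcoeff p a"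
  using mcoeff_scale[of p "-1"] by simp

lemma mcoeff_diff: "p \<in> Poly \<Longrightarrow> q \<in> Poly \<Longrightarrow> mcoeff (\<lambda>x. p x - q x) a = mcoeff p a - mcoeff q a"
  using mcoeff_add[of p "\<lambda>x. - q x" a] by (simp add: mcoeff_uminus mspan_uminus)

lemma mcoeff_sum: "(\<And>i. i \<in> I \<Longrightarrow> p i \<in> Poly) \<Longrightarrow> mcoeff (\<lambda>x. \<Sum>i\<in>I. p i x) a = (\<Sum>i\<in>I. mcoeff (p i) a)"
  by (induction I rule: infinite_finite_induct) (auto simp: mcoeff_zero mcoeff_add mspan_sum)

lemma finite_support_mcoeff: "finite {a. mcoeff p a \<noteq> 0}"
proof -
  have "monom_fun ` {a. mcoeff p a \<noteq> 0} \<subseteq> {b. representation (range monom_fun) p b \<noteq> 0}"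
    by (auto simp: mcoeff_def)
  then have "finite (monom_fun ` {a. mcoeff p a \<noteq> 0})"
    using real_vector.finite_representation finite_subset by blast
  then show ?thesis using inj_monom_fun finite_imageD inj_on_subset by blast
qed

lemma Poly_expansion:
  assumes "p \<in> Poly"
  shows "p = (\<lambda>x. \<Sum>a | mcoeff p a \<noteq> 0. mcoeff p a * monom_fun a x)"
proof -
  let ?r = "representation (range monom_fun) p"
  have "{b. ?r b \<noteq> 0} = monom_fun ` {a. mcoeff p a \<noteq> 0}"
    using real_vector.representation_ne_zero[of "range monom_fun" p] by (auto simp: mcoeff_def)
  moreover have "inj_on monom_fun {a. mcoeff p a \<noteq> 0}" using inj_monom_fun inj_on_subset by blast
  moreover have "p = (\<Sum>b | ?r b \<noteq> 0. ?r b *\<^sub>R b)"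
    using real_vector.sum_nonzero_representation_eq[OF independent_monomials, of p UNIV] assms
    by (simp add: mspan_def)
  ultimately have "p = (\<Sum>a | mcoeff p a \<noteq> 0. mcoeff p a *\<^sub>R monom_fun a)"
    by (simp add: sum.reindex mcoeff_def)
  also have "\<dots> = (\<lambda>x. \<Sum>a | mcoeff p a \<noteq> 0. mcoeff p a * monom_fun a x)"
    by (simp add: fun_eq_iff fun_sum_apply scaleR_fun_def)
  finally show ?thesis .
qed

lemma mspan_iff: "p \<in> mspan A \<longleftrightarrow> p \<in> Poly \<and> (\<forall>a. mcoeff p a \<noteq> 0 \<longrightarrow> a \<in> A)"
proof safe
  assume "p \<in> mspan A"
  then show "p \<in> Poly" by (rule mspan_Poly)
  fix a assume a: "mcoeff p a \<noteq> 0"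
  have "mcoeff p a \<noteq> 0 \<longrightarrow> a \<in> A" using \<open>p \<in> mspan A\<close>
  proof (induction rule: mspan_induct)
    case (add p q)
    then show ?case by (auto simp: mcoeff_add mspan_Poly)
  next
    case (scale c p)
    then show ?case by (auto simp: mcoeff_scale mspan_Poly)
  qed (auto simp: mcoeff_zero mcoeff_monom)
  with a show "a \<in> A" by simp
next
  assume "p \<in> Poly" "\<forall>a. mcoeff p a \<noteq> 0 \<longrightarrow> a \<in> A"
  then show "p \<in> mspan A"
    by (subst Poly_expansion) (auto intro!: mspan_sum mspan_scale monom_in_mspan)
qed

lemma mspanD: "p \<in> mspan A \<Longrightarrow> mcoeff p a \<noteq> 0 \<Longrightarrow> a \<in> A"
  by (subst (asm) mspan_iff) blast

lemma mspanI: "p \<in> Poly \<Longrightarrow> (\<And>a. mcoeff p a \<noteq> 0 \<Longrightarrow> a \<in> A) \<Longrightarrow> p \<in> mspan A"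
  by (subst mspan_iff) blast

lemma mcoeff_eqI:
  assumes "p \<in> Poly" "q \<in> Poly" "\<And>a. mcoeff p a = mcoeff q a"
  shows "p = q"
  using Poly_expansion[OF assms(1)] Poly_expansion[OF assms(2)] assms(3) by simp

lemma mcoeff_eq_0I:
  assumes "p \<in> Poly" "\<And>a. mcoeff p a = 0"
  shows "p = (\<lambda>x. 0)"
  using mcoeff_eqI[OF assms(1) Poly_const[of 0]] assms(2) by (simp add: mcoeff_zero)

lemma dim_mspan: "dim (mspan A) = card A"
  using real_vector.dim_span_eq_card_independent[OF independent_monomials[of A]]
    card_image[of monom_fun A] inj_monom_fun by (simp add: mspan_def inj_on_subset)

lemma fin_dim_mspan: "finite A \<Longrightarrow> fin_dim (mspan A)"
  by (simp add: mspan_def fin_dim_span)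

lemma mcoeff_coord_mult:
  assumes "p \<in> Poly"
  shows "mcoeff (\<lambda>x. x $ i * p x) a = (if a i = 0 then 0 else mcoeff p (a(i := a i - 1)))"
  using assms
proof (induction rule: mspan_induct)
  case (monom b)
  have *: "(a = b(i := Suc (b i))) = (a i \<noteq> 0 \<and> a(i := a i - 1) = b)"
    by (auto simp: fun_eq_iff)
  have eq: "(\<lambda>x. x $ i * monom_fun b x) = monom_fun (b(i := Suc (b i)))"
    by (rule ext) (simp only: monom_fun_inc)
  show ?case
    by (cases "a i = 0") (simp_all only: eq mcoeff_monom * simp_thms if_True if_False)
next
  case (add p q)
  then show ?case by (simp add: distrib_left mcoeff_add Poly_intros del: fun_upd_apply)
next
  case (scale c p)
  then show ?case by (simp add: mult.left_commute mcoeff_scale Poly_intros del: fun_upd_apply)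
qed (simp add: mcoeff_zero)

section \<open>Partial derivatives\<close>

definition partial :: "3 \<Rightarrow> scalar_field \<Rightarrow> scalar_field"
  where "partial i p = (\<lambda>x. frechet_derivative p (at x) (axis i 1))"

lemma partial_eqI: "(p has_derivative D) (at x) \<Longrightarrow> partial i p x = D (axis i 1)"
  by (simp add: partial_def frechet_derivative_at[symmetric])

lemma has_derivative_monom_fun:
  "(monom_fun a has_derivative
     (\<lambda>y. \<Sum>i\<in>UNIV. real (a i) * y $ i * x $ i ^ (a i - 1) * (\<Prod>j\<in>UNIV-{i}. x $ j ^ a j))) (at x)"
proof -
  have "((\<lambda>x. \<Prod>i\<in>UNIV. x $ i ^ a i) has_derivative
     (\<lambda>y. \<Sum>i\<in>UNIV. (real (a i) * y $ i * x $ i ^ (a i - 1)) * (\<Prod>j\<in>UNIV-{i}. x $ j ^ a j))) (at x)"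
    by (rule has_derivative_prod)
      (auto intro!: derivative_eq_intros bounded_linear_imp_has_derivative[OF bounded_linear_vec_nth])
  then show ?thesis by (simp add: monom_fun_def)
qed

lemma monom_fun_upd: "monom_fun (a(i := n)) x = x $ i ^ n * (\<Prod>j\<in>UNIV-{i}. x $ j ^ a j)"
proof -
  have "monom_fun (a(i := n)) x = x $ i ^ n * (\<Prod>j\<in>UNIV-{i}. x $ j ^ (a(i := n)) j)"
    unfolding monom_fun_def by (subst prod.remove[of UNIV i]) auto
  also have "(\<Prod>j\<in>UNIV-{i}. x $ j ^ (a(i := n)) j) = (\<Prod>j\<in>UNIV-{i}. x $ j ^ a j)"
    by (intro prod.cong) auto
  finally show ?thesis .
qed

lemma partial_monom: "partial i (monom_fun a) = (\<lambda>x. real (a i) * monom_fun (a(i := a i - 1)) x)"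
proof
  fix x
  have "partial i (monom_fun a) x = (\<Sum>k\<in>UNIV. real (a k) * (axis i 1 :: real^3) $ k * x $ k ^ (a k - 1) * (\<Prod>j\<in>UNIV-{k}. x $ j ^ a j))"
    by (rule partial_eqI[OF has_derivative_monom_fun])
  also have "\<dots> = (\<Sum>k\<in>UNIV. if k = i then real (a i) * monom_fun (a(i := a i - 1)) x else 0)"
    by (intro sum.cong) (auto simp: axis_def monom_fun_upd)
  finally show "partial i (monom_fun a) x = real (a i) * monom_fun (a(i := a i - 1)) x" by simp
qed

lemma Poly_has_derivative: "p \<in> Poly \<Longrightarrow> (p has_derivative frechet_derivative p (at x)) (at x)"
proof -
  assume "p \<in> Poly"
  then have "p differentiable (at x)"
  proof (induction rule: mspan_induct)
    case (monom a)
    show ?case using has_derivative_monom_fun by (auto simp: differentiable_def)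
  qed (auto intro!: derivative_intros)
  then show ?thesis by (simp add: frechet_derivative_works)
qed

lemma Poly_continuous_on: "p \<in> Poly \<Longrightarrow> continuous_on A p"
  by (meson Poly_has_derivative continuous_at_imp_continuous_on has_derivative_continuous)

lemma partial_add: "p \<in> Poly \<Longrightarrow> q \<in> Poly \<Longrightarrow> partial i (\<lambda>x. p x + q x) = (\<lambda>x. partial i p x + partial i q x)"
  by (rule ext, rule trans, rule partial_eqI, rule has_derivative_add, (rule Poly_has_derivative, assumption)+)
    (simp add: partial_def)

lemma partial_scale: "p \<in> Poly \<Longrightarrow> partial i (\<lambda>x. k * p x) = (\<lambda>x. k * partial i p x)"
  by (rule ext, rule trans, rule partial_eqI, rule has_derivative_mult_right, rule Poly_has_derivative, assumption)
    (simp add: partial_def)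

lemma partial_mult: "p \<in> Poly \<Longrightarrow> q \<in> Poly \<Longrightarrow>
    partial i (\<lambda>x. p x * q x) = (\<lambda>x. p x * partial i q x + partial i p x * q x)"
  by (rule ext, rule trans, rule partial_eqI, rule has_derivative_mult, (rule Poly_has_derivative, assumption)+)
    (simp add: partial_def)

lemma partial_const: "partial i (\<lambda>x. k) = (\<lambda>x. 0)"
  by (rule ext, rule trans, rule partial_eqI, rule has_derivative_const) simp

lemma partial_coord: "partial i (\<lambda>x. x $ j) = (\<lambda>x. if j = i then 1 else 0)"
  by (rule ext, rule trans, rule partial_eqI, rule bounded_linear_imp_has_derivative[OF bounded_linear_vec_nth])
    (simp add: axis_def)

lemma partial_uminus: "p \<in> Poly \<Longrightarrow> partial i (\<lambda>x. - p x) = (\<lambda>x. - partial i p x)"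
  using partial_scale[of p i "-1"] by simp

lemma partial_diff: "p \<in> Poly \<Longrightarrow> q \<in> Poly \<Longrightarrow> partial i (\<lambda>x. p x - q x) = (\<lambda>x. partial i p x - partial i q x)"
  using partial_add[of p "\<lambda>x. - q x" i] by (simp add: partial_uminus mspan_uminus)

lemma partial_sum: "(\<And>k. k \<in> I \<Longrightarrow> p k \<in> Poly) \<Longrightarrow>
    partial i (\<lambda>x. \<Sum>k\<in>I. p k x) = (\<lambda>x. \<Sum>k\<in>I. partial i (p k) x)"
  by (induction I rule: infinite_finite_induct) (auto simp: partial_const partial_add mspan_sum)

lemma mspan_partial:
  assumes "p \<in> mspan A" "\<And>a. a \<in> A \<Longrightarrow> a i > 0 \<Longrightarrow> a(i := a i - 1) \<in> B"
  shows "partial i p \<in> mspan B"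
  using assms(1)
proof (induction rule: mspan_induct)
  case (monom a)
  then show ?case using assms(2)
    by (cases "a i = 0") (auto simp: partial_monom mspan_zero intro!: mspan_scale monom_in_mspan)
next
  case (add p q)
  then show ?case using mspan_add[of "partial i p"] by (simp add: partial_add mspan_Poly)
next
  case (scale c p)
  then show ?case using mspan_scale[of "partial i p"] by (simp add: partial_scale mspan_Poly)
qed (simp add: mspan_zero partial_const)

lemma Poly_partial: "p \<in> Poly \<Longrightarrow> partial i p \<in> Poly"
  by (rule mspan_partial) auto

lemma mcoeff_partial:
  assumes "p \<in> Poly"
  shows "mcoeff (partial i p) a = real (Suc (a i)) * mcoeff p (a(i := Suc (a i)))"
  using assms
proof (induction rule: mspan_induct)
  case (monom b)
  have "b i \<noteq> 0 \<Longrightarrow> (a = b(i := b i - 1)) = (a(i := Suc (a i)) = b)"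
    by (auto simp: fun_eq_iff)
  then show ?case
    by (cases "b i = 0") (auto simp: partial_monom mcoeff_zero mcoeff_scale mcoeff_monom monom_in_mspan fun_eq_iff)
next
  case (add p q)
  then show ?case by (simp add: partial_add mcoeff_add Poly_partial distrib_left)
next
  case (scale c p)
  then show ?case by (simp add: partial_scale mcoeff_scale Poly_partial)
qed (simp add: mcoeff_zero partial_const)

lemma partial_commute:
  assumes p: "p \<in> Poly"
  shows "partial i (partial j p) = partial j (partial i p)"
proof -
  show ?thesis
  proof (cases "i = j")
    case False
    show ?thesis
    proof (rule mcoeff_eqI)
      fix a
      show "mcoeff (partial i (partial j p)) a = mcoeff (partial j (partial i p)) a"
        using False p fun_upd_twist[OF False, of a] by (simp add: mcoeff_partial Poly_partial)
    qed (use p in \<open>auto intro: Poly_partial\<close>)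
  qed simp
qed

text \<open>
  Euler's identity, in the form that homogeneous parts are eigenvectors of the Euler operator.
\<close>

lemma mcoeff_euler:
  assumes "p \<in> Poly"
  shows "mcoeff (\<lambda>x. \<Sum>i\<in>UNIV. x $ i * partial i p x) a = real (\<Sum>i\<in>UNIV. a i) * mcoeff p a"
proof -
  have "mcoeff (\<lambda>x. x $ i * partial i p x) a = real (a i) * mcoeff p a" for i
    using assms by (cases "a i") (auto simp: mcoeff_coord_mult Poly_partial mcoeff_partial fun_upd_idem)
  then show ?thesis using assms
    by (simp add: mcoeff_sum Poly_intros Poly_partial sum_distrib_right)
qed

section \<open>Restriction to coordinate planes\<close>

text \<open>
  A face lies in a plane \<open>x $ i = t\<close>. The restriction of a function to this plane is represented by
  freezing the \<open>i\<close>-th coordinate: the result is again a function on the whole space, one that does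
  not depend on \<open>x $ i\<close>.
\<close>

definition set_coord :: "3 \<Rightarrow> real \<Rightarrow> real^3 \<Rightarrow> real^3"
  where "set_coord i t x = (\<chi> j. if j = i then t else x $ j)"

lemma set_coord_nth: "set_coord i t x $ j = (if j = i then t else x $ j)"
  by (simp add: set_coord_def)

lemma set_coord_same: "set_coord i t (set_coord i s x) = set_coord i t x"
  by (simp add: vec_eq_iff set_coord_nth)

lemma set_coord_commute: "i \<noteq> j \<Longrightarrow> set_coord i t (set_coord j s x) = set_coord j s (set_coord i t x)"
  by (auto simp: vec_eq_iff set_coord_nth)

lemma monom_fun_set_coord: "monom_fun a (set_coord i t x) = t ^ a i * monom_fun (a(i := 0)) x"
proof -
  have "monom_fun a (set_coord i t x) = monom_fun (a(i := a i)) (set_coord i t x)" by simp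
  also have "\<dots> = t ^ a i * (\<Prod>j\<in>UNIV-{i}. set_coord i t x $ j ^ a j)"
    by (simp only: monom_fun_upd set_coord_nth refl if_True)
  also have "(\<Prod>j\<in>UNIV-{i}. set_coord i t x $ j ^ a j) = (\<Prod>j\<in>UNIV-{i}. x $ j ^ a j)"
    by (intro prod.cong) (auto simp: set_coord_nth)
  finally show ?thesis by (simp add: monom_fun_upd)
qed

lemma mspan_set_coord:
  assumes "p \<in> mspan A" "\<And>a. a \<in> A \<Longrightarrow> a(i := 0) \<in> B"
  shows "(\<lambda>x. p (set_coord i t x)) \<in> mspan B"
  using assms(1)
proof (induction rule: mspan_induct)
  case (monom a)
  then show ?case using assms(2) by (auto simp: monom_fun_set_coord intro!: mspan_scale monom_in_mspan)
qed (auto intro: mspan_zero mspan_add mspan_scale)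

lemma Poly_set_coord: "p \<in> Poly \<Longrightarrow> (\<lambda>x. p (set_coord i t x)) \<in> Poly"
  by (rule mspan_set_coord) auto

lemma set_coord_indep:
  assumes "p \<in> mspan A" "\<And>a. a \<in> A \<Longrightarrow> a i = 0"
  shows "p (set_coord i t x) = p x"
  using assms(1)
proof (induction rule: mspan_induct)
  case (monom a)
  then show ?case using assms(2)[of a] by (simp add: monom_fun_set_coord) (metis fun_upd_triv)
qed auto

lemma partial_set_coord:
  assumes "p \<in> Poly"
  shows "partial j (\<lambda>x. p (set_coord i t x)) = (\<lambda>x. if j = i then 0 else partial j p (set_coord i t x))"
  using assms
proof (induction rule: mspan_induct)
  case (monom a)
  show ?case by (auto simp: fun_eq_iff monom_fun_set_coord partial_scale partial_monom monom_in_mspan fun_upd_twist)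
next
  case (add p q)
  then show ?case by (auto simp: partial_add Poly_set_coord)
next
  case (scale c p)
  then show ?case by (auto simp: partial_scale Poly_set_coord)
qed (auto simp: partial_const)

text \<open>
  Polynomial division by \<open>x $ i - t\<close>, monomial by monomial: it lowers the exponent of \<open>x $ i\<close> and
  leaves the other exponents alone, so every bound on degrees can be followed through it.
\<close>

lemma divide_linear_factor:
  assumes "p \<in> mspan A"
    and "\<And>a n. a \<in> A \<Longrightarrow> n < a i \<Longrightarrow> a(i := n) \<in> B"
  shows "\<exists>q \<in> mspan B. \<forall>x. p x - p (set_coord i t x) = (x $ i - t) * q x"
  using assms(1)
proof (induction rule: mspan_induct)
  case (monom a)
  let ?q = "\<lambda>x. \<Sum>n<a i. t ^ (a i - Suc n) * monom_fun (a(i := n)) x"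
  have "?q \<in> mspan B" using assms(2) monom by (intro mspan_sum mspan_scale monom_in_mspan) auto
  moreover have "monom_fun a x - monom_fun a (set_coord i t x) = (x $ i - t) * ?q x" for x
  proof -
    let ?r = "\<Prod>j\<in>UNIV-{i}. x $ j ^ a j"
    have "monom_fun a x = monom_fun (a(i := a i)) x" by simp
    also have "\<dots> = x $ i ^ a i * ?r" by (simp only: monom_fun_upd)
    also have "\<dots> = t ^ a i * ?r + (x $ i ^ a i - t ^ a i) * ?r" by (simp add: algebra_simps)
    also have "x $ i ^ a i - t ^ a i = (x $ i - t) * (\<Sum>n<a i. t ^ (a i - Suc n) * x $ i ^ n)"
      by (rule power_diff_sumr2)
    finally show ?thesis by (simp add: monom_fun_set_coord monom_fun_upd sum_distrib_right mult.assoc)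
  qed
  ultimately show ?case by (intro bexI[of _ ?q] allI)
next
  case (add p q)
  then obtain p' q' where "p' \<in> mspan B" "\<forall>x. p x - p (set_coord i t x) = (x $ i - t) * p' x"
    "q' \<in> mspan B" "\<forall>x. q x - q (set_coord i t x) = (x $ i - t) * q' x" by blast
  then show ?case
    by (intro bexI[of _ "\<lambda>x. p' x + q' x"] mspan_add) (simp_all add: distrib_left add_diff_add)
next
  case (scale c p)
  then obtain p' where "p' \<in> mspan B" "\<forall>x. p x - p (set_coord i t x) = (x $ i - t) * p' x" by blast
  then show ?case
    by (intro bexI[of _ "\<lambda>x. c * p' x"] mspan_scale) (simp_all add: mult.left_commute flip: right_diff_distrib)
qed (auto intro!: bexI[of _ "\<lambda>x. 0"] mspan_zero)

text \<open>
  Any point is joined by a line to a point of the box, and on that line the polynomial has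
  infinitely many zeros.
\<close>

lemma Poly_eq_0_on_box:
  assumes "p \<in> Poly" "box a b \<noteq> {}" "\<And>x. x \<in> box a b \<Longrightarrow> p x = 0"
  shows "p = (\<lambda>x. 0)"
proof
  fix x
  obtain z where z: "z \<in> box a b" using assms(2) by auto
  obtain P :: "real poly" where P: "\<And>t. poly P t = p (\<chi> j. poly [:z $ j, x $ j - z $ j:] t)"
    using Poly_along_curve[OF assms(1)] by metis
  have line: "(\<chi> j. poly [:z $ j, x $ j - z $ j:] t) = z + t *\<^sub>R (x - z)" for t
    by (simp add: vec_eq_iff)
  have "((\<lambda>t. z + t *\<^sub>R (x - z)) \<longlongrightarrow> z + 0 *\<^sub>R (x - z)) (at 0)" by (intro tendsto_intros)
  then have "\<forall>\<^sub>F t in at 0. z + t *\<^sub>R (x - z) \<in> box a b"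
    using z open_box by (auto simp: tendsto_def)
  then obtain e where e: "e > 0" "\<And>t. t \<noteq> 0 \<Longrightarrow> \<bar>t\<bar> < e \<Longrightarrow> z + t *\<^sub>R (x - z) \<in> box a b"
    by (auto simp: eventually_at dist_real_def)
  have "poly P t = 0" if "0 < t" "t < e" for t
    using e(2)[of t] assms(3) that by (simp only: P line)
  then have "{0<..<e} \<subseteq> {t. poly P t = 0}" by auto
  moreover have "infinite {0<..<e}" using e(1) by (simp add: infinite_Ioo)
  ultimately have "P = 0" using poly_roots_finite finite_subset by blast
  then show "p x = 0" using P[of 1] line[of 1] by simp
qed

section \<open>Integrals of polynomials over the box\<close>

lemma borel_integrable_cbox:
  fixes f :: "'a::euclidean_space \<Rightarrow> real"
  assumes "continuous_on (cbox a b) f"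
  shows "set_integrable lborel (cbox a b) f"
  unfolding set_integrable_def
  using borel_integrable_compact[OF compact_cbox assms] by (simp add: indicator_def if_distrib mult.commute cong: if_cong)

text \<open>
  Lebesgue measure is a product measure, so the integral of a product of functions of the single
  coordinates factorises.
\<close>

lemma integral_lborel_prod:
  fixes f :: "'a::euclidean_space \<Rightarrow> real \<Rightarrow> real"
  assumes int: "\<And>b. b \<in> Basis \<Longrightarrow> integrable lborel (f b)"
  shows "(\<integral>x. (\<Prod>b\<in>Basis. f b (x \<bullet> b)) \<partial>lborel) = (\<Prod>b\<in>Basis. \<integral>t. f b t \<partial>lborel)"
proof -
  interpret product_sigma_finite "\<lambda>_::'a. lborel::real measure" ..
  have [measurable]: "b \<in> Basis \<Longrightarrow> f b \<in> borel_measurable borel" for b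
    using borel_measurable_integrable[OF int[of b]] by simp
  have "(\<integral>x. (\<Prod>b\<in>Basis. f b (x \<bullet> b)) \<partial>lborel)
      = (\<integral>x. (\<Prod>b\<in>Basis. f b ((\<Sum>b\<in>Basis. x b *\<^sub>R b) \<bullet> b)) \<partial>(\<Pi>\<^sub>M b\<in>Basis. lborel))"
    by (subst lborel_eq) (subst integral_distr; measurable)
  also have "\<dots> = (\<integral>x. (\<Prod>b\<in>Basis. f b (x b)) \<partial>(\<Pi>\<^sub>M b\<in>Basis. lborel))"
    by (intro Bochner_Integration.integral_cong prod.cong) auto
  also have "\<dots> = (\<Prod>b\<in>Basis. \<integral>t. f b t \<partial>lborel)"
    using int by (intro product_integral_prod) auto
  finally show ?thesis .
qed

lemma prod_Basis_vec:
  fixes g :: "real^'n::finite \<Rightarrow> 'b::comm_monoid_mult"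
  shows "(\<Prod>b\<in>Basis. g b) = (\<Prod>i\<in>UNIV. g (axis i 1))"
proof -
  have B: "(Basis::(real^'n) set) = (\<lambda>i. axis i 1) ` UNIV" by (auto simp: Basis_vec_def)
  have "inj (\<lambda>i::'n. axis i (1::real))" by (auto simp: inj_on_def axis_eq_axis)
  from prod.reindex[OF this, of g] show ?thesis by (simp only: B o_def)
qed

lemma integral_cbox_product:
  fixes g :: "'n::finite \<Rightarrow> real \<Rightarrow> real" and l u :: "real^'n"
  assumes "\<And>i. continuous_on UNIV (g i)"
  shows "integral (cbox l u) (\<lambda>x. \<Prod>i\<in>UNIV. g i (x $ i)) = (\<Prod>i\<in>UNIV. integral {l $ i..u $ i} (g i))"
proof -
  define f where "f = (\<lambda>b t. indicator {l \<bullet> b..u \<bullet> b} t * (\<Prod>i | axis i 1 = b. g i t))"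
  have fi: "f (axis i 1) t = indicator {l $ i..u $ i} t * g i t" for i t
    by (simp add: f_def axis_eq_axis inner_axis)
  have fi': "f (axis i 1) = (\<lambda>t. indicator {l $ i..u $ i} t * g i t)" for i
    by (rule ext) (rule fi)
  have si: "set_integrable lborel {l $ i..u $ i} (g i)" for i
    using borel_integrable_cbox[of "l $ i" "u $ i" "g i"] continuous_on_subset[OF assms] by simp
  have int: "integrable lborel (f b)" if "b \<in> Basis" for b
  proof -
    obtain i where "b = axis i 1" using \<open>b \<in> Basis\<close> by (auto simp: Basis_vec_def)
    then show ?thesis using si[of i] fi'[of i] by (simp add: set_integrable_def)
  qed
  have cont: "continuous_on (cbox l u) (\<lambda>x. \<Prod>i\<in>UNIV. g i (x $ i))"
    by (intro continuous_on_prod continuous_on_compose2[OF assms] continuous_intros) auto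
  have ind: "indicator (cbox l u) x = (\<Prod>i\<in>UNIV. indicator {l $ i..u $ i} (x $ i) :: real)" for x
    by (auto simp: indicator_def mem_box_cart prod_zero_iff intro!: prod.neutral split: if_splits)
  have "integral (cbox l u) (\<lambda>x. \<Prod>i\<in>UNIV. g i (x $ i))
      = (LINT x : cbox l u | lborel. (\<Prod>i\<in>UNIV. g i (x $ i)))"
    using set_borel_integral_eq_integral(2)[OF borel_integrable_cbox[OF cont]] by simp
  also have "\<dots> = (\<integral>x. (\<Prod>b\<in>Basis. f b (x \<bullet> b)) \<partial>lborel)"
    by (simp add: set_lebesgue_integral_def prod_Basis_vec fi inner_axis ind prod.distrib)
  also have "\<dots> = (\<Prod>b\<in>Basis. \<integral>t. f b t \<partial>lborel)"
    by (rule integral_lborel_prod[OF int])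
  also have "\<dots> = (\<Prod>i\<in>UNIV. integral {l $ i..u $ i} (g i))"
    using set_borel_integral_eq_integral(2)[OF si]
    by (simp add: prod_Basis_vec fi' set_lebesgue_integral_def)
  finally show ?thesis .
qed

text \<open>
  The moments of the three side intervals determine all integrals of polynomials: box, face and edge
  integrals of a monomial are products of them.
\<close>

abbreviation moment :: "real^3 \<Rightarrow> real^3 \<Rightarrow> 3 \<Rightarrow> nat \<Rightarrow> real"
  where "moment c h i n \<equiv> integral {c $ i - h $ i..c $ i + h $ i} (\<lambda>t. t ^ n)"

lemma box_integral_monom: "box_integral c h (monom_fun a) = (\<Prod>i\<in>UNIV. moment c h i (a i))"
  unfolding box_integral_def integral_open_interval monom_fun_def
  by (subst integral_cbox_product) (auto intro!: continuous_intros)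

lemma box_integral_add:
  "p \<in> Poly \<Longrightarrow> q \<in> Poly \<Longrightarrow> box_integral c h (\<lambda>x. p x + q x) = box_integral c h p + box_integral c h q"
  unfolding box_integral_def integral_open_interval
  by (intro integral_add integrable_continuous Poly_continuous_on)

lemma box_integral_scale: "box_integral c h (\<lambda>x. k * p x) = k * box_integral c h p"
  unfolding box_integral_def by simp

lemma box_integral_zero: "box_integral c h (\<lambda>x. 0) = 0"
  unfolding box_integral_def by simp

lemma box_integral_uminus: "box_integral c h (\<lambda>x. - p x) = - box_integral c h p"
  using box_integral_scale[of c h "-1" p] by simp

lemma box_integral_diff:
  "p \<in> Poly \<Longrightarrow> q \<in> Poly \<Longrightarrow> box_integral c h (\<lambda>x. p x - q x) = box_integral c h p - box_integral c h q"
  using box_integral_add[of p "\<lambda>x. - q x" c h] by (simp add: box_integral_uminus mspan_uminus)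

lemma box_integral_sum:
  "(\<And>i. i \<in> I \<Longrightarrow> p i \<in> Poly) \<Longrightarrow> box_integral c h (\<lambda>x. \<Sum>i\<in>I. p i x) = (\<Sum>i\<in>I. box_integral c h (p i))"
  by (induction I rule: infinite_finite_induct) (auto simp: box_integral_zero box_integral_add mspan_sum)

lemma moment_power:
  assumes "h $ i \<ge> 0"
  shows "real n * moment c h i (n - 1) = (c $ i + h $ i) ^ n - (c $ i - h $ i) ^ n"
proof -
  have "((\<lambda>t. real n * t ^ (n - 1)) has_integral (c $ i + h $ i) ^ n - (c $ i - h $ i) ^ n) {c $ i - h $ i..c $ i + h $ i}"
  proof (rule fundamental_theorem_of_calculus)
    fix x :: real
    have "((\<lambda>t. t ^ n) has_real_derivative real n * x ^ (n - 1)) (at x within {c $ i - h $ i..c $ i + h $ i})"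
      by (auto intro!: derivative_eq_intros)
    then show "((\<lambda>t. t ^ n) has_vector_derivative real n * x ^ (n - 1)) (at x within {c $ i - h $ i..c $ i + h $ i})"
      by (simp add: has_real_derivative_iff_has_vector_derivative)
  qed (use assms in auto)
  from integral_unique[OF this] show ?thesis by simp
qed

lemma moment_0: "h $ i \<ge> 0 \<Longrightarrow> moment c h i 0 = 2 * h $ i"
  using moment_power[of h i 1 c] by simp

lemma box_integral_monom_upd:
  "box_integral c h (monom_fun (a(i := n))) = moment c h i n * (\<Prod>j\<in>UNIV-{i}. moment c h j (a j))"
proof -
  have "box_integral c h (monom_fun (a(i := n))) = moment c h i n * (\<Prod>j\<in>UNIV-{i}. moment c h j ((a(i := n)) j))"
    unfolding box_integral_monom by (subst prod.remove[of UNIV i]) auto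
  also have "(\<Prod>j\<in>UNIV-{i}. moment c h j ((a(i := n)) j)) = (\<Prod>j\<in>UNIV-{i}. moment c h j (a j))"
    by (intro prod.cong) auto
  finally show ?thesis .
qed

text \<open>
  The divergence theorem for a polynomial field parallel to an axis. The box integral of a function
  frozen in the \<open>i\<close>-th coordinate is \<open>2 * h $ i\<close> times its integral over the face, which explains the
  factor on the left.
\<close>

lemma box_integral_partial:
  assumes "p \<in> Poly" "h $ i \<ge> 0"
  shows "2 * h $ i * box_integral c h (partial i p)
    = box_integral c h (\<lambda>x. p (set_coord i (c $ i + h $ i) x)) - box_integral c h (\<lambda>x. p (set_coord i (c $ i - h $ i) x))"
  using assms(1)
proof (induction rule: mspan_induct)
  case (monom a)
  let ?R = "\<Prod>j\<in>UNIV-{i}. moment c h j (a j)"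
  have "box_integral c h (partial i (monom_fun a)) = ((c $ i + h $ i) ^ a i - (c $ i - h $ i) ^ a i) * ?R"
    by (simp only: partial_monom box_integral_scale box_integral_monom_upd mult.assoc[symmetric] moment_power[OF assms(2)])
  moreover have "box_integral c h (\<lambda>x. monom_fun a (set_coord i t x)) = t ^ a i * (2 * h $ i * ?R)" for t
    by (simp only: monom_fun_set_coord box_integral_scale box_integral_monom_upd moment_0[OF assms(2)])
  ultimately show ?case by (simp only:) (simp add: algebra_simps)
next
  case (add p q)
  then show ?case by (simp add: partial_add box_integral_add Poly_partial Poly_set_coord algebra_simps)
next
  case (scale k p)
  then have "k * (2 * h $ i * box_integral c h (partial i p)) = k * (box_integral c h (\<lambda>x. p (set_coord i (c $ i + h $ i) x)) - box_integral c h (\<lambda>x. p (set_coord i (c $ i - h $ i) x)))"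
    by simp
  with scale(1) show ?case by (simp only: partial_scale box_integral_scale) (simp only: algebra_simps)
qed (simp add: partial_const box_integral_zero)

lemma integration_by_parts:
  assumes "p \<in> Poly" "q \<in> Poly" "h $ i > 0"
    and "\<And>x s. s \<in> {-1, 1} \<Longrightarrow> p (set_coord i (c $ i + s * h $ i) x) * q (set_coord i (c $ i + s * h $ i) x) = 0"
  shows "box_integral c h (\<lambda>x. partial i p x * q x) = - box_integral c h (\<lambda>x. p x * partial i q x)"
proof -
  have "(\<lambda>x. p (set_coord i (c $ i + h $ i) x) * q (set_coord i (c $ i + h $ i) x)) = (\<lambda>x. 0)"
    "(\<lambda>x. p (set_coord i (c $ i - h $ i) x) * q (set_coord i (c $ i - h $ i) x)) = (\<lambda>x. 0)"
    using assms(4)[of 1] assms(4)[of "-1"] by (simp_all add: fun_eq_iff)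
  then have "2 * h $ i * box_integral c h (partial i (\<lambda>x. p x * q x)) = 0"
    using assms(3) by (subst box_integral_partial) (simp_all add: Poly_mult assms(1,2))
  then have "box_integral c h (\<lambda>x. p x * partial i q x + partial i p x * q x) = 0"
    using assms by (simp add: partial_mult)
  then show ?thesis using assms by (simp add: box_integral_add Poly_intros Poly_partial)
qed

lemma box_nonempty:
  fixes c h :: "real^3"
  assumes "\<forall>i. h $ i > 0"
  shows "box (c - h) (c + h) \<noteq> {}"
proof -
  have "c $ i - h $ i < c $ i + h $ i" for i using assms[rule_format, of i] by linarith
  then show ?thesis by (simp add: interval_ne_empty_cart)
qed

text \<open>
  The integrand is continuous and nonnegative on the box; hence \<open>p\<close> vanishes on the box, and then
  everywhere because it is a polynomial.
\<close>

lemma box_integral_square_eq_0: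
  assumes h: "\<forall>i. h $ i > 0" and p: "p \<in> Poly" and w: "w \<in> Poly"
    and pos: "\<And>x. x \<in> box (c - h) (c + h) \<Longrightarrow> w x > 0"
    and int: "box_integral c h (\<lambda>x. w x * (p x * p x)) = 0"
  shows "p = (\<lambda>x. 0)"
proof (rule Poly_eq_0_on_box[OF p box_nonempty[OF h]])
  fix x assume x: "x \<in> box (c - h) (c + h)"
  let ?f = "\<lambda>x. w x * (p x * p x)"
  have f: "?f \<in> Poly" using p w by (intro Poly_intros)
  have "(?f has_integral 0) (cbox (c - h) (c + h))"
    using int integrable_continuous[OF Poly_continuous_on[OF f]]
    unfolding box_integral_def integral_open_interval by (metis integrable_integral)
  moreover have "0 \<le> ?f y" if "y \<in> box (c - h) (c + h)" for y
    using pos[OF that] by simp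
  moreover have "x \<in> cbox (c - h) (c + h)"
    using x box_subset_cbox[of "c - h" "c + h"] by blast
  ultimately have "?f x = 0"
    using has_integral_0_cbox_imp_0[OF Poly_continuous_on[OF f] _ _ box_nonempty[OF h]] by blast
  then show "p x = 0" using pos[OF x] by simp
qed

section \<open>Integrals over faces and edges\<close>

text \<open>
  The three axes are \<open>i\<close>, \<open>i + 1\<close>, \<open>i + 2\<close> modulo 3. Stating everything relative to an arbitrary \<open>i\<close>
  replaces case distinctions between the axes by the cyclic symmetry of cross products and curls.
\<close>

lemma index3: "i + 1 \<noteq> i" "i + 2 \<noteq> i" "i + 2 \<noteq> i + 1" "i \<noteq> i + 1" "i \<noteq> i + 2" "i + 1 \<noteq> i + 2"
  "i + 1 + 1 = i + 2" "i + 1 + 2 = i" "i + 2 + 1 = i" "i + 2 + 2 = i + 1" for i :: 3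
  using exhaust_3[of i] by auto

lemma numeral_index3: "(4::3) = 1" "(5::3) = 2"
  by simp_all

lemma UNIV_index3: "UNIV = {i, i + 1, i + 2}" for i :: 3
proof -
  have "(4::3) = 1" "(5::3) = 2" by simp_all
  then have "j \<in> {i, i + 1, i + 2}" for j
    using exhaust_3[of i] exhaust_3[of j] by auto
  then show ?thesis by blast
qed

lemma index3_cases: "j = i \<or> j = i + 1 \<or> j = i + 2" for i j :: 3
  using UNIV_index3[of i] by blast

lemma sum_index3: "sum f UNIV = f i + f (i + 1) + f (i + 2)" for i :: 3 and f :: "3 \<Rightarrow> 'a::comm_monoid_add"
  by (subst UNIV_index3[of i]) (simp add: index3 ac_simps)

lemma prod_index3: "prod f UNIV = f i * f (i + 1) * f (i + 2)" for i :: 3 and f :: "3 \<Rightarrow> 'a::comm_monoid_mult"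
  by (subst UNIV_index3[of i]) (simp add: index3 ac_simps)

lemma all_index3: "(\<forall>j. P j) \<longleftrightarrow> P i \<and> P (i + 1) \<and> P (i + 2)" for i :: 3
  using index3_cases[of _ i] by metis

definition face_point :: "real^3 \<Rightarrow> real^3 \<Rightarrow> 3 \<Rightarrow> real \<Rightarrow> real^3 \<Rightarrow> real^3"
  where "face_point c h i s = set_coord i (c $ i + s * h $ i)"

lemma Poly_face_point: "p \<in> Poly \<Longrightarrow> (\<lambda>x. p (face_point c h i s x)) \<in> Poly"
  unfolding face_point_def by (rule Poly_set_coord)

lemma Poly_face_point2:
  "p \<in> Poly \<Longrightarrow> (\<lambda>x. p (face_point c h i s (face_point c h j t x))) \<in> Poly"
  by (rule Poly_face_point[of "\<lambda>x. p (face_point c h i s x)"]) (rule Poly_face_point)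

lemma monom_fun_face_arg:
  "monom_fun a (\<chi> j. if j = i then t else if j = i + 1 then u else v) = t ^ a i * u ^ a (i + 1) * v ^ a (i + 2)"
  for i :: 3
  by (simp add: monom_fun_def prod_index3[of _ i] index3)

text \<open>
  Together with \<open>edge_integral_Poly\<close> this turns every degree of freedom into a box integral of a
  frozen function. Integration by parts and positivity then have to be known for the box only, and
  they serve for faces as well.
\<close>

lemma face_integral_Poly:
  assumes "g \<in> Poly" "h $ i \<ge> 0"
  shows "2 * h $ i * face_integral c h (i, s) g = box_integral c h (\<lambda>x. g (face_point c h i s x))"
proof -
  let ?arg = "\<lambda>ab::real\<times>real. \<chi> j. if j = i then c $ i + s * h $ i else if j = i + 1 then fst ab else snd ab"
  have arg: "continuous_on A ?arg" for A
  proof (rule continuous_on_vec_lambda)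
    fix j
    show "continuous_on A (\<lambda>ab. if j = i then c $ i + s * h $ i else if j = i + 1 then fst ab else snd ab)"
      by (cases "j = i"; cases "j = i + 1") (simp_all add: continuous_on_fst continuous_on_snd)
  qed
  have cont: "continuous_on A (\<lambda>ab. p (?arg ab))" if "p \<in> Poly" for p A
    using continuous_on_compose2[OF Poly_continuous_on[OF that, of UNIV] arg] by simp
  have face: "face_integral c h (i, s) p =
     integral (cbox (c $ (i+1) - h $ (i+1), c $ (i+2) - h $ (i+2))
                   (c $ (i+1) + h $ (i+1), c $ (i+2) + h $ (i+2))) (\<lambda>ab. p (?arg ab))" for p
    by (simp add: case_prod_unfold)
  show ?thesis
    using assms(1)
  proof (induction rule: mspan_induct)
    case (monom a)
    have "face_integral c h (i, s) (monom_fun a) =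
      (c $ i + s * h $ i) ^ a i * (moment c h (i + 1) (a (i + 1)) * moment c h (i + 2) (a (i + 2)))"
      unfolding face
      by (subst integral_prod_continuous[OF cont[OF monom_in_mspan]])
        (simp_all add: monom_fun_face_arg mult.assoc)
    moreover have "box_integral c h (\<lambda>x. monom_fun a (face_point c h i s x)) =
      (c $ i + s * h $ i) ^ a i * (2 * h $ i * (moment c h (i + 1) (a (i + 1)) * moment c h (i + 2) (a (i + 2))))"
    proof -
      have "UNIV - {i} = {i + 1, i + 2}" using UNIV_index3[of i] index3[of i] by auto
      then have P: "(\<Prod>j\<in>UNIV - {i}. moment c h j (a j)) = moment c h (i + 1) (a (i + 1)) * moment c h (i + 2) (a (i + 2))"
        by (simp add: index3)
      show ?thesis
        unfolding face_point_def by (simp only: monom_fun_set_coord box_integral_scale box_integral_monom_upd moment_0[OF assms(2)] P)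
    qed
    ultimately show ?case by (simp only: mult_ac)
  next
    case (add p q)
    have "face_integral c h (i, s) (\<lambda>x. p x + q x) = face_integral c h (i, s) p + face_integral c h (i, s) q"
      unfolding face using add by (intro integral_add integrable_continuous cont)
    then show ?case using add by (simp add: box_integral_add Poly_set_coord face_point_def distrib_left del: face_integral.simps)
  next
    case (scale k p)
    have "face_integral c h (i, s) (\<lambda>x. k * p x) = k * face_integral c h (i, s) p"
      unfolding face by simp
    then show ?case using scale by (simp add: box_integral_scale mult.left_commute del: face_integral.simps)
  qed (simp add: face box_integral_zero del: face_integral.simps)
qed

lemma edge_integral_Poly:
  assumes "g \<in> Poly" "h $ (i + 1) \<ge> 0" "h $ (i + 2) \<ge> 0"
  shows "4 * h $ (i + 1) * h $ (i + 2) * edge_integral c h (i, s, t) g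
    = box_integral c h (\<lambda>x. g (face_point c h (i + 1) s (face_point c h (i + 2) t x)))"
proof -
  let ?arg = "\<lambda>u. \<chi> j. if j = i then u else if j = i + 1 then c $ (i+1) + s * h $ (i+1) else c $ (i+2) + t * h $ (i+2)"
  have arg: "continuous_on A ?arg" for A
  proof (rule continuous_on_vec_lambda)
    fix j
    show "continuous_on A (\<lambda>u. if j = i then u else if j = i + 1 then c $ (i+1) + s * h $ (i+1) else c $ (i+2) + t * h $ (i+2))"
      by (cases "j = i"; cases "j = i + 1") simp_all
  qed
  have cont: "continuous_on A (\<lambda>u. p (?arg u))" if "p \<in> Poly" for p and A :: "real set"
    using continuous_on_compose2[OF Poly_continuous_on[OF that, of UNIV] arg] by simp
  show ?thesis
    using assms(1)
  proof (induction rule: mspan_induct)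
    case (monom a)
    let ?S = "c $ (i+1) + s * h $ (i+1)" and ?T = "c $ (i+2) + t * h $ (i+2)"
    have "edge_integral c h (i, s, t) (monom_fun a) = moment c h i (a i) * (?S ^ a (i + 1) * ?T ^ a (i + 2))"
      by (simp add: monom_fun_face_arg mult.assoc)
    moreover have "box_integral c h (\<lambda>x. monom_fun a (face_point c h (i + 1) s (face_point c h (i + 2) t x)))
      = ?S ^ a (i + 1) * (?T ^ a (i + 2) * box_integral c h (monom_fun (a(i + 1 := 0, i + 2 := 0))))"
      unfolding face_point_def
      by (simp only: monom_fun_set_coord box_integral_scale fun_upd_other[OF index3(3)] mult.assoc)
    moreover have "box_integral c h (monom_fun (a(i + 1 := 0, i + 2 := 0)))
      = moment c h i (a i) * (2 * h $ (i + 1)) * (2 * h $ (i + 2))"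
      unfolding box_integral_monom prod_index3[of _ i]
      using moment_0[OF assms(2)] moment_0[OF assms(3)] by (simp add: index3)
    ultimately show ?case by (simp only: mult_ac)
  next
    case (add p q)
    have "edge_integral c h (i, s, t) (\<lambda>x. p x + q x) = edge_integral c h (i, s, t) p + edge_integral c h (i, s, t) q"
      unfolding edge_integral.simps using add by (intro integral_add integrable_continuous_interval cont)
    then show ?case using add by (simp add: box_integral_add Poly_face_point2 distrib_left del: edge_integral.simps)
  next
    case (scale k p)
    have "edge_integral c h (i, s, t) (\<lambda>x. k * p x) = k * edge_integral c h (i, s, t) p"
      by simp
    then show ?case using scale by (simp add: box_integral_scale mult.left_commute del: edge_integral.simps)
  qed (simp add: box_integral_zero)
qed

section \<open>Degrees and the components of grad and curl\<close>

definition deg :: "(3 \<Rightarrow> nat) \<Rightarrow> nat"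
  where "deg a = (\<Sum>j\<in>UNIV. a j)"

lemma deg_index3: "deg a = a i + a (i + 1) + a (i + 2)" for i :: 3
  by (simp add: deg_def sum_index3[of _ i])

lemma deg_upd: "deg (a(i := n)) + a i = deg a + n"
  by (simp add: deg_index3[of _ i] index3)

lemma deg_ge: "a i \<le> deg a"
  by (simp add: deg_index3[of _ i])

lemma superlinear_degree_index3: "superlinear_degree a =
    (if a i = 1 then 0 else a i) + (if a (i + 1) = 1 then 0 else a (i + 1)) + (if a (i + 2) = 1 then 0 else a (i + 2))"
  for i :: 3
proof -
  have "superlinear_degree a = (\<Sum>j\<in>UNIV. if a j = 1 then 0 else a j)"
    unfolding superlinear_degree_def by (rule sum.mono_neutral_cong_left) auto
  then show ?thesis by (simp only: sum_index3[of _ i])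
qed

lemma superlinear_degree_ge: "a i \<noteq> 1 \<Longrightarrow> a i \<le> superlinear_degree a"
  by (simp add: superlinear_degree_index3[of _ i])

lemma span_monom_Collect: "span {monom_fun a |a. Q a} = mspan {a. Q a}"
  by (simp add: mspan_def setcompr_eq_image)

lemma poly_space_mspan: "poly_space J k = mspan {a. (\<forall>j. j \<notin> J \<longrightarrow> a j = 0) \<and> int (deg a) \<le> k}"
  unfolding poly_space_def span_monom_Collect deg_def ..

lemma hom_space_mspan: "hom_space J k = mspan {a. (\<forall>j. j \<notin> J \<longrightarrow> a j = 0) \<and> int (deg a) = k}"
  unfolding hom_space_def span_monom_Collect deg_def ..

lemma S0_mspan: "S0 r = mspan {a. int (superlinear_degree a) \<le> r}"
  unfolding S0_def span_monom_Collect ..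

lemma hom_space_subset: "hom_space J k \<subseteq> poly_space J k"
  unfolding poly_space_mspan hom_space_mspan by (rule mspan_mono) auto

lemma poly_space_Poly: "p \<in> poly_space J k \<Longrightarrow> p \<in> Poly"
  unfolding poly_space_mspan by (rule mspan_Poly)

lemma hom_space_Poly: "p \<in> hom_space J k \<Longrightarrow> p \<in> Poly"
  unfolding hom_space_mspan by (rule mspan_Poly)

lemma S0_Poly: "p \<in> S0 k \<Longrightarrow> p \<in> Poly"
  unfolding S0_mspan by (rule mspan_Poly)

lemma grad_nth: "grad p x $ j = partial j p x"
  by (simp add: grad_def partial_def)

lemma cube_iff: "u \<in> cube A \<longleftrightarrow> (\<forall>j. (\<lambda>x. u x $ j) \<in> A)"
  by (simp add: cube_def)

lemma curl_nth:
  assumes u: "u \<in> cube Poly"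
  shows "curl u x $ i = partial (i + 1) (\<lambda>x. u x $ (i + 2)) x - partial (i + 2) (\<lambda>x. u x $ (i + 1)) x"
proof -
  let ?D = "\<lambda>y. \<chi> j. frechet_derivative (\<lambda>x. u x $ j) (at x) y"
  have "(u has_derivative ?D) (at x)"
  proof (subst has_derivative_componentwise_within, rule ballI)
    fix b :: "real^3" assume "b \<in> Basis"
    then obtain j where b: "b = axis j 1" by (auto simp: Basis_vec_def)
    have "((\<lambda>x. u x $ j) has_derivative frechet_derivative (\<lambda>x. u x $ j) (at x)) (at x)"
      using u by (intro Poly_has_derivative) (simp add: cube_iff)
    then show "((\<lambda>x. u x \<bullet> b) has_derivative (\<lambda>y. ?D y \<bullet> b)) (at x)"
      by (simp add: b inner_axis)
  qed
  from frechet_derivative_at[OF this] have "jacobian u (at x) = matrix ?D"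
    by (simp only: jacobian_def)
  then have J: "jacobian u (at x) $ a $ b = partial b (\<lambda>x. u x $ a) x" for a b
    by (simp add: matrix_def partial_def)
  show ?thesis
    using exhaust_3[of i] by (auto simp: curl_def Let_def J numeral_index3)
qed

section \<open>Potentials of curl-free polynomial fields\<close>

text \<open>
  The potential is obtained by integrating along rays from the origin: the Euler operator applied to
  the potential is \<open>Y = (\<Sum>i. x $ i * U i x)\<close>, so dividing the coefficients of \<open>Y\<close> by their degrees gives
  \<open>P\<close>. In particular \<open>P\<close> involves only monomials of \<open>Y\<close>; this is how superlinear degree and
  independence of a coordinate are inherited.
\<close>

lemma poly_potential:
  fixes U :: "3 \<Rightarrow> scalar_field"
  assumes U: "\<And>i. U i \<in> Poly"
    and curl_free: "\<And>i j. partial i (U j) = partial j (U i)"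
    and Y: "(\<lambda>x. \<Sum>i\<in>UNIV. x $ i * U i x) \<in> mspan A"
  obtains P where "P \<in> mspan A" "\<And>i. U i = partial i P"
proof -
  define Y where "Y = (\<lambda>x. \<Sum>i\<in>UNIV. x $ i * U i x)"
  have YA: "Y \<in> mspan A" using Y by (simp add: Y_def)
  then have YP: "Y \<in> Poly" by (rule mspan_Poly)
  define P where "P = (\<lambda>x. \<Sum>a | mcoeff Y a \<noteq> 0. (mcoeff Y a / deg a) * monom_fun a x)"
  have PA: "P \<in> mspan A"
    unfolding P_def using mspanD[OF YA] by (intro mspan_sum mspan_scale monom_in_mspan) auto
  then have PP: "P \<in> Poly" by (rule mspan_Poly)
  have coP: "mcoeff P a = mcoeff Y a / deg a" for a
  proof -
    have "mcoeff P a = (\<Sum>b | mcoeff Y b \<noteq> 0. (mcoeff Y b / deg b) * mcoeff (monom_fun b) a)"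
      unfolding P_def by (simp only: mcoeff_sum mcoeff_scale mspan_scale monom_in_mspan UNIV_I)
    also have "\<dots> = (\<Sum>b | mcoeff Y b \<noteq> 0. if b = a then mcoeff Y a / deg a else 0)"
      by (intro sum.cong) (auto simp: mcoeff_monom)
    also have "\<dots> = mcoeff Y a / deg a" by (simp add: finite_support_mcoeff)
    finally show ?thesis .
  qed
  have "U i = partial i P" for i
  proof (rule mcoeff_eqI)
    fix a
    have "partial i Y = (\<lambda>x. \<Sum>j\<in>UNIV. x $ j * partial i (U j) x + (if j = i then 1 else 0) * U j x)"
      unfolding Y_def by (simp add: partial_sum partial_mult U Poly_intros partial_coord)
    also have "\<dots> = (\<lambda>x. (\<Sum>j\<in>UNIV. x $ j * partial j (U i) x) + U i x)"
    proof
      fix x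
      have "(\<Sum>j\<in>UNIV. (if j = i then 1 else 0) * U j x) = (\<Sum>j\<in>UNIV. if j = i then U j x else 0)"
        by (intro sum.cong) auto
      then show "(\<Sum>j\<in>UNIV. x $ j * partial i (U j) x + (if j = i then 1 else 0) * U j x)
        = (\<Sum>j\<in>UNIV. x $ j * partial j (U i) x) + U i x"
        by (simp add: sum.distrib curl_free[of i])
    qed
    finally have "mcoeff (partial i Y) a = real (deg a) * mcoeff (U i) a + mcoeff (U i) a"
      by (simp add: mcoeff_add mcoeff_euler U Poly_intros Poly_partial deg_def)
    then have e: "real (Suc (a i)) * mcoeff Y (a(i := Suc (a i))) = real (Suc (deg a)) * mcoeff (U i) a"
      using mcoeff_partial[OF YP, of i a] by (simp add: algebra_simps)
    have "deg (a(i := Suc (a i))) = Suc (deg a)"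
      using deg_upd[of a i "Suc (a i)"] by simp
    then have "mcoeff (partial i P) a = real (Suc (a i)) * mcoeff Y (a(i := Suc (a i))) / Suc (deg a)"
      by (simp add: mcoeff_partial[OF PP] coP)
    then show "mcoeff (U i) a = mcoeff (partial i P) a"
      unfolding e by simp
  qed (use U PP in \<open>auto intro: Poly_partial\<close>)
  with PA that show thesis by blast
qed

lemma mspan_empty: "p \<in> mspan {} \<Longrightarrow> p = (\<lambda>x. 0)"
  by (simp add: mspan_def zero_fun_def)

text \<open>
  A curl-free field orthogonal to the position vector is a gradient whose potential has no monomials
  at all. It yields the directness of the sum of gradients and fields \<open>q \<times> x\<close>.
\<close>

lemma koszul_exact:
  fixes U :: "3 \<Rightarrow> scalar_field"
  assumes "\<And>i. U i \<in> Poly" "\<And>i j. partial i (U j) = partial j (U i)"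
    and "\<And>x. (\<Sum>i\<in>UNIV. x $ i * U i x) = 0"
  shows "U i = (\<lambda>x. 0)"
proof -
  have Y: "(\<lambda>x. \<Sum>i\<in>UNIV. x $ i * U i x) \<in> mspan {}"
    using assms(3) by (simp add: mspan_zero)
  obtain P where P: "P \<in> mspan {}" "\<And>i. U i = partial i P"
    by (rule poly_potential[where U=U, OF assms(1,2) Y]) blast
  then show ?thesis using mspan_empty[OF P(1)] P(2)[of i] by (simp add: partial_const)
qed

section \<open>Bubble functions\<close>

definition axis_bubble :: "real^3 \<Rightarrow> real^3 \<Rightarrow> 3 \<Rightarrow> scalar_field"
  where "axis_bubble c h k = (\<lambda>x. (x $ k - c $ k + h $ k) * (c $ k + h $ k - x $ k))"

lemma axis_bubble_Poly: "axis_bubble c h k \<in> Poly"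
  unfolding axis_bubble_def by (intro Poly_intros)

lemma axis_bubble_pos: "x \<in> box (c - h) (c + h) \<Longrightarrow> axis_bubble c h k x > 0"
  unfolding axis_bubble_def mem_box_cart by (intro mult_pos_pos) (force dest: spec[of _ k])+

lemma prod_axis_bubble_pos: "x \<in> box (c - h) (c + h) \<Longrightarrow> (\<Prod>k\<in>J. axis_bubble c h k x) > 0"
  by (intro prod_pos) (auto intro: axis_bubble_pos)

lemma axis_bubble_other_face: "k \<noteq> i \<Longrightarrow> axis_bubble c h k (face_point c h i s x) = axis_bubble c h k x"
  by (auto simp: axis_bubble_def face_point_def set_coord_nth)

lemma face_point_commute:
  "i \<noteq> j \<Longrightarrow> face_point c h i s (face_point c h j t x) = face_point c h j t (face_point c h i s x)"
  unfolding face_point_def by (rule set_coord_commute)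

lemma face_point_same: "face_point c h i s (face_point c h i t x) = face_point c h i s x"
  unfolding face_point_def by (rule set_coord_same)

lemma face_point_indep:
  "p \<in> mspan A \<Longrightarrow> (\<And>a. a \<in> A \<Longrightarrow> a i = 0) \<Longrightarrow> p (face_point c h i s x) = p x"
  unfolding face_point_def by (rule set_coord_indep)

lemma partial_face_point: "p \<in> Poly \<Longrightarrow> partial j (\<lambda>x. p (face_point c h i s x)) x =
    (if j = i then 0 else partial j p (face_point c h i s x))"
  unfolding face_point_def by (simp add: partial_set_coord)

lemma Poly_factor_cancel:
  assumes "\<forall>i. h $ i > 0" "p \<in> Poly" "\<And>x. x \<in> box (c - h) (c + h) \<Longrightarrow> w x \<noteq> 0"
    and "\<And>x. w x * p x = 0"
  shows "p = (\<lambda>x. 0)"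
  using Poly_eq_0_on_box[OF assms(2) box_nonempty[OF assms(1)]] assms(3,4) by (metis mult_eq_0_iff)

lemma divide_axis_bubble:
  assumes h: "\<forall>i. h $ i > 0" and p: "p \<in> Poly"
    and van: "\<And>s x. s \<in> {-1, 1} \<Longrightarrow> p (face_point c h k s x) = 0"
  obtains q where "q \<in> Poly" "\<And>x. p x = axis_bubble c h k x * q x"
proof -
  let ?l = "c $ k + (-1) * h $ k" and ?u = "c $ k + 1 * h $ k"
  obtain q1 where q1: "q1 \<in> Poly" "\<And>x. p x - p (set_coord k ?u x) = (x $ k - ?u) * q1 x"
    using divide_linear_factor[OF p, where B=UNIV and i=k and t="?u"] by blast
  have p1: "p x = (x $ k - ?u) * q1 x" for x
    using q1(2)[of x] van[of 1 x] unfolding face_point_def by simp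
  have q1l: "q1 (set_coord k ?l x) = 0" for x
  proof -
    have "0 = (set_coord k ?l x $ k - ?u) * q1 (set_coord k ?l x)"
      using p1[of "set_coord k ?l x"] van[of "-1" x] unfolding face_point_def by simp
    then show ?thesis using h by (auto simp: set_coord_nth) (metis less_irrefl)
  qed
  obtain q2 where q2: "q2 \<in> Poly" "\<And>x. q1 x - q1 (set_coord k ?l x) = (x $ k - ?l) * q2 x"
    using divide_linear_factor[OF q1(1), where B=UNIV and i=k and t="?l"] by blast
  have q1x: "q1 x = (x $ k - ?l) * q2 x" for x
    using q2(2)[of x] q1l[of x] by simp
  have "p x = axis_bubble c h k x * (- q2 x)" for x
    unfolding p1[of x] q1x axis_bubble_def by (simp add: algebra_simps)
  with q2(1) that show thesis using mspan_uminus by blast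
qed

text \<open>
  A polynomial vanishing on the faces orthogonal to the axes in \<open>F\<close> is divisible by all their linear
  factors: the quotient by one pair of factors still vanishes on the other faces, since the factors
  removed do not vanish there identically.
\<close>

lemma divide_prod_axis_bubble:
  assumes h: "\<forall>i. h $ i > 0" and p: "p \<in> Poly" and F: "finite F"
    and van: "\<And>k s x. k \<in> F \<Longrightarrow> s \<in> {-1, 1} \<Longrightarrow> p (face_point c h k s x) = 0"
  obtains q where "q \<in> Poly" "\<And>x. p x = (\<Prod>k\<in>F. axis_bubble c h k x) * q x"
proof -
  have "\<exists>q\<in>Poly. (\<forall>x. p x = (\<Prod>k\<in>F. axis_bubble c h k x) * q x)"
    using F p van
  proof (induction F arbitrary: p rule: finite_induct)
    case empty
    then show ?case by (intro bexI[of _ p]) auto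
  next
    case (insert k F)
    obtain p' where p': "p' \<in> Poly" "\<And>x. p x = axis_bubble c h k x * p' x"
      using divide_axis_bubble[OF h insert.prems(1), of c k] insert.prems(2) by blast
    have "p' (face_point c h j s x) = 0" if j: "j \<in> F" and s: "s \<in> {-1, 1}" for j s x
    proof -
      have jk: "k \<noteq> j" using j insert.hyps by auto
      have "axis_bubble c h k x * p' (face_point c h j s x) = 0" for x
        using p'(2)[of "face_point c h j s x"] insert.prems(2)[of j s x] j s
        by (simp add: axis_bubble_other_face[OF jk])
      then have "(\<lambda>x. p' (face_point c h j s x)) = (\<lambda>x. 0)"
        using axis_bubble_pos[of _ c h k] by (intro Poly_factor_cancel[OF h, where w="axis_bubble c h k" and c=c])
          (auto intro: Poly_face_point p'(1) simp: less_le)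
      then show ?thesis by (rule fun_cong)
    qed
    from insert.IH[OF p'(1) this] obtain q where "q \<in> Poly" "\<And>x. p' x = (\<Prod>k\<in>F. axis_bubble c h k x) * q x"
      by blast
    then show ?case using p'(2) insert.hyps by (intro bexI[of _ q]) auto
  qed
  with that show thesis by blast
qed

lemma mcoeff_axis_bubble_mult:
  assumes "q \<in> Poly"
  shows "mcoeff (\<lambda>x. axis_bubble c h k x * q x) a =
    - (if a k < 2 then 0 else mcoeff q (a(k := a k - 2)))
    + 2 * c $ k * (if a k = 0 then 0 else mcoeff q (a(k := a k - 1)))
    + (h $ k * h $ k - c $ k * c $ k) * mcoeff q a"
proof -
  have eq: "(\<lambda>x. axis_bubble c h k x * q x) = (\<lambda>x. (- (x $ k * (x $ k * q x)) + 2 * c $ k * (x $ k * q x))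
      + (h $ k * h $ k - c $ k * c $ k) * q x)"
    by (simp add: fun_eq_iff axis_bubble_def algebra_simps)
  have xx: "mcoeff (\<lambda>x. x $ k * (x $ k * q x)) a = (if a k < 2 then 0 else mcoeff q (a(k := a k - 2)))"
  proof -
    have "mcoeff (\<lambda>x. x $ k * (x $ k * q x)) a = (if a k = 0 then 0 else if a k - 1 = 0 then 0 else mcoeff q (a(k := a k - 1 - 1)))"
      by (simp only: mcoeff_coord_mult Poly_mult Poly_coord assms fun_upd_same fun_upd_upd)
    then show ?thesis by (auto simp: less_2_cases_iff numeral_2_eq_2)
  qed
  have "(\<lambda>x. x $ k * q x) \<in> Poly" "(\<lambda>x. x $ k * (x $ k * q x)) \<in> Poly"
    using assms by (intro Poly_intros; assumption)+
  then show ?thesis unfolding eq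
    by (simp only: mcoeff_add mcoeff_uminus mcoeff_scale mcoeff_coord_mult[OF assms] xx mspan_add mspan_uminus mspan_scale assms)
qed

text \<open>
  The leading part of \<open>axis_bubble c h k\<close> is \<open>- (x $ k)\<^sup>2\<close>. Thus multiplication raises the degree by
  exactly two, every top-degree monomial of the product contains \<open>(x $ k)\<^sup>2\<close>, and the top coefficients
  of the cofactor can be read off.
\<close>

lemma axis_bubble_mult_degree:
  assumes "q \<in> mspan {a. deg a \<le> d}"
  shows "(\<lambda>x. axis_bubble c h k x * q x) \<in> mspan {a. deg a \<le> d + 2}"
    and "deg a = d \<Longrightarrow> mcoeff (\<lambda>x. axis_bubble c h k x * q x) (a(k := a k + 2)) = - mcoeff q a"
    and "deg b = d + 2 \<Longrightarrow> b k < 2 \<Longrightarrow> mcoeff (\<lambda>x. axis_bubble c h k x * q x) b = 0"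
proof -
  have qP: "q \<in> Poly" using assms by (rule mspan_Poly)
  have 0: "mcoeff q b = 0" if "deg b > d" for b
    using mspanD[OF assms, of b] that by fastforce
  have *: "mcoeff (\<lambda>x. axis_bubble c h k x * q x) b = - (if b k < 2 then 0 else mcoeff q (b(k := b k - 2)))"
    if "deg b \<ge> d + 2" for b
  proof -
    have "mcoeff q b = 0" using that by (intro 0) simp
    moreover have "mcoeff q (b(k := b k - 1)) = 0" if "b k \<noteq> 0"
      using deg_upd[of b k "b k - 1"] that \<open>deg b \<ge> d + 2\<close> by (intro 0) linarith
    ultimately show ?thesis by (simp only: mcoeff_axis_bubble_mult[OF qP]) simp
  qed
  show "(\<lambda>x. axis_bubble c h k x * q x) \<in> mspan {a. deg a \<le> d + 2}"
  proof (rule mspanI)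
    fix b assume b: "mcoeff (\<lambda>x. axis_bubble c h k x * q x) b \<noteq> 0"
    show "b \<in> {a. deg a \<le> d + 2}"
    proof (rule ccontr)
      assume "b \<notin> {a. deg a \<le> d + 2}"
      then have g: "deg b > d + 2" by simp
      then have "mcoeff q (b(k := b k - 2)) = 0" if "b k \<ge> 2"
        using deg_upd[of b k "b k - 2"] that by (intro 0) linarith
      then have "mcoeff (\<lambda>x. axis_bubble c h k x * q x) b = 0" using *[of b] g by (cases "b k < 2") auto
      then show False using b by simp
    qed
  qed (intro Poly_mult axis_bubble_Poly qP)
  show "mcoeff (\<lambda>x. axis_bubble c h k x * q x) (a(k := a k + 2)) = - mcoeff q a" if "deg a = d"
  proof -
    have "deg (a(k := a k + 2)) \<ge> d + 2" using deg_upd[of a k "a k + 2"] that by simp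
    from *[OF this] show ?thesis by simp
  qed
  show "mcoeff (\<lambda>x. axis_bubble c h k x * q x) b = 0" if "deg b = d + 2" "b k < 2"
    using *[of b] that by simp
qed

lemma prod_axis_bubble_mult_degree:
  assumes "finite F" "q \<in> mspan {a. deg a \<le> d}"
  shows "(\<lambda>x. (\<Prod>k\<in>F. axis_bubble c h k x) * q x) \<in> mspan {a. deg a \<le> d + 2 * card F} \<and>
    (\<forall>a. deg a = d \<longrightarrow>
      deg (\<lambda>j. if j \<in> F then a j + 2 else a j) = d + 2 * card F \<and>
      mcoeff (\<lambda>x. (\<Prod>k\<in>F. axis_bubble c h k x) * q x) (\<lambda>j. if j \<in> F then a j + 2 else a j) = (-1) ^ card F * mcoeff q a)"
  using assms(1)
proof (induction F rule: finite_induct)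
  case empty
  then show ?case using assms(2) by simp
next
  case (insert k F)
  let ?p = "\<lambda>x. (\<Prod>k\<in>F. axis_bubble c h k x) * q x"
  have p: "?p \<in> mspan {a. deg a \<le> d + 2 * card F}" using insert.IH by blast
  have eq: "(\<lambda>x. (\<Prod>k\<in>insert k F. axis_bubble c h k x) * q x) = (\<lambda>x. axis_bubble c h k x * ?p x)"
    using insert.hyps by (simp add: mult.assoc)
  have card: "card (insert k F) = Suc (card F)" using insert.hyps by simp
  show ?case
    unfolding eq card
  proof (intro conjI allI impI)
    show "(\<lambda>x. axis_bubble c h k x * ?p x) \<in> mspan {a. deg a \<le> d + 2 * Suc (card F)}"
      using axis_bubble_mult_degree(1)[OF p, of c h k] by (simp add: add.assoc)
    fix a assume a: "deg a = d"
    define b where "b = (\<lambda>j. if j \<in> F then a j + 2 else a j)"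
    have b: "deg b = d + 2 * card F" "mcoeff ?p b = (-1) ^ card F * mcoeff q a"
      using insert.IH a unfolding b_def by blast+
    have e: "(\<lambda>j. if j \<in> insert k F then a j + 2 else a j) = b(k := b k + 2)"
      using insert.hyps by (auto simp: fun_eq_iff b_def)
    show "deg (\<lambda>j. if j \<in> insert k F then a j + 2 else a j) = d + 2 * Suc (card F)"
      unfolding e using deg_upd[of b k "b k + 2"] b(1) by simp
    show "mcoeff (\<lambda>x. axis_bubble c h k x * ?p x) (\<lambda>j. if j \<in> insert k F then a j + 2 else a j) = (-1) ^ Suc (card F) * mcoeff q a"
      unfolding e axis_bubble_mult_degree(2)[OF p b(1)] b(2) by simp
  qed
qed

lemma top_degree_exponent:
  assumes q: "q \<in> Poly" and a: "mcoeff q a \<noteq> 0"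
  obtains b where "mcoeff q b \<noteq> 0" "deg a \<le> deg b" "q \<in> mspan {a. deg a \<le> deg b}"
proof -
  have fin: "finite (deg ` {a. mcoeff q a \<noteq> 0})" using finite_support_mcoeff by blast
  have "Max (deg ` {a. mcoeff q a \<noteq> 0}) \<in> deg ` {a. mcoeff q a \<noteq> 0}"
    using a by (intro Max_in[OF fin]) blast
  then obtain b where b: "mcoeff q b \<noteq> 0" "deg b = Max (deg ` {a. mcoeff q a \<noteq> 0})" by auto
  then have le: "mcoeff q c \<noteq> 0 \<Longrightarrow> deg c \<le> deg b" for c using Max_ge[OF fin] by auto
  have "q \<in> mspan {a. deg a \<le> deg b}" by (rule mspanI[OF q]) (use le in blast)
  with b(1) le[OF a] that show thesis by blast
qed

lemma antiderivative:
  assumes "q \<in> poly_space J k" "j \<in> J"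
  shows "\<exists>g \<in> poly_space J (k + 1). partial j g = q"
  using assms(1) unfolding poly_space_mspan
proof (induction rule: mspan_induct)
  case zero
  then show ?case by (intro bexI[of _ "\<lambda>x. 0"] mspan_zero partial_const)
next
  case (monom a)
  let ?g = "\<lambda>x. (1 / Suc (a j)) * monom_fun (a(j := Suc (a j))) x"
  have "partial j ?g = monom_fun a"
    by (subst partial_scale) (simp_all add: monom_in_mspan partial_monom)
  moreover have "?g \<in> mspan {a. (\<forall>j. j \<notin> J \<longrightarrow> a j = 0) \<and> int (deg a) \<le> k + 1}"
    using monom assms(2) deg_upd[of a j "Suc (a j)"]
    by (intro mspan_scale monom_in_mspan) (auto split: if_splits)
  ultimately show ?case by blast
next
  case (add p q)
  then obtain f g where "f \<in> mspan {a. (\<forall>j. j \<notin> J \<longrightarrow> a j = 0) \<and> int (deg a) \<le> k + 1}" "partial j f = p"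
    "g \<in> mspan {a. (\<forall>j. j \<notin> J \<longrightarrow> a j = 0) \<and> int (deg a) \<le> k + 1}" "partial j g = q" by blast
  then show ?case by (intro bexI[of _ "\<lambda>x. f x + g x"] mspan_add) (simp_all add: partial_add mspan_Poly)
next
  case (scale s p)
  then obtain f where "f \<in> mspan {a. (\<forall>j. j \<notin> J \<longrightarrow> a j = 0) \<and> int (deg a) \<le> k + 1}" "partial j f = p" by blast
  then show ?case by (intro bexI[of _ "\<lambda>x. s * f x"] mspan_scale) (simp_all add: partial_scale mspan_Poly)
qed

lemma constant_if_partial_0:
  assumes "p \<in> Poly" "\<And>j. partial j p = (\<lambda>x. 0)"
  shows "p x = p y"
proof -
  have c0: "mcoeff p a = 0" if a0: "a \<noteq> (\<lambda>j. 0)" for a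
  proof -
    obtain i where i: "a i \<noteq> 0" using a0 by (auto simp: fun_eq_iff)
    have "mcoeff (partial i p) (a(i := a i - 1)) = 0" using assms(2) by (simp add: mcoeff_zero)
    then show ?thesis using i by (simp add: mcoeff_partial[OF assms(1)])
  qed
  have "p \<in> mspan {\<lambda>j. 0}" by (rule mspanI[OF assms(1)]) (use c0 in blast)
  then show ?thesis
    by (induction rule: mspan_induct) (auto simp: monom_fun_0)
qed

text \<open>
  On each face all tangential derivatives of \<open>P\<close> vanish, so \<open>P\<close> is constant there; faces orthogonal
  to different axes meet, so the constants agree. Opposite faces are compared through a third face,
  which is why two axes in \<open>J\<close> are required.
\<close>

lemma constant_on_boundary:
  assumes P: "P \<in> Poly" and J: "\<And>k. \<exists>k'\<in>J. k' \<noteq> k"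
    and tang: "\<And>j k s x. k \<in> J \<Longrightarrow> s \<in> {-1, 1} \<Longrightarrow> j \<noteq> k \<Longrightarrow> partial j P (face_point c h k s x) = 0"
  shows "\<exists>C. \<forall>k\<in>J. \<forall>s\<in>{-1, 1}. \<forall>x. P (face_point c h k s x) = C"
proof -
  have const: "P (face_point c h k s x) = P (face_point c h k s y)" if "k \<in> J" "s \<in> {-1, 1}" for k s x y
  proof (rule constant_if_partial_0[of "\<lambda>x. P (face_point c h k s x)"])
    show "partial j (\<lambda>x. P (face_point c h k s x)) = (\<lambda>x. 0)" for j
      using tang[OF that] by (auto simp: partial_face_point[OF P])
  qed (rule Poly_face_point[OF P])
  have ne: "P (face_point c h k s x) = P (face_point c h k' s' y)"
    if "k \<in> J" "k' \<in> J" "k \<noteq> k'" "s \<in> {-1, 1}" "s' \<in> {-1, 1}" for k k' s s' x y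
    using const[OF that(1,4), of x "face_point c h k' s' 0"] const[OF that(2,5), of y "face_point c h k s 0"]
      face_point_commute[OF that(3), of c h s s' 0] by simp
  have "P (face_point c h k s x) = P (face_point c h k' s' y)"
    if k: "k \<in> J" "k' \<in> J" "s \<in> {-1, 1}" "s' \<in> {-1, 1}" for k k' s s' x y
  proof (cases "k = k'")
    case True
    obtain l where "l \<in> J" "l \<noteq> k" using J by blast
    then show ?thesis using ne[of k l s 1 x 0] ne[of l k' 1 s' 0 y] k True by auto
  qed (use ne k in blast)
  then show ?thesis by metis
qed

text \<open>
  The final step both on a face (\<open>J = - {i}\<close>) and in the box (\<open>J = UNIV\<close>). A gradient with vanishing
  tangential trace has a potential of the form \<open>(\<Prod>k\<in>J. axis_bubble c h k) * q\<close>. The top-degree monomials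
  of this product have all exponents at least two, so for them superlinear degree and total degree
  coincide, and a potential of superlinear degree at most \<open>r\<close> forces \<open>deg q \<le> r - 2 * card J\<close>. This
  is small enough for \<open>q\<close> to be the derivative of an admissible test function, and integration by
  parts gives the weighted integral of \<open>q\<^sup>2\<close>.
\<close>

lemma gradient_bubble_eq_0:
  assumes h: "\<forall>i. h $ i > 0" and r: "r \<ge> 0"
    and J: "\<And>k. \<exists>k'\<in>J. k' \<noteq> k"
    and P: "P \<in> mspan {a. (\<forall>j. j \<notin> J \<longrightarrow> a j = 0) \<and> int (superlinear_degree a) \<le> r}"
    and tang: "\<And>j k s x. k \<in> J \<Longrightarrow> s \<in> {-1, 1} \<Longrightarrow> j \<noteq> k \<Longrightarrow> partial j P (face_point c h k s x) = 0"
    and j: "j \<in> J"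
    and orth: "\<And>q. q \<in> poly_space J (r - 2 * int (card J) + 1) \<Longrightarrow> box_integral c h (\<lambda>x. partial j P x * q x) = 0"
  shows "partial i P = (\<lambda>x. 0)"
proof -
  let ?A = "{a. (\<forall>j. j \<notin> J \<longrightarrow> a j = 0) \<and> int (superlinear_degree a) \<le> r}"
  have PP: "P \<in> Poly" using P by (rule mspan_Poly)
  obtain C where C: "\<And>k s x. k \<in> J \<Longrightarrow> s \<in> {-1, 1} \<Longrightarrow> P (face_point c h k s x) = C"
    using constant_on_boundary[OF PP J tang] by blast
  define Q where "Q = (\<lambda>x. P x - C)"
  have QA: "Q \<in> mspan ?A"
    unfolding Q_def using r by (intro mspan_diff P mspan_const) (auto simp: superlinear_degree_index3[of _ 1])
  then have QP: "Q \<in> Poly" by (rule mspan_Poly)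
  have pdQ: "partial k Q = partial k P" for k unfolding Q_def by (simp add: partial_diff PP Poly_const partial_const)
  have Qvan: "Q (face_point c h k s x) = 0" if "k \<in> J" "s \<in> {-1, 1}" for k s x
    using C[OF that] by (simp add: Q_def)
  let ?B = "\<lambda>x. \<Prod>k\<in>J. axis_bubble c h k x"
  obtain q where q: "q \<in> Poly" "\<And>x. Q x = ?B x * q x"
    by (rule divide_prod_axis_bubble[OF h QP, of J c]) (use Qvan in auto)
  have Bpos: "x \<in> box (c - h) (c + h) \<Longrightarrow> ?B x > 0" for x by (rule prod_axis_bubble_pos)
  have BP: "?B \<in> Poly" by (intro Poly_prod axis_bubble_Poly)
  have Qq: "Q = (\<lambda>x. ?B x * q x)" using q(2) by (simp add: fun_eq_iff)
  \<comment> \<open>freezing a coordinate outside of \<open>J\<close> changes neither \<open>Q\<close> nor the bubbles, hence not \<open>q\<close>\<close>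
  have indep: "a l = 0" if "mcoeff q a \<noteq> 0" "l \<notin> J" for a l
  proof -
    have "(\<lambda>x. q (set_coord l 0 x) - q x) = (\<lambda>x. 0)"
    proof (rule Poly_factor_cancel[OF h, where w="?B" and c=c])
      show "(\<lambda>x. q (set_coord l 0 x) - q x) \<in> Poly" by (intro Poly_intros Poly_set_coord q)
      show "?B x * (q (set_coord l 0 x) - q x) = 0" for x
      proof -
        have "?B (set_coord l 0 x) = ?B x"
          using \<open>l \<notin> J\<close> by (intro prod.cong) (auto simp: axis_bubble_def set_coord_nth)
        moreover have "Q (set_coord l 0 x) = Q x"
          using \<open>l \<notin> J\<close> by (intro set_coord_indep[OF QA]) auto
        ultimately show ?thesis using q(2)[of x] q(2)[of "set_coord l 0 x"] by (simp add: algebra_simps)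
      qed
    qed (use Bpos in \<open>auto simp: less_le\<close>)
    then have "q = (\<lambda>x. q (set_coord l 0 x))" by (simp add: fun_eq_iff)
    also have "\<dots> \<in> mspan {a. a l = 0}" by (rule mspan_set_coord[OF q(1)]) auto
    finally show ?thesis using mspanD that(1) by blast
  qed
  \<comment> \<open>compare with a coefficient of maximal degree\<close>
  have bound: "int (deg a) \<le> r - 2 * int (card J)" if a: "mcoeff q a \<noteq> 0" for a
  proof -
    obtain b where b: "mcoeff q b \<noteq> 0" "deg a \<le> deg b" "q \<in> mspan {a. deg a \<le> deg b}"
      using top_degree_exponent[OF q(1) a] by blast
    \<comment> \<open>the monomial of \<open>Q\<close> that comes from \<open>b\<close> through the leading terms of the bubbles\<close>
    let ?b = "\<lambda>j. if j \<in> J then b j + 2 else b j"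
    have "finite J" by simp
    from prod_axis_bubble_mult_degree[OF this b(3), of c h]
    have *: "deg ?b = deg b + 2 * card J" "mcoeff Q ?b = (-1) ^ card J * mcoeff q b"
      unfolding Qq by blast+
    then have "mcoeff Q ?b \<noteq> 0" using b by simp
    then have "int (superlinear_degree ?b) \<le> r" using mspanD[OF QA] by blast
    moreover have "superlinear_degree ?b = deg ?b"
      using indep[OF b(1)] by (auto simp: superlinear_degree_index3[of _ 1] deg_index3[of _ 1])
    ultimately show ?thesis using *(1) b(2) by linarith
  qed
  have qJ: "q \<in> poly_space J (r - 2 * int (card J))"
    unfolding poly_space_mspan by (rule mspanI[OF q(1)]) (use indep bound in auto)
  obtain g where g: "g \<in> poly_space J (r - 2 * int (card J) + 1)" "partial j g = q"
    using antiderivative[OF qJ j] by blast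
  have "0 = box_integral c h (\<lambda>x. partial j Q x * g x)" using orth[OF g(1)] by (simp add: pdQ)
  also have "\<dots> = - box_integral c h (\<lambda>x. Q x * partial j g x)"
    using h Qvan[OF j] poly_space_Poly[OF g(1)]
    by (intro integration_by_parts QP) (auto simp: face_point_def)
  finally have "box_integral c h (\<lambda>x. ?B x * (q x * q x)) = 0"
    by (simp add: g(2) Qq mult.assoc)
  then have "q = (\<lambda>x. 0)"
    using box_integral_square_eq_0[OF h q(1) BP Bpos] by blast
  then have "Q = (\<lambda>x. 0)" using Qq by simp
  then show ?thesis using pdQ[of i] partial_const by metis
qed

section \<open>The structure of S1\<close>

text \<open>
  The components of the two non-gradient summands of \<open>S1\<close>: the fields \<open>q \<times> x\<close> and the additional
  fields given by the functions \<open>w\<close>. Families of component functions are used because the components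
  of a field play the role of independent scalar unknowns in most arguments.
\<close>

definition koszul_part :: "(3 \<Rightarrow> scalar_field) \<Rightarrow> 3 \<Rightarrow> scalar_field"
  where "koszul_part q i = (\<lambda>x. q (i + 1) x * x $ (i + 2) - q (i + 2) x * x $ (i + 1))"

definition extra_part :: "(3 \<Rightarrow> scalar_field) \<Rightarrow> 3 \<Rightarrow> scalar_field"
  where "extra_part w i = (\<lambda>x. x $ (i + 1) * (x $ (i + 2) * (w (i + 1) x - w (i + 2) x)))"

lemma cross3_nth: "cross3 a b $ i = a $ (i + 1) * b $ (i + 2) - a $ (i + 2) * b $ (i + 1)"
  using exhaust_3[of i] by (auto simp: cross3_def numeral_index3)

lemma cross_position_nth: "cross3 (q x) x $ i = koszul_part (\<lambda>j x. q x $ j) i x"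
  by (simp add: cross3_nth koszul_part_def)

lemma extra_vector_nth: "(vector [x$2 * x$3 * (w 2 x - w 3 x), x$1 * x$3 * (w 3 x - w 1 x),
    x$1 * x$2 * (w 1 x - w 2 x)] :: real^3) $ i = extra_part w i x"
  using exhaust_3[of i] by (auto simp: extra_part_def numeral_index3)

lemma S1E:
  assumes "u \<in> S1 r"
  obtains p q w where "p \<in> S0 r" "\<And>j. q j \<in> poly_space UNIV (r - 1)"
    "\<And>j. w j \<in> hom_space (- {j}) (r - 1)"
    "\<And>i. (\<lambda>x. u x $ i) = (\<lambda>x. partial i p x + koszul_part q i x + extra_part w i x)"
proof -
  from assms obtain p q w where p: "p \<in> S0 r" and q: "q \<in> cube (poly_space UNIV (r - 1))"
    and w: "\<forall>i. w i \<in> hom_space (- {i}) (r - 1)"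
    and u: "u = grad p + (\<lambda>x. cross3 (q x) x) + (\<lambda>x. vector [x$2 * x$3 * (w 2 x - w 3 x),
                  x$1 * x$3 * (w 3 x - w 1 x), x$1 * x$2 * (w 1 x - w 2 x)])"
    unfolding S1_def cross_space_def by (auto elim!: set_plus_elim)
  have "(\<lambda>x. u x $ i) = (\<lambda>x. partial i p x + koszul_part (\<lambda>j x. q x $ j) i x + extra_part w i x)" for i
    by (simp add: u grad_nth cross_position_nth extra_vector_nth)
  with p q w that[of p "\<lambda>j x. q x $ j" w] show thesis by (simp add: cube_iff)
qed

lemma poly_space_mono: "k \<le> l \<Longrightarrow> poly_space J k \<subseteq> poly_space J l"
  unfolding poly_space_mspan by (rule mspan_mono) auto

lemma poly_space_UNIV: "poly_space UNIV k = mspan {a. int (deg a) \<le> k}"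
  by (simp add: poly_space_mspan)

lemma deg_inc: "deg (a(i := Suc (a i))) = Suc (deg a)"
  using deg_upd[of a i "Suc (a i)"] by simp

lemma deg_dec: "a i > 0 \<Longrightarrow> deg a = Suc (deg (a(i := a i - 1)))"
  using deg_upd[of a i "a i - 1"] by simp

lemma deg_zero_le: "int (deg (a(i := 0))) \<le> int (deg a)"
  using deg_upd[of a i 0] by simp

lemma superlinear_degree_zero_le: "int (superlinear_degree (a(i := 0))) \<le> int (superlinear_degree a)"
  by (simp add: superlinear_degree_index3[of _ i] index3)

lemma coord_mult_poly_space:
  "p \<in> poly_space UNIV k \<Longrightarrow> (\<lambda>x. p x * x $ i) \<in> poly_space UNIV (k + 1)"
  unfolding poly_space_UNIV
  using mspan_coord_mult[of p "{a. int (deg a) \<le> k}" i "{a. int (deg a) \<le> k + 1}"]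
  by (simp add: deg_inc mult.commute)

lemma partial_poly_space: "p \<in> poly_space J k \<Longrightarrow> partial i p \<in> poly_space J (k - 1)"
  unfolding poly_space_mspan
  by (erule mspan_partial) (auto dest: deg_dec)

lemma poly_space_diff: "p \<in> poly_space J k \<Longrightarrow> q \<in> poly_space J k \<Longrightarrow> (\<lambda>x. p x - q x) \<in> poly_space J k"
  unfolding poly_space_mspan by (rule mspan_diff)

lemma poly_space_scale: "p \<in> poly_space J k \<Longrightarrow> (\<lambda>x. s * p x) \<in> poly_space J k"
  unfolding poly_space_mspan by (rule mspan_scale)

lemma poly_space_add: "p \<in> poly_space J k \<Longrightarrow> q \<in> poly_space J k \<Longrightarrow> (\<lambda>x. p x + q x) \<in> poly_space J k"
  unfolding poly_space_mspan by (rule mspan_add)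

lemma poly_space_zero: "(\<lambda>x. 0) \<in> poly_space J k"
  unfolding poly_space_mspan by (rule mspan_zero)

lemma koszul_part_degree:
  "(\<And>j. q j \<in> poly_space UNIV (r - 1)) \<Longrightarrow> koszul_part q i \<in> poly_space UNIV r"
  unfolding koszul_part_def using coord_mult_poly_space[of _ "r - 1"]
  by (intro poly_space_diff) simp_all

lemma restrict_poly_space:
  "p \<in> poly_space UNIV k \<Longrightarrow> (\<lambda>x. p (face_point c h i s x)) \<in> poly_space (- {i}) k"
  unfolding face_point_def poly_space_mspan
  by (erule mspan_set_coord) (auto intro: order_trans[OF deg_zero_le])

text \<open>
  Each monomial of \<open>w (i + 1) x - w (i + 2) x\<close> lacks one of the coordinates \<open>i + 1\<close> and \<open>i + 2\<close>.
  Multiplication by both makes this coordinate enter linearly, so that it does not count for the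
  superlinear degree.
\<close>

lemma extra_part_mspan:
  assumes "\<And>j. w j \<in> hom_space (- {j}) (r - 1)"
    and "\<And>a. int (deg a) = r - 1 \<Longrightarrow> a (i + 1) = 0 \<or> a (i + 2) = 0 \<Longrightarrow>
      a(i + 2 := Suc (a (i + 2)), i + 1 := Suc (a (i + 1))) \<in> B"
  shows "extra_part w i \<in> mspan B"
proof -
  let ?A = "{a. int (deg a) = r - 1 \<and> (a (i + 1) = 0 \<or> a (i + 2) = 0)}"
  let ?C = "{a(i + 2 := Suc (a (i + 2))) |a. a \<in> ?A}"
  have "w (i + 1) \<in> mspan ?A" "w (i + 2) \<in> mspan ?A"
    using assms(1)[of "i + 1"] assms(1)[of "i + 2"] unfolding hom_space_mspan
    by (auto elim!: mspan_mono[THEN subsetD, rotated])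
  then have "(\<lambda>x. w (i + 1) x - w (i + 2) x) \<in> mspan ?A" by (rule mspan_diff)
  then have "(\<lambda>x. x $ (i + 2) * (w (i + 1) x - w (i + 2) x)) \<in> mspan ?C"
    by (rule mspan_coord_mult) blast
  then show ?thesis unfolding extra_part_def
  proof (rule mspan_coord_mult)
    fix a assume "a \<in> ?C"
    then obtain b where b: "a = b(i + 2 := Suc (b (i + 2)))" "b \<in> ?A" by blast
    then show "a(i + 1 := Suc (a (i + 1))) \<in> B" using assms(2)[of b] by (auto simp: index3)
  qed
qed

lemma hom_space_euler:
  assumes "w \<in> hom_space J k"
  shows "(\<Sum>j\<in>UNIV. x $ j * partial j w x) = of_int k * w x"
proof -
  have w: "w \<in> Poly" using assms by (rule hom_space_Poly)
  have "(\<lambda>x. \<Sum>j\<in>UNIV. x $ j * partial j w x) = (\<lambda>x. of_int k * w x)"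
  proof (rule mcoeff_eqI)
    fix a
    have "mcoeff w a \<noteq> 0 \<Longrightarrow> int (deg a) = k"
      using mspanD[OF assms[unfolded hom_space_mspan]] by blast
    then show "mcoeff (\<lambda>x. \<Sum>j\<in>UNIV. x $ j * partial j w x) a = mcoeff (\<lambda>x. of_int k * w x) a"
      unfolding mcoeff_euler[OF w] mcoeff_scale[OF w] deg_def[symmetric] by (cases "mcoeff w a = 0") auto
  qed (intro Poly_intros Poly_partial w mspan_scale)+
  then show ?thesis by (rule fun_cong)
qed

lemma partial_indep: "w \<in> mspan A \<Longrightarrow> (\<And>a. a \<in> A \<Longrightarrow> a i = 0) \<Longrightarrow> partial i w = (\<lambda>x. 0)"
  by (rule mspan_empty, erule mspan_partial) (metis less_irrefl)

lemma partial_hom_space: "w \<in> hom_space (- {i}) k \<Longrightarrow> partial i w = (\<lambda>x. 0)"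
  unfolding hom_space_mspan by (erule partial_indep) auto

definition curl_comp :: "(3 \<Rightarrow> scalar_field) \<Rightarrow> 3 \<Rightarrow> scalar_field"
  where "curl_comp U i = (\<lambda>x. partial (i + 1) (U (i + 2)) x - partial (i + 2) (U (i + 1)) x)"

lemma curl_comp_Poly: "(\<And>j. U j \<in> Poly) \<Longrightarrow> curl_comp U i \<in> Poly"
  unfolding curl_comp_def by (intro Poly_intros Poly_partial)

lemma curl_comp_0_symmetric:
  assumes "\<And>i. curl_comp U i = (\<lambda>x. 0)"
  shows "partial i (U j) = partial j (U i)"
proof -
  have *: "partial (k + 1) (U (k + 2)) = partial (k + 2) (U (k + 1))" for k
    using assms[of k] unfolding curl_comp_def by (auto simp: fun_eq_iff)
  show ?thesis
    using index3_cases[of j i] *[of "i + 2"] *[of "i + 1"] by (auto simp: index3)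
qed

text \<open>
  By Euler's identity the derivatives of \<open>w i\<close> combine to a multiple of \<open>w i\<close>. The result is divisible
  by \<open>x $ i\<close>, so freezing \<open>x $ i\<close> on a face lowers its degree from \<open>r\<close> to \<open>r - 1\<close>.
\<close>

lemma curl_comp_extra_part:
  assumes w: "\<And>j. w j \<in> hom_space (- {j}) (r - 1)"
  shows "curl_comp (extra_part w) i x = x $ i * ((of_int r + 1) * w i x - w (i + 1) x - w (i + 2) x)"
proof -
  have wP: "w j \<in> Poly" for j using w by (rule hom_space_Poly)
  have euler: "x $ (i + 1) * partial (i + 1) (w i) x + x $ (i + 2) * partial (i + 2) (w i) x = (of_int r - 1) * w i x"
    using hom_space_euler[OF w[of i], of x] partial_hom_space[OF w[of i]] by (simp add: sum_index3[of _ i])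
  have wP': "(\<lambda>x. w j x - w k x) \<in> Poly" for j k by (intro Poly_intros wP)
  have wP'': "(\<lambda>x. x $ l * (w j x - w k x)) \<in> Poly" for j k l by (intro Poly_intros wP)
  have 1: "partial (i + 1) (extra_part w (i + 2)) x = x $ i * (w i x - w (i + 1) x + x $ (i + 1) * partial (i + 1) (w i) x)"
    unfolding extra_part_def index3
    by (simp add: partial_mult Poly_coord wP' wP'' partial_diff wP partial_coord partial_hom_space[OF w] index3, (simp add: algebra_simps)?)
  have 2: "partial (i + 2) (extra_part w (i + 1)) x = x $ i * (w (i + 2) x - w i x - x $ (i + 2) * partial (i + 2) (w i) x)"
    unfolding extra_part_def index3
    by (simp add: partial_mult Poly_coord wP' wP'' partial_diff wP partial_coord partial_hom_space[OF w] index3, (simp add: algebra_simps)?)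
  have "curl_comp (extra_part w) i x = x $ i * (2 * w i x - w (i + 1) x - w (i + 2) x
    + (x $ (i + 1) * partial (i + 1) (w i) x + x $ (i + 2) * partial (i + 2) (w i) x))"
    unfolding curl_comp_def 1 2 by (simp add: algebra_simps)
  then show ?thesis unfolding euler by (simp add: algebra_simps)
qed

lemma position_koszul_part: "(\<Sum>i\<in>UNIV. x $ i * koszul_part q i x) = 0"
  by (simp add: sum_index3[of _ 1] koszul_part_def numeral_index3 algebra_simps)

lemma position_extra_part: "(\<Sum>i\<in>UNIV. x $ i * extra_part w i x) = 0"
  by (simp add: sum_index3[of _ 1] extra_part_def numeral_index3 algebra_simps)

locale S1_field =
  fixes r :: int and p :: scalar_field and q w u :: "3 \<Rightarrow> scalar_field"
  assumes r: "r \<ge> 2" and p: "p \<in> S0 r" and q: "\<And>j. q j \<in> poly_space UNIV (r - 1)"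
    and w: "\<And>j. w j \<in> hom_space (- {j}) (r - 1)"
    and u: "\<And>i. u i = (\<lambda>x. partial i p x + koszul_part q i x + extra_part w i x)"
begin

lemma Poly_parts: "p \<in> Poly" "koszul_part q i \<in> Poly" "extra_part w i \<in> Poly" "u i \<in> Poly"
proof -
  show *: "p \<in> Poly" using p by (rule S0_Poly)
  show **: "koszul_part q i \<in> Poly" by (rule poly_space_Poly, rule koszul_part_degree) (rule q)
  show ***: "extra_part w i \<in> Poly" by (rule extra_part_mspan[OF w]) auto
  show "u i \<in> Poly" unfolding u by (intro Poly_intros Poly_partial * ** ***)
qed

text \<open>
  A field in \<open>S1\<close> has tangential component of degree at most \<open>r - 1\<close> along each edge: in a monomial
  of superlinear degree at most \<open>r\<close> no exponent exceeds \<open>r\<close>, and the other two summands of the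
  \<open>i\<close>-th component contain \<open>x $ i\<close> only through \<open>q\<close> and \<open>w\<close>.
\<close>

lemma edge_degree: "u i \<in> mspan {a. int (a i) \<le> r - 1}"
  unfolding u
proof (intro mspan_add)
  have "a i \<le> r" if "int (superlinear_degree a) \<le> r" for a
    using superlinear_degree_ge[of a i] that r by (cases "a i = 1") auto
  then show "partial i p \<in> mspan {a. int (a i) \<le> r - 1}"
    using p unfolding S0_mspan by (elim mspan_partial) force
  have A: "q j \<in> mspan {a. int (deg a) \<le> r - 1}" for j using q[of j] by (simp add: poly_space_UNIV)
  have D: "int (a i) \<le> r - 1" if "int (deg a) \<le> r - 1" for a
    using deg_ge[of a i] that by simp
  have M: "(\<lambda>x. q j x * x $ k) \<in> mspan {a. int (a i) \<le> r - 1}" if "k \<noteq> i" for j k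
    unfolding mult.commute[of "q j _"]
    using A[of j] by (rule mspan_coord_mult) (use that D in auto)
  show "koszul_part q i \<in> mspan {a. int (a i) \<le> r - 1}"
    unfolding koszul_part_def by (intro mspan_diff M index3)
  show "extra_part w i \<in> mspan {a. int (a i) \<le> r - 1}"
    by (rule extra_part_mspan[OF w]) (auto simp: index3 deg_index3[of _ i])
qed

lemma normal_face_degree: "u i \<in> mspan {a. int (superlinear_degree (a(i := 0))) \<le> r}"
  unfolding u
proof (intro mspan_add)
  show "partial i p \<in> mspan {a. int (superlinear_degree (a(i := 0))) \<le> r}"
    using p unfolding S0_mspan by (elim mspan_partial) (auto intro: order_trans[OF superlinear_degree_zero_le])
  have "int (superlinear_degree (a(i := 0))) \<le> int (deg a)" for a
    by (simp add: superlinear_degree_index3[of _ i] deg_index3[of _ i] index3)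
  from order_trans[OF this] have "mspan {a. int (deg a) \<le> r} \<subseteq> mspan {a. int (superlinear_degree (a(i := 0))) \<le> r}"
    by (intro mspan_mono) auto
  moreover have "koszul_part q i \<in> poly_space UNIV r" by (rule koszul_part_degree) (rule q)
  ultimately show "koszul_part q i \<in> mspan {a. int (superlinear_degree (a(i := 0))) \<le> r}"
    unfolding poly_space_UNIV by blast
  show "extra_part w i \<in> mspan {a. int (superlinear_degree (a(i := 0))) \<le> r}"
    by (rule extra_part_mspan[OF w])
      (auto simp: superlinear_degree_index3[of _ i] index3 deg_index3[of _ i])
qed

text \<open>
  The other two summands are orthogonal to the position vector, and the Euler operator preserves the
  monomials of \<open>p\<close>.
\<close>

lemma position_dot: "(\<lambda>x. \<Sum>i\<in>UNIV. x $ i * u i x) \<in> S0 r"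
proof -
  have "(\<lambda>x. \<Sum>i\<in>UNIV. x $ i * u i x) = (\<lambda>x. \<Sum>i\<in>UNIV. x $ i * partial i p x)"
    using position_koszul_part[where q=q] position_extra_part[where w=w]
    by (simp add: u distrib_left sum.distrib)
  moreover have "(\<lambda>x. x $ i * partial i p x) \<in> S0 r" for i
  proof -
    have "partial i p \<in> mspan {a. int (superlinear_degree (a(i := Suc (a i)))) \<le> r}"
      using p unfolding S0_mspan by (elim mspan_partial) simp
    then show ?thesis unfolding S0_mspan by (rule mspan_coord_mult) simp
  qed
  ultimately show ?thesis unfolding S0_mspan by (simp add: mspan_sum)
qed

lemma curl_decomp: "curl_comp u i x = curl_comp (koszul_part q) i x
    + x $ i * ((of_int r + 1) * w i x - w (i + 1) x - w (i + 2) x)"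
proof -
  have "partial j (u k) x = partial j (partial k p) x + partial j (koszul_part q k) x + partial j (extra_part w k) x" for j k
    unfolding u by (simp add: partial_add Poly_parts Poly_partial mspan_add)
  then have "curl_comp u i x = curl_comp (koszul_part q) i x + curl_comp (extra_part w) i x"
    unfolding curl_comp_def using partial_commute[OF Poly_parts(1), of "i + 1" "i + 2"] by simp
  then show ?thesis by (simp only: curl_comp_extra_part[OF w])
qed

lemma curl_koszul_degree: "curl_comp (koszul_part q) i \<in> poly_space UNIV (r - 1)"
  unfolding curl_comp_def by (intro poly_space_diff partial_poly_space koszul_part_degree q)

text \<open>
  The surface rotation of the tangential trace is the normal component of the curl. On a face it is
  an ordinary polynomial of degree at most \<open>r - 1\<close>, in spite of the monomials of higher degree in \<open>u\<close>.
\<close>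

lemma curl_face_degree: "(\<lambda>x. curl_comp u i (face_point c h i s x)) \<in> poly_space (- {i}) (r - 1)"
proof -
  let ?t = "c $ i + s * h $ i"
  have W: "(\<lambda>x. w j (face_point c h i s x)) \<in> poly_space (- {i}) (r - 1)" for j
    using w[of j] hom_space_subset by (intro restrict_poly_space) (auto simp: hom_space_mspan poly_space_mspan elim!: mspan_mono[THEN subsetD, rotated])
  have "(\<lambda>x. curl_comp u i (face_point c h i s x)) = (\<lambda>x. curl_comp (koszul_part q) i (face_point c h i s x)
    + ?t * ((of_int r + 1) * w i (face_point c h i s x) - w (i + 1) (face_point c h i s x) - w (i + 2) (face_point c h i s x)))"
    by (simp add: curl_decomp) (simp add: face_point_def set_coord_nth)
  also have "\<dots> \<in> poly_space (- {i}) (r - 1)"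
    by (intro poly_space_add poly_space_scale poly_space_diff W restrict_poly_space[OF curl_koszul_degree])
  finally show ?thesis .
qed

end

section \<open>Vanishing traces and vanishing fields\<close>

text \<open>
  The tangential component on an edge is itself an admissible test function.
\<close>

lemma edge_trace_eq_0:
  assumes h: "\<forall>i. h $ i > 0" and U: "U \<in> mspan {a. int (a i) \<le> k}"
    and dof: "\<And>q. q \<in> poly_space {i} k \<Longrightarrow> edge_integral c h (i, s, t) (\<lambda>x. U x * q x) = 0"
  shows "U (face_point c h (i + 1) s (face_point c h (i + 2) t x)) = 0"
proof -
  let ?e = "\<lambda>x. face_point c h (i + 1) s (face_point c h (i + 2) t x)"
  let ?Q = "\<lambda>x. U (?e x)"
  have UP: "U \<in> Poly" using U by (rule mspan_Poly)
  have "(\<lambda>x. U (face_point c h (i + 1) s x)) \<in> mspan {a. int (a i) \<le> k \<and> a (i + 1) = 0}"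
    unfolding face_point_def by (rule mspan_set_coord[OF U]) (auto simp: index3)
  then have Q: "?Q \<in> poly_space {i} k"
    unfolding face_point_def[of c h "i + 2"] poly_space_mspan
    by (rule mspan_set_coord) (auto simp: index3 deg_index3[of _ i], metis index3_cases)
  have ind: "?Q (?e x) = ?Q x" for x
    using index3(3)[of i] by (simp add: face_point_commute face_point_same)
  have "box_integral c h (\<lambda>x. 1 * (?Q x * ?Q x)) = 4 * h $ (i + 1) * h $ (i + 2) * edge_integral c h (i, s, t) (\<lambda>x. U x * ?Q x)"
    using h ind by (subst edge_integral_Poly) (auto intro!: Poly_mult UP poly_space_Poly[OF Q] less_imp_le)
  also have "\<dots> = 0" using dof[OF Q] by simp
  finally have "?Q = (\<lambda>x. 0)"
    by (intro box_integral_square_eq_0[OF h poly_space_Poly[OF Q] Poly_const[of 1]]) auto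
  then show ?thesis by (rule fun_cong)
qed

text \<open>
  After integration by parts, which is possible because the edge traces vanish, the tests \<open>grad q\<close> say
  that the surface rotation is orthogonal to all polynomials of degree at most \<open>r - 1\<close>. It is such a
  polynomial, hence zero. The tangential trace is thus a surface gradient and \<open>gradient_bubble_eq_0\<close>
  applies; its hypotheses on degrees come from \<open>pos\<close> through \<open>poly_potential\<close>.
\<close>

lemma face_trace_eq_0:
  fixes U :: "3 \<Rightarrow> scalar_field"
  assumes h: "\<forall>i. h $ i > 0" and r: "r \<ge> 0" and U: "\<And>j. U j \<in> Poly"
    and rot: "(\<lambda>x. curl_comp U i (face_point c h i s x)) \<in> poly_space (- {i}) (r - 1)"
    and pos: "(\<lambda>x. x $ (i + 1) * U (i + 1) (face_point c h i s x) + x $ (i + 2) * U (i + 2) (face_point c h i s x))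
      \<in> mspan {a. (\<forall>j. j \<notin> - {i} \<longrightarrow> a j = 0) \<and> int (superlinear_degree a) \<le> r}"
    and edge: "\<And>j k t x. t \<in> {-1, 1} \<Longrightarrow> j \<noteq> i \<Longrightarrow> k \<noteq> i \<Longrightarrow> j \<noteq> k \<Longrightarrow>
      U j (face_point c h i s (face_point c h k t x)) = 0"
    and dof1: "\<And>q. q \<in> poly_space (- {i}) (r - 3) \<Longrightarrow>
      box_integral c h (\<lambda>x. U (i + 2) (face_point c h i s x) * q x) = 0"
    and dof2: "\<And>q. q \<in> poly_space (- {i}) (r - 1) \<Longrightarrow>
      box_integral c h (\<lambda>x. U (i + 2) (face_point c h i s x) * partial (i + 1) q x
        - U (i + 1) (face_point c h i s x) * partial (i + 2) q x) = 0"
    and j: "j \<noteq> i"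
  shows "U j (face_point c h i s x) = 0"
proof -
  \<comment> \<open>the trace as a field on the whole space: normal component zero, independent of \<open>x $ i\<close>\<close>
  define W where "W = (\<lambda>m. if m = i then (\<lambda>x. 0) else (\<lambda>x. U m (face_point c h i s x)))"
  have WP: "W m \<in> Poly" for m using U by (simp add: W_def Poly_const Poly_face_point)
  have W: "W (i + 1) = (\<lambda>x. U (i + 1) (face_point c h i s x))"
    "W (i + 2) = (\<lambda>x. U (i + 2) (face_point c h i s x))" "W i = (\<lambda>x. 0)"
    by (simp_all add: W_def index3)
  have Wedge: "W m (face_point c h k t x) = 0" if "t \<in> {-1, 1}" "k \<noteq> i" "m \<noteq> k" for m k t x
    using edge[OF that(1) _ that(2,3), of x] by (simp add: W_def)
  define R where "R = curl_comp W i"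
  have R: "R = (\<lambda>x. curl_comp U i (face_point c h i s x))"
    using U by (simp add: R_def curl_comp_def W fun_eq_iff partial_face_point index3)
  have RP: "R \<in> Poly" unfolding R_def by (rule curl_comp_Poly) (rule WP)
  have "box_integral c h (\<lambda>x. 1 * (R x * R x)) =
    box_integral c h (\<lambda>x. partial (i + 1) (W (i + 2)) x * R x) - box_integral c h (\<lambda>x. partial (i + 2) (W (i + 1)) x * R x)"
    by (subst box_integral_diff[symmetric])
      (auto intro!: Poly_intros Poly_partial WP RP simp: R_def curl_comp_def left_diff_distrib)
  also have "\<dots> = - box_integral c h (\<lambda>x. W (i + 2) x * partial (i + 1) R x) + box_integral c h (\<lambda>x. W (i + 1) x * partial (i + 2) R x)"
    using h Wedge index3 by (subst (1 2) integration_by_parts) (auto intro!: WP RP simp: face_point_def)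
  also have "\<dots> = - box_integral c h (\<lambda>x. W (i + 2) x * partial (i + 1) R x - W (i + 1) x * partial (i + 2) R x)"
    by (subst box_integral_diff) (auto intro!: Poly_intros Poly_partial WP RP)
  also have "\<dots> = 0" using dof2[of R] rot by (simp add: W R)
  finally have R0: "R = (\<lambda>x. 0)"
    by (intro box_integral_square_eq_0[OF h RP Poly_const[of 1]]) auto
  have "curl_comp W k = (\<lambda>x. 0)" for k
  proof (cases "k = i")
    case True
    then show ?thesis using R0 by (simp add: R_def)
  next
    case False
    have "partial i (W m) = (\<lambda>x. 0)" for m
      using U by (auto simp: W_def partial_const fun_eq_iff partial_face_point)
    then show ?thesis using False index3_cases[of k i]
      by (auto simp: curl_comp_def index3 W(3) partial_const)
  qed
  then have cf: "partial a (W b) = partial b (W a)" for a b by (rule curl_comp_0_symmetric)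
  let ?A = "{a. (\<forall>j. j \<notin> - {i} \<longrightarrow> a j = 0) \<and> int (superlinear_degree a) \<le> r}"
  have Y: "(\<lambda>x. \<Sum>m\<in>UNIV. x $ m * W m x) \<in> mspan ?A"
    using pos by (simp add: sum_index3[of _ i] W)
  obtain P where P: "P \<in> mspan ?A" "\<And>m. W m = partial m P"
    by (rule poly_potential[where U=W, OF WP cf Y]) blast
  have "- {i} = {i + 1, i + 2}" using UNIV_index3[of i] index3[of i] by blast
  then have "card (- {i}) = 2" by (simp add: index3)
  have "partial j P = (\<lambda>x. 0)"
  proof (rule gradient_bubble_eq_0[OF h r _ P(1), where j="i + 2" and c=c])
    show "\<exists>k'\<in>- {i}. k' \<noteq> k" for k
      using index3[of i] by (metis ComplI singletonD)
    show "partial j P (face_point c h k s x) = 0" if "k \<in> - {i}" "s \<in> {-1, 1}" "j \<noteq> k" for j k s x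
      using Wedge[of s k j x] that by (simp add: P(2))
    show "i + 2 \<in> - {i}" by (simp add: index3)
    fix q assume "q \<in> poly_space (- {i}) (r - 2 * int (card (- {i})) + 1)"
    then have "q \<in> poly_space (- {i}) (r - 3)" using \<open>card (- {i}) = 2\<close> by simp
    from dof1[OF this] show "box_integral c h (\<lambda>x. partial (i + 2) P x * q x) = 0"
      by (simp add: W flip: P(2))
  qed
  then show ?thesis using j P(2)[of j] by (simp add: W_def fun_eq_iff)
qed

context S1_field
begin

text \<open>
  On the face the tangential part of the product with the position vector is the full product minus
  \<open>x $ i * u i x\<close>, where \<open>x $ i\<close> is a constant; both terms have superlinear degree at most \<open>r\<close> in the
  face coordinates.
\<close>

lemma tangential_position:
  assumes "u = U"
  shows "(\<lambda>x. x $ (i + 1) * U (i + 1) (face_point c h i s x) + x $ (i + 2) * U (i + 2) (face_point c h i s x))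
      \<in> mspan {a. (\<forall>j. j \<notin> - {i} \<longrightarrow> a j = 0) \<and> int (superlinear_degree a) \<le> r}"
proof -
  let ?A = "{a. (\<forall>j. j \<notin> - {i} \<longrightarrow> a j = 0) \<and> int (superlinear_degree a) \<le> r}"
  let ?t = "c $ i + s * h $ i"
  have 1: "(\<lambda>x. (\<lambda>x. \<Sum>m\<in>UNIV. x $ m * u m x) (face_point c h i s x)) \<in> mspan ?A"
    unfolding face_point_def using position_dot unfolding S0_mspan
    by (elim mspan_set_coord) (auto intro: order_trans[OF superlinear_degree_zero_le])
  have 2: "(\<lambda>x. ?t * u i (face_point c h i s x)) \<in> mspan ?A"
    unfolding face_point_def
    by (intro mspan_scale mspan_set_coord[OF normal_face_degree]) auto
  have "(\<lambda>x. (\<lambda>x. \<Sum>m\<in>UNIV. x $ m * u m x) (face_point c h i s x) - ?t * u i (face_point c h i s x))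
    = (\<lambda>x. x $ (i + 1) * U (i + 1) (face_point c h i s x) + x $ (i + 2) * U (i + 2) (face_point c h i s x))"
    unfolding assms by (simp add: sum_index3[of _ i] face_point_def set_coord_nth index3)
  with mspan_diff[OF 1 2] show ?thesis by simp
qed

text \<open>
  The normal component of the curl vanishes on the faces, so \<open>v i = axis_bubble c h i * m i\<close> for the
  curl \<open>v\<close>. The top-degree part of \<open>v i\<close> is therefore divisible by \<open>(x $ i)\<^sup>2\<close>. It is also the explicit
  expression in \<open>w\<close> from \<open>curl_decomp\<close>, and comparing the monomials linear in \<open>x $ i\<close> forces \<open>w\<close> to be
  zero. Then \<open>m i\<close> has degree at most \<open>r - 3\<close>, the curl of \<open>m i\<close> times a unit vector is an admissible
  test field, and integration by parts gives the weighted integral of \<open>(m i)\<^sup>2\<close>. So the field is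
  curl-free, and \<open>gradient_bubble_eq_0\<close> applies to its potential.
\<close>

lemma interior_eq_0:
  assumes h: "\<forall>i. h $ i > 0"
    and tang: "\<And>i j s x. s \<in> {-1, 1} \<Longrightarrow> j \<noteq> i \<Longrightarrow> u j (face_point c h i s x) = 0"
    and dof1: "\<And>q. q \<in> poly_space UNIV (r - 5) \<Longrightarrow> box_integral c h (\<lambda>x. u 1 x * q x) = 0"
    and dof2: "\<And>i q. q \<in> poly_space UNIV (r - 3) \<Longrightarrow>
      box_integral c h (\<lambda>x. u (i + 1) x * partial (i + 2) q x - u (i + 2) x * partial (i + 1) q x) = 0"
  shows "u j = (\<lambda>x. 0)"
proof -
  define v where "v = curl_comp u"
  have vP: "v i \<in> Poly" for i unfolding v_def by (intro curl_comp_Poly Poly_parts)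
  have vn: "v i (face_point c h i s x) = 0" if "s \<in> {-1, 1}" for i s x
  proof -
    have *: "(\<lambda>x. u k (face_point c h i s x)) = (\<lambda>x. 0)" if "k \<noteq> i" for k
      using tang[OF \<open>s \<in> {-1, 1}\<close> that] by (simp add: fun_eq_iff)
    have "partial j (u k) (face_point c h i s x) = 0" if "j \<noteq> i" "k \<noteq> i" for j k
      using partial_face_point[OF Poly_parts(4)[of k], of j c h i s x] *[OF that(2)] that(1)
      by (simp add: partial_const)
    then show ?thesis unfolding v_def curl_comp_def using index3 by simp
  qed
  have "\<exists>m\<in>Poly. \<forall>x. v i x = axis_bubble c h i x * m x" for i
    by (rule divide_axis_bubble[OF h vP, where c=c and k=i, OF vn]) auto
  then obtain m where mP: "\<And>i. m i \<in> Poly" and m: "\<And>i x. v i x = axis_bubble c h i x * m i x"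
    by metis
  have v: "v i = (\<lambda>x. axis_bubble c h i x * m i x)" for i using m by (simp add: fun_eq_iff)
  have wP: "w i \<in> Poly" for i using w by (rule hom_space_Poly)
  have wdeg: "int (deg a) = r - 1 \<and> a i = 0" if "mcoeff (w i) a \<noteq> 0" for i a
    using mspanD[OF w[of i, unfolded hom_space_mspan] that] by auto
  define W where "W = (\<lambda>i x. (of_int r + 1) * w i x - w (i + 1) x - w (i + 2) x)"
  have WP: "W i \<in> Poly" for i unfolding W_def by (intro Poly_intros mspan_scale wP)
  have vW: "v i = (\<lambda>x. curl_comp (koszul_part q) i x + x $ i * W i x)" for i
    unfolding v_def W_def by (simp add: fun_eq_iff curl_decomp)
  have kP: "curl_comp (koszul_part q) i \<in> Poly" for i by (intro curl_comp_Poly Poly_parts)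
  have kdeg: "mcoeff (curl_comp (koszul_part q) i) a = 0" if "int (deg a) \<ge> r" for i a
    using mspanD[OF curl_koszul_degree[of i, unfolded poly_space_UNIV], of a] that by force
  have cov: "mcoeff (v i) a = mcoeff (curl_comp (koszul_part q) i) a + (if a i = 0 then 0 else mcoeff (W i) (a(i := a i - 1)))" for i a
    unfolding vW by (simp only: mcoeff_add[OF kP] Poly_mult Poly_coord WP mcoeff_coord_mult)
  have coW: "mcoeff (W i) a = (of_int r + 1) * mcoeff (w i) a - mcoeff (w (i + 1)) a - mcoeff (w (i + 2)) a" for i a
    unfolding W_def by (simp only: mcoeff_diff mcoeff_scale wP mspan_diff mspan_scale)
  have Wdeg: "int (deg a) = r - 1" if "mcoeff (W i) a \<noteq> 0" for i a
    using that wdeg[of i a] wdeg[of "i + 1" a] wdeg[of "i + 2" a] unfolding coW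
    by (cases "mcoeff (w i) a = 0"; cases "mcoeff (w (i + 1)) a = 0"; cases "mcoeff (w (i + 2)) a = 0") auto
  have vdeg: "v i \<in> mspan {a. int (deg a) \<le> r}" for i
  proof (rule mspanI[OF vP])
    fix a assume a: "mcoeff (v i) a \<noteq> 0"
    show "a \<in> {a. int (deg a) \<le> r}"
    proof (rule ccontr)
      assume "a \<notin> {a. int (deg a) \<le> r}"
      then have g: "int (deg a) > r" by simp
      then have "mcoeff (W i) (a(i := a i - 1)) \<noteq> 0" "a i \<noteq> 0"
        using a kdeg[of a i] unfolding cov by (auto split: if_splits)
      then show False using Wdeg[of i "a(i := a i - 1)"] deg_dec[of a i] g by simp
    qed
  qed
  have mdeg: "int (deg a) \<le> k - 2" if vk: "v i \<in> mspan {a. int (deg a) \<le> k}" and a: "mcoeff (m i) a \<noteq> 0" for i k a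
  proof -
    obtain b where b: "mcoeff (m i) b \<noteq> 0" "deg a \<le> deg b" "m i \<in> mspan {a. deg a \<le> deg b}"
      using top_degree_exponent[OF mP a] by blast
    have "mcoeff (v i) (b(i := b i + 2)) = - mcoeff (m i) b"
      unfolding v by (rule axis_bubble_mult_degree(2)[OF b(3) refl])
    then have "int (deg (b(i := b i + 2))) \<le> k" using b mspanD[OF vk, of "b(i := b i + 2)"] by simp
    moreover have "deg (b(i := b i + 2)) = deg b + 2" using deg_upd[of b i "b i + 2"] by simp
    ultimately show ?thesis using b(2) by linarith
  qed
  \<comment> \<open>monomials of \<open>v i\<close> of degree \<open>r\<close> that are linear in \<open>x $ i\<close> cannot come from a product with
    the bubble\<close>
  have W0: "mcoeff (W i) b = 0" if b: "int (deg b) = r - 1" "b i = 0" for i b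
  proof -
    let ?a = "b(i := Suc (b i))"
    have "m i \<in> mspan {a. deg a \<le> nat (r - 2)}"
      by (rule mspanI[OF mP]) (use mdeg[OF vdeg] in force)
    from axis_bubble_mult_degree(3)[OF this, of ?a i c h] have "mcoeff (v i) ?a = 0"
      using b r deg_inc[of b i] unfolding v by simp
    moreover have "mcoeff (curl_comp (koszul_part q) i) ?a = 0"
      using b deg_inc[of b i] by (intro kdeg) simp
    ultimately show ?thesis using cov[of i ?a] by simp
  qed
  have w0: "mcoeff (w i) a = 0" for i a
  proof (rule ccontr)
    assume ne: "mcoeff (w i) a \<noteq> 0"
    then have a: "int (deg a) = r - 1" "a i = 0" using wdeg by auto
    have e1: "(of_int r + 1) * mcoeff (w i) a = mcoeff (w (i + 1)) a + mcoeff (w (i + 2)) a"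
      using W0[OF a] unfolding coW by simp
    have z: "mcoeff (w j) a = 0" if "a j \<noteq> 0" for j using wdeg[of j a] that by auto
    have r1: "(of_int r + 1 :: real) > 1" using r by simp
    \<comment> \<open>If only one coordinate \<open>l\<close> occurs in the monomial, the equations for \<open>i\<close> and for the remaining
      axis \<open>k\<close> form a system with determinant \<open>(r + 1)\<^sup>2 - 1\<close>.\<close>
    have pair: "mcoeff (w i) a = 0" if k: "a k = 0" "k \<noteq> i" "l \<noteq> i" "k \<noteq> l" "a l \<noteq> 0" for k l
    proof -
      have zl: "mcoeff (w l) a = 0" using z k by simp
      have "(of_int r + 1) * mcoeff (w i) a = mcoeff (w k) a"
        using e1 zl k index3_cases[of k i] index3_cases[of l i] by auto
      moreover have "(of_int r + 1) * mcoeff (w k) a = mcoeff (w i) a"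
        using W0[OF a(1) k(1)] zl k index3_cases[of i k] index3_cases[of l k] unfolding coW by auto
      ultimately have "((of_int r + 1) * (of_int r + 1)) * mcoeff (w i) a = 1 * mcoeff (w i) a" by (simp add: mult.assoc)
      then have "(of_int r + 1) * (of_int r + 1 :: real) = 1 \<or> mcoeff (w i) a = 0"
        using mult_right_cancel by blast
      moreover have "(of_int r + 1) * (of_int r + 1 :: real) > 1"
        using r1 by (metis less_1_mult)
      ultimately show ?thesis by auto
    qed
    have "a (i + 1) \<noteq> 0 \<or> a (i + 2) \<noteq> 0" using a r deg_index3[of a i] by auto
    then consider "a (i + 1) \<noteq> 0" "a (i + 2) \<noteq> 0" | "a (i + 1) = 0" "a (i + 2) \<noteq> 0" | "a (i + 1) \<noteq> 0" "a (i + 2) = 0"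
      by blast
    then show False
    proof cases
      case 1
      then show False using e1 z ne r1 by simp
    next
      case 2
      then show False using pair[of "i + 1" "i + 2"] ne index3[of i] by simp
    next
      case 3
      then show False using pair[of "i + 2" "i + 1"] ne index3[of i] by simp
    qed
  qed
  have w0': "w i = (\<lambda>x. 0)" for i using mcoeff_eq_0I[OF wP w0] .
  have "v i = curl_comp (koszul_part q) i" for i
    unfolding vW by (simp add: W_def w0')
  then have vdeg': "v i \<in> mspan {a. int (deg a) \<le> r - 1}" for i
    using curl_koszul_degree[of i] by (simp add: poly_space_UNIV)
  \<comment> \<open>without the extra part the curl has degree at most \<open>r - 1\<close>\<close>
  have m3: "m i \<in> poly_space UNIV (r - 3)" for i
    unfolding poly_space_UNIV by (rule mspanI[OF mP]) (use mdeg[OF vdeg'] in force)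
  have v0: "v i = (\<lambda>x. 0)" for i
  proof -
    have "box_integral c h (\<lambda>x. axis_bubble c h i x * (m i x * m i x)) = box_integral c h (\<lambda>x. v i x * m i x)"
      by (simp add: v mult.assoc)
    also have "\<dots> = box_integral c h (\<lambda>x. partial (i + 1) (u (i + 2)) x * m i x) - box_integral c h (\<lambda>x. partial (i + 2) (u (i + 1)) x * m i x)"
      by (subst box_integral_diff[symmetric])
        (auto intro!: Poly_intros Poly_partial Poly_parts mP simp: v_def curl_comp_def left_diff_distrib)
    also have "\<dots> = - box_integral c h (\<lambda>x. u (i + 2) x * partial (i + 1) (m i) x) + box_integral c h (\<lambda>x. u (i + 1) x * partial (i + 2) (m i) x)"
      using h tang index3 by (subst (1 2) integration_by_parts) (auto intro!: Poly_parts mP simp: face_point_def)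
    also have "\<dots> = box_integral c h (\<lambda>x. u (i + 1) x * partial (i + 2) (m i) x - u (i + 2) x * partial (i + 1) (m i) x)"
      by (subst box_integral_diff) (auto intro!: Poly_intros Poly_partial Poly_parts mP)
    also have "\<dots> = 0" by (rule dof2[OF m3])
    finally have "m i = (\<lambda>x. 0)"
      using box_integral_square_eq_0[OF h mP axis_bubble_Poly axis_bubble_pos] by blast
    then show ?thesis by (simp add: v)
  qed
  have cf: "partial a (u b) = partial b (u a)" for a b
    using curl_comp_0_symmetric[of u] v0 unfolding v_def by blast
  obtain P where P: "P \<in> S0 r" "\<And>m. u m = partial m P"
    using poly_potential[where U=u, OF Poly_parts(4) cf position_dot[unfolded S0_mspan]]
    unfolding S0_mspan by blast
  have "partial j P = (\<lambda>x. 0)"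
  proof (rule gradient_bubble_eq_0[OF h, where r=r and J=UNIV and j=1 and c=c])
    show "\<exists>k'\<in>UNIV. k' \<noteq> k" for k :: 3 using index3(1)[of k] by blast
    show "P \<in> mspan {a. (\<forall>j. j \<notin> UNIV \<longrightarrow> a j = 0) \<and> int (superlinear_degree a) \<le> r}"
      using P(1) by (simp add: S0_mspan)
    show "partial j P (face_point c h k s x) = 0" if "s \<in> {-1, 1}" "j \<noteq> k" for j k s x
      using tang[OF that] by (simp add: P(2))
    fix q assume "q \<in> poly_space UNIV (r - 2 * int (card (UNIV :: 3 set)) + 1)"
    then have "q \<in> poly_space UNIV (r - 5)" by simp
    from dof1[OF this] show "box_integral c h (\<lambda>x. partial 1 P x * q x) = 0" by (simp add: P(2))
  qed (use r in auto)
  then show ?thesis by (simp add: P(2))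
qed

end

section \<open>The degrees of freedom on S1\<close>

lemma face_normal_nth: "face_normal (i, s) $ j = (if j = i then s else 0)"
  by (simp add: axis_def)

lemma inner_index3: "x \<bullet> y = x $ i * y $ i + x $ (i + 1) * y $ (i + 1) + x $ (i + 2) * y $ (i + 2)"
  for x y :: "real^3" and i :: 3
  by (simp add: inner_vec_def sum_index3[of _ i])

lemma cross_face_normal_inner:
  "cross3 a (face_normal (i, s)) \<bullet> b = s * (a $ (i + 2) * b $ (i + 1) - a $ (i + 1) * b $ (i + 2))"
  by (simp only: inner_index3[of _ _ i] cross3_nth face_normal_nth index3 if_True if_False simp_thms)
    (simp add: algebra_simps)

lemma face_dof_box_integral:
  assumes u: "\<And>j. (\<lambda>x. u x $ j) \<in> Poly" and Q: "\<And>j. (\<lambda>x. Q x $ j) \<in> Poly"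
    and s: "s \<in> {-1, 1}" and h: "\<forall>i. h $ i > 0"
    and dof: "face_integral c h (i, s) (\<lambda>x. cross3 (u x) (face_normal (i, s)) \<bullet> Q x) = 0"
  shows "box_integral c h (\<lambda>x. u (face_point c h i s x) $ (i + 2) * Q (face_point c h i s x) $ (i + 1)
    - u (face_point c h i s x) $ (i + 1) * Q (face_point c h i s x) $ (i + 2)) = 0"
proof -
  let ?g = "\<lambda>x. u x $ (i + 2) * Q x $ (i + 1) - u x $ (i + 1) * Q x $ (i + 2)"
  have g: "(\<lambda>x. cross3 (u x) (face_normal (i, s)) \<bullet> Q x) = (\<lambda>x. s * ?g x)"
    by (simp only: cross_face_normal_inner)
  have gP: "?g \<in> Poly" by (intro Poly_intros u Q)
  have "s * box_integral c h (\<lambda>x. ?g (face_point c h i s x)) = 2 * h $ i * face_integral c h (i, s) (\<lambda>x. s * ?g x)"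
    using h by (subst face_integral_Poly) (auto intro!: mspan_scale gP simp: box_integral_scale less_imp_le)
  also have "\<dots> = 0" using dof unfolding g by simp
  finally show ?thesis using s by auto
qed

text \<open>
  The test spaces combine a full polynomial space with derivatives of homogeneous polynomials of the
  next degree; splitting off the top degree shows that derivatives of all polynomials up to that
  degree are admissible.
\<close>

lemma poly_space_split:
  assumes "p \<in> poly_space J k"
  obtains p1 p2 where "p1 \<in> poly_space J (k - 1)" "p2 \<in> hom_space J k" "p = (\<lambda>x. p1 x + p2 x)"
proof -
  have "\<exists>p1\<in>poly_space J (k - 1). \<exists>p2\<in>hom_space J k. p = (\<lambda>x. p1 x + p2 x)"
    using assms unfolding poly_space_mspan[of J k]
  proof (induction rule: mspan_induct)
    case zero
    show ?case
      by (intro bexI[of _ "\<lambda>x. 0"] poly_space_zero) (auto simp: hom_space_mspan mspan_zero)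
  next
    case (monom a)
    show ?case
    proof (cases "int (deg a) = k")
      case True
      with monom show ?thesis
        by (intro bexI[of _ "\<lambda>x. 0"] bexI[of _ "monom_fun a"] poly_space_zero)
          (auto simp: hom_space_mspan intro: monom_in_mspan)
    next
      case False
      with monom show ?thesis
        by (intro bexI[of _ "monom_fun a"] bexI[of _ "\<lambda>x. 0"])
          (auto simp: hom_space_mspan poly_space_mspan mspan_zero intro!: monom_in_mspan)
    qed
  next
    case (add p q)
    then obtain p1 p2 q1 q2 where "p1 \<in> poly_space J (k - 1)" "p2 \<in> hom_space J k" "p = (\<lambda>x. p1 x + p2 x)"
      "q1 \<in> poly_space J (k - 1)" "q2 \<in> hom_space J k" "q = (\<lambda>x. q1 x + q2 x)" by blast
    then show ?case
      by (intro bexI[of _ "\<lambda>x. p1 x + q1 x"] bexI[of _ "\<lambda>x. p2 x + q2 x"])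
        (auto simp: hom_space_mspan intro: poly_space_add mspan_add)
  next
    case (scale t p)
    then obtain p1 p2 where "p1 \<in> poly_space J (k - 1)" "p2 \<in> hom_space J k" "p = (\<lambda>x. p1 x + p2 x)"
      by blast
    then show ?case
      by (intro bexI[of _ "\<lambda>x. t * p1 x"] bexI[of _ "\<lambda>x. t * p2 x"])
        (auto simp: hom_space_mspan distrib_left intro: poly_space_scale mspan_scale)
  qed
  with that show thesis by blast
qed

lemma surface_grad_nth:
  assumes "s \<in> {-1, 1}"
  shows "surface_grad (i, s) p x $ j = (if j = i then 0 else partial j p x)"
proof -
  have "grad p x \<bullet> face_normal (i, s) = partial i p x * s"
    by (simp add: inner_index3[of _ _ i] face_normal_nth grad_nth index3 del: face_normal.simps)
  then show ?thesis using assms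
    by (auto simp: surface_grad_def face_normal_nth grad_nth simp del: face_normal.simps)
qed

lemma face_tangential_polyI:
  assumes "\<And>j. (\<lambda>x. v x $ j) \<in> poly_space (- {i}) k" "\<And>x. v x $ i = 0"
  shows "v \<in> face_tangential_poly (i, s) k"
  using assms
  by (auto simp: face_tangential_poly_def cube_iff inner_index3[of _ _ i] face_normal_nth index3 simp del: face_normal.simps)

lemma face_test_lower:
  assumes "v \<in> face_tangential_poly f (r - 3)"
  shows "v \<in> face_test r f"
proof -
  have "surface_grad f (\<lambda>x. 0) = 0"
    by (auto simp: surface_grad_def fun_eq_iff vec_eq_iff grad_nth partial_const inner_vec_def)
  moreover have "(\<lambda>x. 0) \<in> face_hom f (r - 1)" by (cases f) (simp add: hom_space_mspan mspan_zero)
  ultimately have "0 \<in> surface_grad f ` face_hom f (r - 1)" by (metis imageI)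
  from set_plus_intro[OF assms this] show ?thesis by (simp add: face_test_def)
qed

lemma surface_grad_in_face_test:
  assumes s: "s \<in> {-1, 1}" and p: "p \<in> poly_space (- {i}) (r - 1)"
  shows "surface_grad (i, s) p \<in> face_test r (i, s)"
proof -
  obtain p1 p2 where pp: "p1 \<in> poly_space (- {i}) (r - 1 - 1)" "p2 \<in> hom_space (- {i}) (r - 1)" "p = (\<lambda>x. p1 x + p2 x)"
    using poly_space_split[OF p] by blast
  have P: "p1 \<in> Poly" "p2 \<in> Poly" using pp poly_space_Poly hom_space_Poly by blast+
  have "partial j p1 \<in> poly_space (- {i}) (r - 3)" for j
    using partial_poly_space[OF pp(1), of j] by simp
  moreover have "(\<lambda>x. surface_grad (i, s) p1 x $ j) = (if j = i then (\<lambda>x. 0) else partial j p1)" for j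
    by (simp add: fun_eq_iff surface_grad_nth[OF s])
  ultimately have "surface_grad (i, s) p1 \<in> face_tangential_poly (i, s) (r - 3)"
    using surface_grad_nth[OF s] by (intro face_tangential_polyI) (auto simp: poly_space_zero)
  moreover have "surface_grad (i, s) p2 \<in> surface_grad (i, s) ` face_hom (i, s) (r - 1)"
    using pp(2) by simp
  moreover have "surface_grad (i, s) p = surface_grad (i, s) p1 + surface_grad (i, s) p2"
    unfolding pp(3) by (simp add: fun_eq_iff vec_eq_iff surface_grad_nth[OF s] partial_add[OF P])
  ultimately show ?thesis unfolding face_test_def by (metis set_plus_intro)
qed

lemma interior_test_lower:
  assumes "v \<in> cube (poly_space UNIV (r - 5))"
  shows "v \<in> interior_test r"
proof -
  have z: "(\<lambda>x. 0) \<in> cube (hom_space UNIV (r - 3))"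
    by (simp add: cube_iff hom_space_mspan mspan_zero)
  have "(\<lambda>x. 0) \<in> cube Poly" by (simp add: cube_iff Poly_const)
  from curl_nth[OF this] have "curl (\<lambda>x. 0) = 0"
    by (simp add: fun_eq_iff vec_eq_iff partial_const)
  with z have "0 \<in> curl ` cube (hom_space UNIV (r - 3))" by (metis imageI)
  from set_plus_intro[OF assms this] show ?thesis by (simp add: interior_test_def)
qed

lemma curl_in_interior_test:
  assumes q: "q \<in> poly_space UNIV (r - 3)"
  shows "curl (\<lambda>x. \<chi> j. if j = i then q x else 0) \<in> interior_test r"
proof -
  obtain p1 p2 where pp: "p1 \<in> poly_space UNIV (r - 3 - 1)" "p2 \<in> hom_space UNIV (r - 3)" "q = (\<lambda>x. p1 x + p2 x)"
    using poly_space_split[OF q] by blast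
  let ?e = "\<lambda>p x. (\<chi> j. if j = i then p x else 0) :: real^3"
  have P: "p1 \<in> Poly" "p2 \<in> Poly" "q \<in> Poly" using pp q poly_space_Poly hom_space_Poly by blast+
  have nth: "(\<lambda>x. ?e p x $ j) = (if j = i then p else (\<lambda>x. 0))" for p j by auto
  have eP: "?e p \<in> cube Poly" if "p \<in> Poly" for p
    unfolding cube_iff nth using that by (auto simp: Poly_const)
  have pdS: "partial j p1 \<in> poly_space UNIV (r - 5)" for j using partial_poly_space[OF pp(1), of j] by simp
  have c1: "curl (?e p1) \<in> cube (poly_space UNIV (r - 5))"
    unfolding cube_iff curl_nth[OF eP[OF P(1)]] nth
    by (intro allI poly_space_diff) (auto simp: partial_const pdS poly_space_zero)
  have c2: "?e p2 \<in> cube (hom_space UNIV (r - 3))"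
    unfolding cube_iff nth using pp(2) by (simp add: hom_space_mspan mspan_zero)
  have c3: "curl (?e q) = curl (?e p1) + curl (?e p2)"
  proof (intro ext, simp only: vec_eq_iff plus_fun_apply vector_add_component, intro allI)
    fix x j
    have "partial k (\<lambda>x. ?e q x $ l) x = partial k (\<lambda>x. ?e p1 x $ l) x + partial k (\<lambda>x. ?e p2 x $ l) x" for k l
      unfolding nth pp(3) by (simp add: partial_add P partial_const)
    then show "curl (?e q) x $ j = curl (?e p1) x $ j + curl (?e p2) x $ j"
      by (simp only: curl_nth[OF eP[OF P(1)]] curl_nth[OF eP[OF P(2)]] curl_nth[OF eP[OF P(3)]])
  qed
  show ?thesis unfolding interior_test_def c3 by (intro set_plus_intro imageI c1 c2)
qed

text \<open>
  Interior test fields have low enough degree to be admissible in the orthogonality condition that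
  defines \<open>Vf\<close>.
\<close>

lemma interior_test_degree:
  assumes "v \<in> interior_test r"
  shows "v \<in> cube (poly_space UNIV (r - 3))"
proof -
  obtain a b where ab: "v = a + curl b" "a \<in> cube (poly_space UNIV (r - 5))" "b \<in> cube (hom_space UNIV (r - 3))"
    using assms unfolding interior_test_def by (auto elim!: set_plus_elim)
  have b: "(\<lambda>x. b x $ j) \<in> poly_space UNIV (r - 3)" for j
    using ab(3) hom_space_subset by (auto simp: cube_iff)
  then have bP: "b \<in> cube Poly" using poly_space_Poly by (auto simp: cube_iff)
  have "(\<lambda>x. curl b x $ j) \<in> poly_space UNIV (r - 3 - 1)" for j
    unfolding curl_nth[OF bP] by (intro poly_space_diff partial_poly_space b)
  then have "(\<lambda>x. curl b x $ j) \<in> poly_space UNIV (r - 3)" for j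
    using poly_space_mono[of "r - 3 - 1" "r - 3"] by auto
  moreover have "(\<lambda>x. a x $ j) \<in> poly_space UNIV (r - 3)" for j
    using ab(2) poly_space_mono[of "r - 5" "r - 3"] by (auto simp: cube_iff)
  ultimately show ?thesis unfolding ab(1) by (simp add: cube_iff poly_space_add)
qed

lemma S1_Poly: "r \<ge> 2 \<Longrightarrow> u \<in> S1 r \<Longrightarrow> u \<in> cube Poly"
proof -
  assume r: "r \<ge> 2" and u: "u \<in> S1 r"
  obtain p q w where "p \<in> S0 r" "\<And>j. q j \<in> poly_space UNIV (r - 1)"
    "\<And>j. w j \<in> hom_space (- {j}) (r - 1)"
    "\<And>i. (\<lambda>x. u x $ i) = (\<lambda>x. partial i p x + koszul_part q i x + extra_part w i x)"
    by (rule S1E[OF u]) (rule that)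
  then interpret S1_field r p q w "\<lambda>i x. u x $ i"
    using r by unfold_locales
  show ?thesis using Poly_parts(4) by (simp add: cube_iff)
qed

lemma S1_unisolvent:
  assumes r: "r \<ge> 2" and h: "\<forall>i. h $ i > 0" and u: "u \<in> S1 r"
    and dof1: "\<And>e q. e \<in> edges \<Longrightarrow> q \<in> edge_poly e (r - 1) \<Longrightarrow> edge_integral c h e (\<lambda>x. u x \<bullet> edge_tangent e * q x) = 0"
    and dof2: "\<And>f q. f \<in> faces \<Longrightarrow> q \<in> face_test r f \<Longrightarrow> face_integral c h f (\<lambda>x. cross3 (u x) (face_normal f) \<bullet> q x) = 0"
    and dof4: "\<And>q. q \<in> interior_test r \<Longrightarrow> box_integral c h (\<lambda>x. u x \<bullet> q x) = 0"
  shows "u = 0"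
proof -
  obtain p q w where pqw: "p \<in> S0 r" "\<And>j. q j \<in> poly_space UNIV (r - 1)"
    "\<And>j. w j \<in> hom_space (- {j}) (r - 1)"
    "\<And>i. (\<lambda>x. u x $ i) = (\<lambda>x. partial i p x + koszul_part q i x + extra_part w i x)"
    by (rule S1E[OF u]) (rule that)
  define U where "U = (\<lambda>i x. u x $ i)"
  interpret S1_field r p q w U
    using r pqw by unfold_locales (auto simp: U_def)
  have UP: "(\<lambda>x. u x $ j) \<in> Poly" for j using Poly_parts(4)[of j] by (simp add: U_def)
  have edge0: "U i (face_point c h (i + 1) s (face_point c h (i + 2) t x)) = 0"
    if st: "s \<in> {-1, 1}" "t \<in> {-1, 1}" for i s t x
  proof (rule edge_trace_eq_0[OF h edge_degree])
    fix q assume "q \<in> poly_space {i} (r - 1)"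
    with st dof1[of "(i, s, t)" q] show "edge_integral c h (i, s, t) (\<lambda>x. U i x * q x) = 0"
      by (simp add: edges_def U_def inner_axis del: edge_integral.simps)
  qed
  have face0: "U j (face_point c h i s x) = 0" if s: "s \<in> {-1, 1}" and ji: "j \<noteq> i" for i j s x
  proof (rule face_trace_eq_0[OF h, where r=r, OF _ Poly_parts(4) curl_face_degree tangential_position[OF refl]])
    have f: "(i, s) \<in> faces" using s by (simp add: faces_def)
    show "U j (face_point c h i s (face_point c h k t x)) = 0"
      if jk: "t \<in> {-1, 1}" "j \<noteq> i" "k \<noteq> i" "j \<noteq> k" for j k t x
    proof -
      consider "i = j + 1" "k = j + 2" | "i = j + 2" "k = j + 1"
        using jk index3_cases[of i j] index3_cases[of k j] by auto
      then show ?thesis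
      proof cases
        case 1
        then show ?thesis using edge0[OF s jk(1), of j x] by simp
      next
        case 2
        then show ?thesis using edge0[OF jk(1) s, of j x] face_point_commute[of i k] jk(3) by simp
      qed
    qed
    show "box_integral c h (\<lambda>x. U (i + 2) (face_point c h i s x) * q x) = 0" if q: "q \<in> poly_space (- {i}) (r - 3)" for q
    proof -
      define Q where "Q = (\<lambda>x. (\<chi> j. if j = i + 1 then q x else 0) :: real^3)"
      have Qn: "(\<lambda>x. Q x $ j) = (if j = i + 1 then q else (\<lambda>x. 0))" for j by (auto simp: Q_def)
      have "Q \<in> face_tangential_poly (i, s) (r - 3)"
        using q by (intro face_tangential_polyI, unfold Qn) (auto simp: poly_space_zero Q_def index3)
      from dof2[OF f face_test_lower[OF this]]
      have "box_integral c h (\<lambda>x. u (face_point c h i s x) $ (i + 2) * Q (face_point c h i s x) $ (i + 1)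
        - u (face_point c h i s x) $ (i + 1) * Q (face_point c h i s x) $ (i + 2)) = 0"
        by (intro face_dof_box_integral[OF UP _ s h]) (auto simp: Qn Poly_const poly_space_Poly[OF q])
      moreover have "q (face_point c h i s x) = q x" for x
        using q unfolding poly_space_mspan by (rule face_point_indep) auto
      ultimately show ?thesis by (simp add: Q_def U_def index3)
    qed
    show "box_integral c h (\<lambda>x. U (i + 2) (face_point c h i s x) * partial (i + 1) q x
        - U (i + 1) (face_point c h i s x) * partial (i + 2) q x) = 0" if q: "q \<in> poly_space (- {i}) (r - 1)" for q
    proof -
      define Q where "Q = surface_grad (i, s) q"
      have Qn: "Q x $ j = (if j = i then 0 else partial j q x)" for j x
        by (simp add: Q_def surface_grad_nth[OF s])
      have QP: "(\<lambda>x. Q x $ j) \<in> Poly" for j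
      proof -
        have "(\<lambda>x. Q x $ j) = (if j = i then (\<lambda>x. 0) else partial j q)" by (simp add: fun_eq_iff Qn)
        then show ?thesis using Poly_partial[OF poly_space_Poly[OF q], of j] by (simp add: Poly_const)
      qed
      have "partial j q (face_point c h i s x) = partial j q x" for j x
        using partial_poly_space[OF q, of j] unfolding poly_space_mspan by (rule face_point_indep) auto
      moreover have "box_integral c h (\<lambda>x. u (face_point c h i s x) $ (i + 2) * Q (face_point c h i s x) $ (i + 1)
        - u (face_point c h i s x) $ (i + 1) * Q (face_point c h i s x) $ (i + 2)) = 0"
        using dof2[OF f surface_grad_in_face_test[OF s q]]
        by (intro face_dof_box_integral[OF UP QP s h]) (simp add: Q_def del: face_integral.simps face_normal.simps)
      ultimately show ?thesis by (simp add: Qn U_def index3)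
    qed
  qed (use r ji in auto)
  have "U j = (\<lambda>x. 0)" for j
  proof (rule interior_eq_0[OF h face0])
    fix q assume q: "q \<in> poly_space UNIV (r - 5)"
    define Q where "Q = (\<lambda>x. (\<chi> j. if j = 1 then q x else 0) :: real^3)"
    have Qn: "(\<lambda>x. Q x $ j) = (if j = 1 then q else (\<lambda>x. 0))" for j by (auto simp: Q_def)
    have "Q \<in> cube (poly_space UNIV (r - 5))"
      unfolding cube_iff Qn using q by (auto simp: poly_space_zero)
    from dof4[OF interior_test_lower[OF this]] show "box_integral c h (\<lambda>x. U 1 x * q x) = 0"
      by (simp add: inner_index3[of _ _ 1] Q_def U_def numeral_index3)
  next
    fix i q assume q: "q \<in> poly_space UNIV (r - 3)"
    define Q where "Q = (\<lambda>x. (\<chi> j. if j = i then q x else 0) :: real^3)"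
    have Qn: "(\<lambda>x. Q x $ j) = (if j = i then q else (\<lambda>x. 0))" for j by (auto simp: Q_def)
    have QP: "Q \<in> cube Poly" unfolding cube_iff Qn using poly_space_Poly[OF q] by (auto simp: Poly_const)
    have "u x \<bullet> curl Q x = U (i + 1) x * partial (i + 2) q x - U (i + 2) x * partial (i + 1) q x" for x
      by (simp add: inner_index3[of _ _ i] curl_nth[OF QP] Qn partial_const index3 U_def)
    then show "box_integral c h (\<lambda>x. U (i + 1) x * partial (i + 2) q x - U (i + 2) x * partial (i + 1) q x) = 0"
      using dof4[OF curl_in_interior_test[OF q, of i]] by (simp add: Q_def)
  qed
  then show "u = 0" by (simp add: U_def fun_eq_iff vec_eq_iff)
qed

section \<open>The bubble enrichment\<close>

text \<open>
  Taking the cross product with the normal of a face is, up to a rotation in the face, the projection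
  onto the tangential components.
\<close>

lemma cross_space_normal_iff:
  assumes s: "s \<in> {-1, 1}"
  shows "w \<in> cross_space (cube (poly_space UNIV k)) (\<lambda>x. face_normal (i, s)) \<longleftrightarrow>
    w \<in> cube (poly_space UNIV k) \<and> (\<forall>x. w x $ i = 0)"
proof
  assume "w \<in> cross_space (cube (poly_space UNIV k)) (\<lambda>x. face_normal (i, s))"
  then obtain p where p: "p \<in> cube (poly_space UNIV k)" and w: "w = (\<lambda>x. cross3 (p x) (face_normal (i, s)))"
    unfolding cross_space_def by blast
  have n: "w x $ i = 0" "w x $ (i + 1) = s * p x $ (i + 2)" "w x $ (i + 2) = (- s) * p x $ (i + 1)" for x
    unfolding w cross3_nth face_normal_nth by (simp_all add: index3)
  have P: "(\<lambda>x. p x $ j) \<in> poly_space UNIV k" for j using p by (simp add: cube_iff)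
  have "(\<lambda>x. w x $ i) \<in> poly_space UNIV k" "(\<lambda>x. w x $ (i + 1)) \<in> poly_space UNIV k"
    "(\<lambda>x. w x $ (i + 2)) \<in> poly_space UNIV k"
    unfolding n by (rule poly_space_zero, rule poly_space_scale[OF P], rule poly_space_scale[OF P])
  then have "(\<lambda>x. w x $ j) \<in> poly_space UNIV k" for j
    using index3_cases[of j i] by auto
  then show "w \<in> cube (poly_space UNIV k) \<and> (\<forall>x. w x $ i = 0)" using n by (simp add: cube_iff)
next
  assume w: "w \<in> cube (poly_space UNIV k) \<and> (\<forall>x. w x $ i = 0)"
  define p where "p = (\<lambda>x. (\<chi> j. if j = i + 2 then s * w x $ (i + 1) else if j = i + 1 then (- s) * w x $ (i + 2) else 0) :: real^3)"
  have pn: "(\<lambda>x. p x $ j) = (if j = i + 2 then (\<lambda>x. s * w x $ (i + 1)) else if j = i + 1 then (\<lambda>x. (- s) * w x $ (i + 2)) else (\<lambda>x. 0))" for j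
    by (auto simp: p_def)
  have "p \<in> cube (poly_space UNIV k)"
  proof -
    have P: "(\<lambda>x. w x $ j) \<in> poly_space UNIV k" for j using w by (simp add: cube_iff)
    show ?thesis
      unfolding cube_iff pn
      using poly_space_scale[OF P, of s "i + 1"] poly_space_scale[OF P, of "- s" "i + 2"] by (simp add: poly_space_zero)
  qed
  moreover have "w = (\<lambda>x. cross3 (p x) (face_normal (i, s)))"
  proof (intro ext vec_eq_iff[THEN iffD2] allI)
    fix x j
    have ss: "s * s = 1" using s by auto
    have "cross3 (p x) (face_normal (i, s)) $ i = w x $ i"
      "cross3 (p x) (face_normal (i, s)) $ (i + 1) = w x $ (i + 1)"
      "cross3 (p x) (face_normal (i, s)) $ (i + 2) = w x $ (i + 2)"
      using w ss unfolding cross3_nth face_normal_nth p_def by (simp_all add: index3 algebra_simps)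
    then show "w x $ j = cross3 (p x) (face_normal (i, s)) $ j"
      using index3_cases[of j i] by metis
  qed
  ultimately show "w \<in> cross_space (cube (poly_space UNIV k)) (\<lambda>x. face_normal (i, s))"
    unfolding cross_space_def by blast
qed

lemma finite_faces: "finite faces"
proof -
  have "faces = UNIV \<times> {-1, 1}" by (auto simp: faces_def)
  moreover have "finite ((UNIV :: 3 set) \<times> {-1, 1 :: real})" by (intro finite_cartesian_product) auto
  ultimately show ?thesis by (rule ssubst)
qed

lemma face_factor_Poly: "face_factor c h f \<in> Poly"
  by (cases f) (auto intro!: Poly_intros)

lemma bubble_face_Poly: "bubble_face c h f \<in> Poly"
  unfolding bubble_face_def by (intro Poly_prod face_factor_Poly)

lemma bubble_box_axis_bubble: "bubble_box c h x = (\<Prod>k\<in>UNIV. axis_bubble c h k x)"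
  by (simp add: bubble_box_def axis_bubble_def)

lemma bubble_box_Poly: "bubble_box c h \<in> Poly"
  unfolding bubble_box_def by (intro Poly_prod Poly_intros)

lemma bubble_box_pos: "x \<in> box (c - h) (c + h) \<Longrightarrow> bubble_box c h x > 0"
  unfolding bubble_box_axis_bubble by (rule prod_axis_bubble_pos)

lemma face_factor_face_point: "face_factor c h (i, s) (face_point c h i s x) = 0" if "s \<in> {-1, 1}"
  using that by (auto simp: face_point_def set_coord_nth)

lemma bubble_box_face_point: "s \<in> {-1, 1} \<Longrightarrow> bubble_box c h (face_point c h i s x) = 0"
  using bubble_box_eq_factor_times_bubble_face[of "(i, s)" c h "face_point c h i s x"]
    face_factor_face_point[of s c h i x] by (simp add: faces_def del: face_factor.simps)

lemma bubble_face_face_point: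
  assumes "(i, s) \<in> faces" "g \<noteq> (i, s)"
  shows "bubble_face c h g (face_point c h i s x) = 0"
  unfolding bubble_face_def
proof (rule prod_zero)
  show "\<exists>f\<in>faces - {g}. face_factor c h f (face_point c h i s x) = 0"
    using assms face_factor_face_point[of s c h i x]
    by (intro bexI[of _ "(i, s)"]) (auto simp: faces_def simp del: face_factor.simps)
qed (use finite_faces in simp)

lemma bubble_face_pos:
  assumes h: "\<forall>i. h $ i > 0" and f: "(i, s) \<in> faces" and x: "x \<in> box (c - h) (c + h)"
  shows "bubble_face c h (i, s) (face_point c h i s x) > 0"
  unfolding bubble_face_def
proof (rule prod_pos)
  fix g assume g: "g \<in> faces - {(i, s)}"
  obtain j t where jt: "g = (j, t)" by (cases g)
  show "face_factor c h g (face_point c h i s x) > 0"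
  proof (cases "j = i")
    case True
    then have "t = - s" using g f jt by (auto simp: faces_def)
    then show ?thesis using True f h by (auto simp: jt faces_def face_point_def set_coord_nth)
  next
    case False
    have "c $ j - h $ j < x $ j" "x $ j < c $ j + h $ j" using x by (auto simp: mem_box_cart dest: spec[of _ j])
    then show ?thesis using False g by (auto simp: jt faces_def face_point_def set_coord_nth)
  qed
qed

lemma partial_face_factor: "partial j (face_factor c h (i, s)) x = (if j = i then - s else 0)"
proof -
  have e: "face_factor c h (i, s) = (\<lambda>x. h $ i - s * (x $ i - c $ i))" by simp
  have P: "(\<lambda>x. x $ i - c $ i) \<in> Poly" by (intro Poly_intros)
  show ?thesis
    unfolding e by (simp only: partial_diff partial_scale mspan_scale P Poly_const Poly_coord partial_const partial_coord) simp
qed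

text \<open>
  Write the box bubble as \<open>face_factor * bubble_face\<close>; on the face the first factor vanishes, so only
  its derivative, a constant normal vector, survives.
\<close>

lemma partial_bubble_mult_face_point:
  assumes f: "(i, s) \<in> faces" and z: "z \<in> Poly"
  shows "partial j (\<lambda>x. bubble_box c h x * z x) (face_point c h i s x)
    = (if j = i then - s * bubble_face c h (i, s) (face_point c h i s x) * z (face_point c h i s x) else 0)"
proof -
  have e: "(\<lambda>x. bubble_box c h x * z x) = (\<lambda>x. face_factor c h (i, s) x * (bubble_face c h (i, s) x * z x))"
    by (simp only: bubble_box_eq_factor_times_bubble_face[OF f] mult.assoc)
  have "face_factor c h (i, s) (face_point c h i s x) = 0"
    using f by (intro face_factor_face_point) (auto simp: faces_def)
  then show ?thesis
    unfolding e by (simp only: partial_mult face_factor_Poly Poly_mult bubble_face_Poly z partial_face_factor) simp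
qed

lemma VfD:
  assumes "q \<in> Vf c h r (i, s)" "(i, s) \<in> faces"
  shows "(\<lambda>x. q x $ j) \<in> poly_space UNIV (r - 2)" "q x $ i = 0"
    and "w \<in> cube (poly_space UNIV (r - 3)) \<Longrightarrow>
      box_integral c h (\<lambda>x. bubble_box c h x * bubble_face c h (i, s) x * (q x \<bullet> w x)) = 0"
proof -
  have s: "s \<in> {-1, 1}" using assms(2) by (simp add: faces_def)
  have q: "q \<in> cube (poly_space UNIV (r - 2)) \<and> (\<forall>x. q x $ i = 0)"
    using assms(1) unfolding Vf_def cross_space_normal_iff[OF s] by simp
  then show "(\<lambda>x. q x $ j) \<in> poly_space UNIV (r - 2)" "q x $ i = 0" by (auto simp: cube_iff)
  assume w: "w \<in> cube (poly_space UNIV (r - 3))"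
  define w' where "w' = (\<lambda>x. (\<chi> j. if j = i then 0 else w x $ j) :: real^3)"
  have "(\<lambda>x. w' x $ j) = (if j = i then (\<lambda>x. 0) else (\<lambda>x. w x $ j))" for j by (auto simp: w'_def)
  then have "w' \<in> cube (poly_space UNIV (r - 3))" using w by (auto simp: cube_iff poly_space_zero)
  then have "w' \<in> cross_space (cube (poly_space UNIV (r - 3))) (\<lambda>x. face_normal (i, s))"
    unfolding cross_space_normal_iff[OF s] by (simp add: w'_def)
  then have "box_integral c h (\<lambda>x. q x \<bullet> ((bubble_box c h x * bubble_face c h (i, s) x) *\<^sub>R w' x)) = 0"
    using assms(1) unfolding Vf_def by blast
  moreover have "q x \<bullet> w' x = q x \<bullet> w x" for x
    using q by (simp add: inner_index3[of _ _ i] w'_def index3)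
  ultimately show "box_integral c h (\<lambda>x. bubble_box c h x * bubble_face c h (i, s) x * (q x \<bullet> w x)) = 0"
    by (simp add: mult.assoc)
qed

definition bubble_field :: "real^3 \<Rightarrow> real^3 \<Rightarrow> (face \<Rightarrow> vector_field) \<Rightarrow> vector_field"
  where "bubble_field c h q = (\<lambda>x. bubble_box c h x *\<^sub>R (\<Sum>f\<in>faces. bubble_face c h f x *\<^sub>R q f x))"

lemma V_iff: "v \<in> V c h r \<longleftrightarrow> (\<exists>q. (\<forall>f\<in>faces. q f \<in> Vf c h r f) \<and> v = bubble_field c h q)"
proof
  assume "v \<in> V c h r"
  then obtain z where z: "z \<in> (\<Sum>f\<in>faces. (\<lambda>q x. bubble_face c h f x *\<^sub>R q x) ` Vf c h r f)"
    and v: "v = (\<lambda>x. bubble_box c h x *\<^sub>R z x)" unfolding V_def by blast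
  obtain y where y: "z = sum y faces" "\<And>f. f \<in> faces \<Longrightarrow> y f \<in> (\<lambda>q x. bubble_face c h f x *\<^sub>R q x) ` Vf c h r f"
    using z unfolding set_sum_alt[OF finite_faces] by blast
  then have "\<forall>f\<in>faces. \<exists>q. q \<in> Vf c h r f \<and> y f = (\<lambda>x. bubble_face c h f x *\<^sub>R q x)" by blast
  then obtain q where q: "\<And>f. f \<in> faces \<Longrightarrow> q f \<in> Vf c h r f \<and> y f = (\<lambda>x. bubble_face c h f x *\<^sub>R q f x)" by metis
  have "v = bubble_field c h q"
    unfolding v y(1) bubble_field_def using q by (simp add: fun_eq_iff fun_sum_apply)
  with q show "\<exists>q. (\<forall>f\<in>faces. q f \<in> Vf c h r f) \<and> v = bubble_field c h q" by blast
next
  assume "\<exists>q. (\<forall>f\<in>faces. q f \<in> Vf c h r f) \<and> v = bubble_field c h q"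
  then obtain q where q: "\<forall>f\<in>faces. q f \<in> Vf c h r f" and v: "v = bubble_field c h q" by blast
  have "(\<Sum>f\<in>faces. (\<lambda>x. bubble_face c h f x *\<^sub>R q f x)) \<in> (\<Sum>f\<in>faces. (\<lambda>q x. bubble_face c h f x *\<^sub>R q x) ` Vf c h r f)"
    unfolding set_sum_alt[OF finite_faces] using q by blast
  moreover have "v = (\<lambda>x. bubble_box c h x *\<^sub>R (\<Sum>f\<in>faces. (\<lambda>x. bubble_face c h f x *\<^sub>R q f x)) x)"
    unfolding v bubble_field_def by (simp add: fun_eq_iff fun_sum_apply)
  ultimately show "v \<in> V c h r" unfolding V_def by blast
qed

lemma edge_integral_cong:
  assumes "\<And>x. x $ (i + 1) = c $ (i + 1) + s * h $ (i + 1) \<Longrightarrow> g x = g' x"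
  shows "edge_integral c h (i, s, t) g = edge_integral c h (i, s, t) g'"
  unfolding edge_integral.simps by (intro integral_cong assms) (simp add: index3)

lemma face_integral_cong:
  assumes "\<And>x. x $ i = c $ i + s * h $ i \<Longrightarrow> g x = g' x"
  shows "face_integral c h (i, s) g = face_integral c h (i, s) g'"
  unfolding face_integral.simps by (intro integral_cong) (auto intro!: assms)

context
  fixes r :: int and c h :: "real^3" and q :: "face \<Rightarrow> vector_field"
  assumes r: "r \<ge> 2" and h: "\<forall>i. h $ i > 0" and q: "\<And>f. f \<in> faces \<Longrightarrow> q f \<in> Vf c h r f"
begin

lemma q_degree: "f \<in> faces \<Longrightarrow> (\<lambda>x. q f x $ j) \<in> poly_space UNIV (r - 2)"
  using VfD(1) q by (cases f) blast

lemma q_Poly: "f \<in> faces \<Longrightarrow> (\<lambda>x. q f x $ j) \<in> Poly"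
  using q_degree poly_space_Poly by blast

definition bubble_sum :: "3 \<Rightarrow> scalar_field"
  where "bubble_sum j = (\<lambda>x. \<Sum>f\<in>faces. bubble_face c h f x * q f x $ j)"

lemma bubble_sum_Poly: "bubble_sum j \<in> Poly"
  unfolding bubble_sum_def by (intro mspan_sum Poly_mult bubble_face_Poly q_Poly)

lemma bubble_field_nth: "bubble_field c h q x $ j = bubble_box c h x * bubble_sum j x"
  by (simp add: bubble_field_def bubble_sum_def sum_component)

lemma bubble_field_Poly: "bubble_field c h q \<in> cube Poly"
  unfolding cube_iff bubble_field_nth by (intro allI Poly_mult bubble_box_Poly bubble_sum_Poly)

lemma bubble_field_boundary: "s \<in> {-1, 1} \<Longrightarrow> bubble_field c h q (face_point c h i s x) = 0"
  by (simp add: bubble_field_def bubble_box_face_point)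

text \<open>
  The defining orthogonality of \<open>Vf\<close>, summed over the faces.
\<close>

lemma bubble_field_orthogonal:
  assumes w: "w \<in> interior_test r"
  shows "box_integral c h (\<lambda>x. bubble_field c h q x \<bullet> w x) = 0"
proof -
  have w: "w \<in> cube (poly_space UNIV (r - 3))" using w by (rule interior_test_degree)
  have wP: "(\<lambda>x. w x $ j) \<in> Poly" for j using w poly_space_Poly by (auto simp: cube_iff)
  have "bubble_field c h q x \<bullet> w x = (\<Sum>f\<in>faces. bubble_box c h x * bubble_face c h f x * (q f x \<bullet> w x))" for x
    by (simp add: bubble_field_def inner_sum_left sum_distrib_left mult.assoc)
  then have "box_integral c h (\<lambda>x. bubble_field c h q x \<bullet> w x)
    = (\<Sum>f\<in>faces. box_integral c h (\<lambda>x. bubble_box c h x * bubble_face c h f x * (q f x \<bullet> w x)))"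
    unfolding inner_index3[of _ _ 1]
    by (simp only:) (intro box_integral_sum Poly_intros bubble_box_Poly bubble_face_Poly q_Poly wP)
  also have "\<dots> = 0"
  proof (intro sum.neutral ballI)
    fix f assume f: "f \<in> faces"
    obtain i s where "f = (i, s)" by (cases f)
    then show "box_integral c h (\<lambda>x. bubble_box c h x * bubble_face c h f x * (q f x \<bullet> w x)) = 0"
      using VfD(3)[OF _ _ w] q f by auto
  qed
  finally show ?thesis .
qed

lemma bubble_sum_face_point:
  assumes f: "(i, s) \<in> faces"
  shows "bubble_sum j (face_point c h i s x) = bubble_face c h (i, s) (face_point c h i s x) * q (i, s) (face_point c h i s x) $ j"
proof -
  have "bubble_sum j (face_point c h i s x) = (\<Sum>g\<in>faces. if g = (i, s) then
    bubble_face c h (i, s) (face_point c h i s x) * q (i, s) (face_point c h i s x) $ j else 0)"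
    unfolding bubble_sum_def using bubble_face_face_point[OF f] by (intro sum.cong) auto
  then show ?thesis using f finite_faces by simp
qed

text \<open>
  On the face \<open>f = (i, s)\<close> every term of the sum that belongs to another face vanishes, because its
  bubble contains the factor of \<open>f\<close>. Up to a rotation, the tangential part of the curl is the squared
  face bubble times \<open>q f\<close>.
\<close>

lemma curl_bubble_field_face:
  assumes f: "(i, s) \<in> faces"
  shows "curl (bubble_field c h q) (face_point c h i s x) $ (i + 1)
      = s * (bubble_face c h (i, s) (face_point c h i s x))\<^sup>2 * q (i, s) (face_point c h i s x) $ (i + 2)"
    and "curl (bubble_field c h q) (face_point c h i s x) $ (i + 2)
      = - s * (bubble_face c h (i, s) (face_point c h i s x))\<^sup>2 * q (i, s) (face_point c h i s x) $ (i + 1)"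
  unfolding curl_nth[OF bubble_field_Poly] bubble_field_nth partial_bubble_mult_face_point[OF f bubble_sum_Poly] bubble_sum_face_point[OF f]
  by (simp_all add: index3 power2_eq_square)

text \<open>
  Testing the curl against the trace of \<open>q f\<close> on the face shows that this trace is zero. Hence
  \<open>q f\<close> is \<open>face_factor c h f\<close> times a field \<open>w\<close> of degree at most \<open>r - 3\<close>. Such a field is admissible in
  the orthogonality condition, and the condition becomes the integral of \<open>w\<^sup>2\<close> with the weight
  \<open>bubble_box\<^sup>2\<close>.
\<close>

lemma bubble_field_unisolvent:
  assumes dof3: "\<And>f Q. f \<in> faces \<Longrightarrow> Q \<in> face_tangential_poly f (r - 2) \<Longrightarrow>
      face_integral c h f (\<lambda>x. cross3 (curl (bubble_field c h q) x) (face_normal f) \<bullet> Q x) = 0"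
    and f: "f \<in> faces"
  shows "q f = 0"
proof -
  obtain i s where fis: "f = (i, s)" by (cases f)
  have f: "(i, s) \<in> faces" using f fis by simp
  then have s: "s \<in> {-1, 1}" by (simp add: faces_def)
  let ?q = "q (i, s)" and ?F = "face_point c h i s" and ?B = "bubble_face c h (i, s)"
  have curlP: "(\<lambda>x. curl (bubble_field c h q) x $ j) \<in> Poly" for j
    using bubble_field_Poly unfolding curl_nth[OF bubble_field_Poly] cube_iff by (intro Poly_intros Poly_partial) auto
  have trace: "(\<lambda>x. ?q (?F x) $ j) = (\<lambda>x. 0)" for j
  proof (cases "j = i")
    case True
    then show ?thesis using VfD(2)[OF q[OF f] f] by simp
  next
    case False
    define g where "g = (\<lambda>x. ?q (?F x) $ j)"
    have g: "g \<in> poly_space (- {i}) (r - 2)"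
      unfolding g_def by (rule restrict_poly_space[OF q_degree[OF f]])
    define Q where "Q = (\<lambda>x. (\<chi> k. if k = j then g x else 0) :: real^3)"
    have Qn: "(\<lambda>x. Q x $ k) = (if k = j then g else (\<lambda>x. 0))" for k by (auto simp: Q_def)
    have QP: "(\<lambda>x. Q x $ k) \<in> Poly" for k unfolding Qn using poly_space_Poly[OF g] by (simp add: Poly_const)
    have "Q \<in> face_tangential_poly (i, s) (r - 2)"
      using g False by (intro face_tangential_polyI, unfold Qn) (auto simp: poly_space_zero Q_def)
    from face_dof_box_integral[OF curlP QP s h dof3[OF f this]]
    have "box_integral c h (\<lambda>x. curl (bubble_field c h q) (?F x) $ (i + 2) * Q (?F x) $ (i + 1)
      - curl (bubble_field c h q) (?F x) $ (i + 1) * Q (?F x) $ (i + 2)) = 0" .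
    moreover have "curl (bubble_field c h q) (?F x) $ (i + 2) * Q (?F x) $ (i + 1)
      - curl (bubble_field c h q) (?F x) $ (i + 1) * Q (?F x) $ (i + 2) = - s * ((?B (?F x))\<^sup>2 * (g x * g x))" for x
    proof -
      have "g (?F x) = g x" by (simp add: g_def face_point_same)
      then show ?thesis
        using index3_cases[of j i] False unfolding curl_bubble_field_face[OF f]
        by (auto simp: Q_def index3 g_def)
    qed
    ultimately have "- s * box_integral c h (\<lambda>x. (?B (?F x))\<^sup>2 * (g x * g x)) = 0"
      by (simp only: box_integral_scale)
    then have int: "box_integral c h (\<lambda>x. (?B (?F x))\<^sup>2 * (g x * g x)) = 0" using s by auto
    have "g = (\<lambda>x. 0)"
    proof (rule box_integral_square_eq_0[OF h poly_space_Poly[OF g] _ _ int])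
      show "(\<lambda>x. (?B (?F x))\<^sup>2) \<in> Poly"
        unfolding power2_eq_square by (intro Poly_mult Poly_face_point bubble_face_Poly)
      show "(?B (?F x))\<^sup>2 > 0" if "x \<in> box (c - h) (c + h)" for x
        using bubble_face_pos[OF h f that] by simp
    qed
    then show ?thesis by (simp add: g_def)
  qed
  have "?q x $ j = 0" for x j
  proof (cases "j = i")
    case True
    then show ?thesis using VfD(2)[OF q[OF f] f] by simp
  next
    case False
    let ?t = "c $ i + s * h $ i"
    have lower: "a(i := n) \<in> {a. int (deg a) \<le> r - 3}" if "a \<in> {a. int (deg a) \<le> r - 2}" "n < a i" for a n
      using that deg_upd[of a i n] by simp
    obtain m where m: "m \<in> poly_space UNIV (r - 3)" "\<And>x. ?q x $ j - ?q (set_coord i ?t x) $ j = (x $ i - ?t) * m x"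
      using divide_linear_factor[OF q_degree[OF f, of j, unfolded poly_space_UNIV] lower, of ?t]
      unfolding poly_space_UNIV by blast
    \<comment> \<open>\<open>face_factor\<close> is \<open>- s\<close> times the monic linear factor, and \<open>s * s = 1\<close>\<close>
    define w where "w = (\<lambda>x. - s * m x)"
    have w: "w \<in> poly_space UNIV (r - 3)" unfolding w_def by (rule poly_space_scale[OF m(1)])
    have qw: "?q x $ j = face_factor c h (i, s) x * w x" for x
    proof -
      have "?q (set_coord i ?t x) $ j = 0" using fun_cong[OF trace[of j], of x] by (simp add: face_point_def)
      then have "?q x $ j = (x $ i - ?t) * m x" using m(2)[of x] by simp
      also have "\<dots> = face_factor c h (i, s) x * w x" using s by (auto simp: w_def algebra_simps)
      finally show ?thesis .
    qed
    define W where "W = (\<lambda>x. (\<chi> k. if k = j then w x else 0) :: real^3)"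
    have Wn: "(\<lambda>x. W x $ k) = (if k = j then w else (\<lambda>x. 0))" for k by (auto simp: W_def)
    have "W \<in> cube (poly_space UNIV (r - 3))" unfolding cube_iff Wn using w by (simp add: poly_space_zero)
    from VfD(3)[OF q[OF f] f this]
    have "box_integral c h (\<lambda>x. bubble_box c h x * ?B x * (?q x \<bullet> W x)) = 0" .
    moreover have "bubble_box c h x * ?B x * (?q x \<bullet> W x) = (bubble_box c h x)\<^sup>2 * (w x * w x)" for x
    proof -
      have "?q x \<bullet> W x = face_factor c h (i, s) x * w x * w x"
        unfolding inner_index3[of _ _ j] by (simp add: W_def index3 qw)
      then show ?thesis using bubble_box_eq_factor_times_bubble_face[OF f, of c h x]
        by (simp add: power2_eq_square)
    qed
    ultimately have int: "box_integral c h (\<lambda>x. (bubble_box c h x)\<^sup>2 * (w x * w x)) = 0" by simp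
    have "w = (\<lambda>x. 0)"
    proof (rule box_integral_square_eq_0[OF h poly_space_Poly[OF w] _ _ int])
      show "(\<lambda>x. (bubble_box c h x)\<^sup>2) \<in> Poly"
        unfolding power2_eq_square by (intro Poly_mult bubble_box_Poly)
      show "(bubble_box c h x)\<^sup>2 > 0" if "x \<in> box (c - h) (c + h)" for x
        using bubble_box_pos[OF that] by simp
    qed
    then show ?thesis by (simp add: qw)
  qed
  then show ?thesis by (simp add: fis fun_eq_iff vec_eq_iff)
qed

text \<open>
  The bubble part vanishes on the boundary and is orthogonal to the interior tests. So the degrees of
  freedom that involve no curl are those of the \<open>S1\<close> part, which is therefore zero; the tangential
  curl then determines the bubble part.
\<close>

lemma S1_plus_bubble_unisolvent:
  assumes s: "s \<in> S1 r" and u: "u = s + bubble_field c h q"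
    and dof1: "\<And>e q. e \<in> edges \<Longrightarrow> q \<in> edge_poly e (r - 1) \<Longrightarrow> edge_integral c h e (\<lambda>x. u x \<bullet> edge_tangent e * q x) = 0"
    and dof2: "\<And>f q. f \<in> faces \<Longrightarrow> q \<in> face_test r f \<Longrightarrow> face_integral c h f (\<lambda>x. cross3 (u x) (face_normal f) \<bullet> q x) = 0"
    and dof3: "\<And>f q. f \<in> faces \<Longrightarrow> q \<in> face_tangential_poly f (r - 2) \<Longrightarrow>
      face_integral c h f (\<lambda>x. cross3 (curl u x) (face_normal f) \<bullet> q x) = 0"
    and dof4: "\<And>q. q \<in> interior_test r \<Longrightarrow> box_integral c h (\<lambda>x. u x \<bullet> q x) = 0"
  shows "s = 0" "\<forall>f\<in>faces. q f = 0"
proof -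
  have face_pt: "face_point c h i t x = x" if "x $ i = c $ i + t * h $ i" for i t x
    using that by (simp add: face_point_def set_coord_def vec_eq_iff)
  have us: "u x = s x" if "x $ i = c $ i + t * h $ i" "t \<in> {-1, 1}" for i t x
    using bubble_field_boundary[OF that(2), of i x] face_pt[OF that(1)] by (simp add: u)
  have sP: "s \<in> cube Poly" using S1_Poly[OF r s] .
  show s0: "s = 0"
  proof (rule S1_unisolvent[OF r h s])
    fix e q assume e: "e \<in> edges" "q \<in> edge_poly e (r - 1)"
    obtain i a b where eq: "e = (i, a, b)" by (cases e)
    then have "a \<in> {-1, 1}" using e by (simp add: edges_def)
    then have "edge_integral c h (i, a, b) (\<lambda>x. s x \<bullet> edge_tangent e * q x) = edge_integral c h (i, a, b) (\<lambda>x. u x \<bullet> edge_tangent e * q x)"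
      using us[of _ "i + 1" a] by (intro edge_integral_cong) simp
    then show "edge_integral c h e (\<lambda>x. s x \<bullet> edge_tangent e * q x) = 0"
      using dof1[OF e] by (simp add: eq del: edge_integral.simps)
  next
    fix f q assume f: "f \<in> faces" "q \<in> face_test r f"
    obtain i a where eq: "f = (i, a)" by (cases f)
    then have "a \<in> {-1, 1}" using f by (simp add: faces_def)
    then have "face_integral c h (i, a) (\<lambda>x. cross3 (s x) (face_normal f) \<bullet> q x) = face_integral c h (i, a) (\<lambda>x. cross3 (u x) (face_normal f) \<bullet> q x)"
      using us[of _ i a] by (intro face_integral_cong) simp
    then show "face_integral c h f (\<lambda>x. cross3 (s x) (face_normal f) \<bullet> q x) = 0"
      using dof2[OF f] by (simp add: eq del: face_integral.simps)
  next
    fix w assume w: "w \<in> interior_test r"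
    have wP: "(\<lambda>x. w x $ j) \<in> Poly" for j using interior_test_degree[OF w] poly_space_Poly by (auto simp: cube_iff)
    have P: "(\<lambda>x. a x \<bullet> w x) \<in> Poly" if "a \<in> cube Poly" for a
      unfolding inner_index3[of _ _ 1] using that by (intro Poly_intros wP) (auto simp: cube_iff)
    have "box_integral c h (\<lambda>x. u x \<bullet> w x) = box_integral c h (\<lambda>x. s x \<bullet> w x) + box_integral c h (\<lambda>x. bubble_field c h q x \<bullet> w x)"
      using box_integral_add[OF P[OF sP] P[OF bubble_field_Poly]] by (simp add: u inner_add_left)
    then show "box_integral c h (\<lambda>x. s x \<bullet> w x) = 0"
      using bubble_field_orthogonal[OF w] dof4[OF w] by simp
  qed
  have "u = bubble_field c h q" using s0 u by simp
  then show "\<forall>f\<in>faces. q f = 0" using bubble_field_unisolvent dof3 by blast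
qed

end

section \<open>Counting exponents\<close>

text \<open>
  Sets of exponents are counted as sets of triples, the order of the axes starting at any \<open>i\<close>.
\<close>

lemma card_exponents:
  fixes i :: 3
  assumes "\<And>a :: 3 \<Rightarrow> nat. a \<in> A \<longleftrightarrow> (a i, a (i + 1), a (i + 2)) \<in> T"
  shows "card A = card T" "finite A \<longleftrightarrow> finite T"
proof -
  let ?g = "\<lambda>(x, y, z) j. if j = i then x else if j = i + 1 then y else (z::nat)"
  have "bij_betw (\<lambda>a. (a i, a (i + 1), a (i + 2))) A T"
  proof (rule bij_betw_byWitness[where f' = ?g])
    have "?g (a i, a (i + 1), a (i + 2)) j = a j" for a j
      using index3_cases[of j i] by (auto simp: index3)
    then show "\<forall>a\<in>A. ?g (a i, a (i + 1), a (i + 2)) = a" by blast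
    show "\<forall>t\<in>T. (?g t i, ?g t (i + 1), ?g t (i + 2)) = t" by (auto simp: index3)
    show "(\<lambda>a. (a i, a (i + 1), a (i + 2))) ` A \<subseteq> T" using assms by auto
    show "?g ` T \<subseteq> A"
    proof
      fix b assume "b \<in> ?g ` T"
      then obtain x y z where "(x, y, z) \<in> T" "b = ?g (x, y, z)" by auto
      then show "b \<in> A" using assms[of b] by (simp add: index3)
    qed
  qed
  then show "card A = card T" "finite A \<longleftrightarrow> finite T" by (rule bij_betw_same_card, rule bij_betw_finite)
qed

lemma card_Sigma_total:
  fixes B :: "nat \<Rightarrow> 'b set"
  assumes "\<And>m. finite (B m)"
  shows "card (SIGMA x:{..k}. B (k - x)) = (\<Sum>j\<le>k. card (B j))"
proof -
  have "card (SIGMA x:{..k}. B (k - x)) = (\<Sum>x\<le>k. card (B (k - x)))"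
    using assms by (intro card_SigmaI) auto
  also have "\<dots> = (\<Sum>j\<le>k. card (B j))"
    by (rule sum.reindex_bij_witness[where i="\<lambda>x. k - x" and j="\<lambda>x. k - x"]) auto
  finally show ?thesis .
qed

text \<open>
  The contribution of a single exponent to the superlinear degree.
\<close>

definition weight :: "nat \<Rightarrow> nat"
  where "weight x = (if x = 1 then 0 else x)"

lemma weight_le_set: "{x. weight x \<le> k} = {0, 1} \<union> {2..k}"
  by (auto simp: weight_def)

lemma card_Sigma_weight:
  fixes B :: "nat \<Rightarrow> 'b set"
  assumes "\<And>m. finite (B m)"
  shows "card (SIGMA x:{x. weight x \<le> k}. B (k - weight x)) = 2 * card (B k) + (\<Sum>j<k - 1. card (B j))"
proof -
  have fin: "finite {x. weight x \<le> k}" by (simp add: weight_le_set)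
  have "card (SIGMA x:{x. weight x \<le> k}. B (k - weight x)) = (\<Sum>x\<in>{x. weight x \<le> k}. card (B (k - weight x)))"
    using assms fin by (intro card_SigmaI) auto
  also have "\<dots> = (\<Sum>x\<in>{0, 1}. card (B (k - weight x))) + (\<Sum>x\<in>{2..k}. card (B (k - weight x)))"
    unfolding weight_le_set by (rule sum.union_disjoint) auto
  also have "(\<Sum>x\<in>{0, 1}. card (B (k - weight x))) = 2 * card (B k)"
    by (simp add: weight_def)
  also have "(\<Sum>x\<in>{2..k}. card (B (k - weight x))) = (\<Sum>j<k - 1. card (B j))"
    by (rule sum.reindex_bij_witness[where i="\<lambda>x. k - x" and j="\<lambda>x. k - x"]) (auto simp: weight_def)
  finally show ?thesis .
qed

lemma card_pairs: "finite {(x, y). x + y \<le> (k::nat)}" "2 * card {(x, y). x + y \<le> (k::nat)} = (k + 1) * (k + 2)"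
proof -
  have e: "{(x, y). x + y \<le> k} = (SIGMA x:{..k}. {..k - x})" by auto
  show "finite {(x, y). x + y \<le> k}" unfolding e by auto
  have "card {(x, y). x + y \<le> k} = (\<Sum>j\<le>k. j + 1)"
    unfolding e by (subst card_Sigma_total[where B="\<lambda>m. {..m}"]) auto
  moreover have "2 * (\<Sum>j\<le>k. j + 1) = (k + 1) * (k + 2)" by (induction k) auto
  ultimately show "2 * card {(x, y). x + y \<le> (k::nat)} = (k + 1) * (k + 2)" by simp
qed

lemma card_triples: "finite {(x, y, z). x + y + z \<le> (k::nat)}"
  "6 * card {(x, y, z). x + y + z \<le> (k::nat)} = (k + 1) * (k + 2) * (k + 3)"
proof -
  have e: "{(x, y, z). x + y + z \<le> k} = (SIGMA x:{..k}. {(y, z). y + z \<le> k - x})" by auto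
  show "finite {(x, y, z). x + y + z \<le> k}" unfolding e using card_pairs(1) by auto
  have "card {(x, y, z). x + y + z \<le> k} = (\<Sum>j\<le>k. card {(y, z). y + z \<le> j})"
    unfolding e by (rule card_Sigma_total) (rule card_pairs(1))
  then have "6 * card {(x, y, z). x + y + z \<le> k} = (\<Sum>j\<le>k. 3 * (2 * card {(y, z). y + z \<le> j}))"
    by (simp add: sum_distrib_left)
  also have "\<dots> = (\<Sum>j\<le>k. 3 * ((j + 1) * (j + 2)))" by (simp only: card_pairs(2))
  also have "\<dots> = (k + 1) * (k + 2) * (k + 3)" by (induction k) (auto simp: algebra_simps)
  finally show "6 * card {(x, y, z). x + y + z \<le> (k::nat)} = (k + 1) * (k + 2) * (k + 3)" .
qed

lemma finite_weight: "finite {x. weight x \<le> k}" by (simp add: weight_le_set)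

lemma card_weight_1: "card {x. weight x \<le> k} = (if k = 0 then 2 else k + 1)"
proof -
  have "card {x. weight x \<le> k} = card {0::nat, 1} + card {2..k}"
    unfolding weight_le_set by (rule card_Un_disjoint) auto
  then show ?thesis by auto
qed

text \<open>
  For \<open>k \<le> 1\<close> the count differs from the quadratic polynomial valid from \<open>k = 2\<close> on. The same
  happens to the cubic count in three variables; there the two deviations cancel in the sum over
  smaller degrees, so that the cubic formula starts at \<open>k = 3\<close> and \<open>k = 2\<close> is computed separately.
\<close>

lemma card_weight_2: "finite {(x, y). weight x + weight y \<le> k}"
  "2 * card {(x, y). weight x + weight y \<le> k} = (if k \<le> 1 then 8 else k * k + 3 * k + 6)"
proof -
  have e: "{(x, y). weight x + weight y \<le> k} = (SIGMA x:{x. weight x \<le> k}. {y. weight y \<le> k - weight x})" by auto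
  show "finite {(x, y). weight x + weight y \<le> k}" unfolding e using finite_weight by auto
  have c: "card {(x, y). weight x + weight y \<le> k} = 2 * card {y. weight y \<le> k} + (\<Sum>j<k - 1. card {y. weight y \<le> j})"
    unfolding e by (rule card_Sigma_weight) (rule finite_weight)
  have s: "2 * (\<Sum>j<Suc n. card {y. weight y \<le> j}) = n * n + 3 * n + 4" for n
    by (induction n) (auto simp: card_weight_1 algebra_simps simp del: le_zero_eq)
  show "2 * card {(x, y). weight x + weight y \<le> k} = (if k \<le> 1 then 8 else k * k + 3 * k + 6)"
  proof (cases "k \<le> 1")
    case True
    then have "{..<k - 1} = {}" by auto
    then show ?thesis unfolding c card_weight_1 using True by auto
  next
    case False
    then obtain n where k: "k = Suc (Suc n)"
      using less_imp_Suc_add[of 1 k] by auto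
    show ?thesis using s[of n] unfolding c unfolding card_weight_1 unfolding k by (simp add: algebra_simps)
  qed
qed

lemma card_weight_3: "finite {(x, y, z). weight x + weight y + weight z \<le> k}"
  "k = 2 \<Longrightarrow> card {(x, y, z). weight x + weight y + weight z \<le> k} = 20"
  "k = m + 3 \<Longrightarrow> 6 * card {(x, y, z). weight x + weight y + weight z \<le> k} = 6 * (k * k + 3 * k + 6) + (m + 2) * ((m + 1) * (m + 1) + 5 * (m + 1) + 18)"
proof -
  have e: "{(x, y, z). weight x + weight y + weight z \<le> k} = (SIGMA x:{x. weight x \<le> k}. {(y, z). weight y + weight z \<le> k - weight x})" by auto
  show "finite {(x, y, z). weight x + weight y + weight z \<le> k}" unfolding e using finite_weight card_weight_2(1) by auto
  have c: "card {(x, y, z). weight x + weight y + weight z \<le> k} = 2 * card {(y, z). weight y + weight z \<le> k} + (\<Sum>j<k - 1. card {(y, z). weight y + weight z \<le> j})"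
    unfolding e by (rule card_Sigma_weight) (rule card_weight_2(1))
  have half: "2 * n = 2 * m \<Longrightarrow> n = m" for n m :: nat by simp
  have v: "card {(y, z). weight y + weight z \<le> 0} = 4" "card {(y, z). weight y + weight z \<le> Suc 0} = 4" "card {(y, z). weight y + weight z \<le> 2} = 8"
    by (rule half, subst card_weight_2(2), simp)+
  show "card {(x, y, z). weight x + weight y + weight z \<le> k} = 20" if "k = 2"
  proof -
    have "(\<Sum>j<2 - 1. card {(y, z). weight y + weight z \<le> j}) = card {(y, z). weight y + weight z \<le> 0}" by simp
    then have "(\<Sum>j<2 - 1. card {(y, z). weight y + weight z \<le> j}) = 4" by (simp only: v)
    then show ?thesis unfolding c unfolding that v by simp
  qed
  have s: "6 * (\<Sum>j<Suc (Suc n). card {(y, z). weight y + weight z \<le> j}) = (n + 2) * ((n + 1) * (n + 1) + 5 * (n + 1) + 18)" for n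
  proof (induction n)
    case 0
    then show ?case by (simp only: sum.lessThan_Suc lessThan_0 sum.empty v) simp
  next
    case (Suc n)
    have "6 * (\<Sum>j<Suc (Suc (Suc n)). card {(y, z). weight y + weight z \<le> j})
      = 6 * (\<Sum>j<Suc (Suc n). card {(y, z). weight y + weight z \<le> j}) + 3 * (2 * card {(y, z). weight y + weight z \<le> Suc (Suc n)})"
      by simp
    then show ?case unfolding Suc card_weight_2(2) by (simp add: algebra_simps)
  qed
  show "6 * card {(x, y, z). weight x + weight y + weight z \<le> k} = 6 * (k * k + 3 * k + 6) + (m + 2) * ((m + 1) * (m + 1) + 5 * (m + 1) + 18)" if k: "k = m + 3"
  proof -
    have "6 * card {(x, y, z). weight x + weight y + weight z \<le> k} = 6 * (2 * card {(y, z). weight y + weight z \<le> k}) + 6 * (\<Sum>j<Suc (Suc m). card {(y, z). weight y + weight z \<le> j})"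
      unfolding c using k by (simp add: numeral_3_eq_3)
    then show ?thesis unfolding s card_weight_2(2) using k by simp
  qed
qed

section \<open>Dimensions of polynomial spaces\<close>

lemma superlinear_degree_eq_weights: "superlinear_degree a = weight (a i) + weight (a (i + 1)) + weight (a (i + 2))" for i :: 3
  by (simp add: superlinear_degree_index3[of _ i] weight_def)

lemma finite_deg_le: "finite {a. int (deg a) \<le> k}"
proof -
  have "finite {a. deg a \<le> nat k}"
    using card_triples(1) by (subst card_exponents(2)[of _ 1 "{(x, y, z). x + y + z \<le> nat k}"]) (auto simp: deg_index3[of _ 1])
  then show ?thesis by (rule rev_finite_subset) auto
qed

lemma fin_dim_poly_space: "fin_dim (poly_space J k)"
  unfolding poly_space_mspan by (rule fin_dim_mspan, rule finite_subset[OF _ finite_deg_le[of k]]) auto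

lemma fin_dim_hom_space: "fin_dim (hom_space J k)"
  by (rule fin_dim_subset[OF fin_dim_poly_space hom_space_subset])

lemma subspace_poly_space: "subspace (poly_space J k)"
  unfolding poly_space_mspan by (rule subspace_mspan)

lemma subspace_hom_space: "subspace (hom_space J k)"
  unfolding hom_space_mspan by (rule subspace_mspan)

text \<open>
  In this and the next formula the polynomial on the right has zeros at the negative degrees allowed,
  where the space is trivial. This covers the low orders in which some test spaces are trivial
  without case distinctions.
\<close>

lemma dim_poly_space_box: "k \<ge> -3 \<Longrightarrow> 6 * int (dim (poly_space UNIV k)) = (k + 1) * (k + 2) * (k + 3)"
proof -
  assume k: "k \<ge> -3"
  show ?thesis
  proof (cases "k < 0")
    case True
    then have "{a. int (deg a) \<le> k} = {}" by auto
    then have "dim (poly_space UNIV k) = 0" by (simp add: poly_space_UNIV dim_mspan)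
    moreover have "k = -1 \<or> k = -2 \<or> k = -3" using True k by auto
    ultimately show ?thesis by auto
  next
    case False
    have "dim (poly_space UNIV k) = card {(x, y, z). x + y + z \<le> nat k}"
      unfolding poly_space_UNIV dim_mspan using False
      by (intro card_exponents(1)[of _ 1]) (auto simp: deg_index3[of _ 1])
    moreover have "int (6 * card {(x, y, z). x + y + z \<le> nat k}) = int ((nat k + 1) * (nat k + 2) * (nat k + 3))"
      by (simp only: card_triples(2))
    ultimately show ?thesis using False by (simp add: algebra_simps)
  qed
qed

lemma dim_poly_space_face: "k \<ge> -2 \<Longrightarrow> 2 * int (dim (poly_space (- {i}) k)) = (k + 1) * (k + 2)"
proof -
  assume k: "k \<ge> -2"
  show ?thesis
  proof (cases "k < 0")
    case True
    then have "dim (poly_space (- {i}) k) = 0" by (simp add: poly_space_mspan dim_mspan)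
    moreover have "k = -1 \<or> k = -2" using True k by auto
    ultimately show ?thesis by auto
  next
    case False
    have "dim (poly_space (- {i}) k) = card {(x::nat, y, z). x = 0 \<and> y + z \<le> nat k}"
      unfolding poly_space_mspan dim_mspan using False
      by (intro card_exponents(1)[of _ i]) (auto simp: deg_index3[of _ i])
    also have "{(x::nat, y, z). x = 0 \<and> y + z \<le> nat k} = {0} \<times> {(y, z). y + z \<le> nat k}" by auto
    finally have "dim (poly_space (- {i}) k) = card {(y, z). y + z \<le> nat k}" by (simp add: card_cartesian_product)
    moreover have "int (2 * card {(y, z). y + z \<le> nat k}) = int ((nat k + 1) * (nat k + 2))"
      by (simp only: card_pairs(2))
    ultimately show ?thesis using False by (simp add: algebra_simps)
  qed
qed

lemma dim_poly_space_edge: "k \<ge> 0 \<Longrightarrow> int (dim (poly_space {i} k)) = k + 1"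
proof -
  assume k: "k \<ge> 0"
  have z: "(\<forall>j. j \<notin> {i} \<longrightarrow> a j = 0) \<longleftrightarrow> a (i + 1) = 0 \<and> a (i + 2) = 0" for a :: "3 \<Rightarrow> nat"
    by (subst all_index3[of _ i]) (simp add: index3)
  have "a \<in> {a. (\<forall>j. j \<notin> {i} \<longrightarrow> a j = 0) \<and> int (deg a) \<le> k} \<longleftrightarrow>
    (a i, a (i + 1), a (i + 2)) \<in> {(x, y, z). x \<le> nat k \<and> y = 0 \<and> z = 0}" for a
    unfolding mem_Collect_eq z prod.case deg_index3[of a i] using k by auto
  then have "dim (poly_space {i} k) = card {(x, y::nat, z::nat). x \<le> nat k \<and> y = 0 \<and> z = 0}"
    unfolding poly_space_mspan dim_mspan by (rule card_exponents(1))
  also have "{(x, y::nat, z::nat). x \<le> nat k \<and> y = 0 \<and> z = 0} = {..nat k} \<times> {0} \<times> {0}" by auto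
  finally show ?thesis using k by (simp add: card_cartesian_product)
qed

lemma dim_hom_space_face: "k \<ge> 0 \<Longrightarrow> int (dim (hom_space (- {i}) k)) = k + 1"
proof -
  assume k: "k \<ge> 0"
  have "dim (hom_space (- {i}) k) = card {(x::nat, y, z). x = 0 \<and> y + z = nat k}"
    unfolding hom_space_mspan dim_mspan using k
    by (intro card_exponents(1)[of _ i]) (auto simp: deg_index3[of _ i])
  also have "{(x::nat, y, z). x = 0 \<and> y + z = nat k} = (\<lambda>y. (0, y, nat k - y)) ` {..nat k}" by (auto simp: image_iff)
  also have "card \<dots> = nat k + 1" by (subst card_image) (auto simp: inj_on_def)
  finally show ?thesis using k by simp
qed

lemma dim_hom_space_box: "k \<ge> 0 \<Longrightarrow> 2 * int (dim (hom_space UNIV k)) = (k + 1) * (k + 2)"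
proof -
  assume k: "k \<ge> 0"
  have "dim (hom_space UNIV k) = card {(x::nat, y, z). x + y + z = nat k}"
    unfolding hom_space_mspan dim_mspan using k
    by (intro card_exponents(1)[of _ 1]) (auto simp: deg_index3[of _ 1])
  also have "{(x::nat, y, z). x + y + z = nat k} = (\<lambda>(y, z). (nat k - (y + z), y, z)) ` {(y, z). y + z \<le> nat k}"
    by (auto simp: image_iff)
  also have "card \<dots> = card {(y, z). y + z \<le> nat k}" by (rule card_image) (auto simp: inj_on_def)
  finally have "dim (hom_space UNIV k) = card {(y, z). y + z \<le> nat k}" .
  moreover have "int (2 * card {(y, z). y + z \<le> nat k}) = int ((nat k + 1) * (nat k + 2))"
    by (simp only: card_pairs(2))
  ultimately show ?thesis using k by (simp add: algebra_simps)
qed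

lemma dim_S0: "fin_dim (S0 r)"
  "r = 2 \<Longrightarrow> dim (S0 r) = 20"
  "r \<ge> 3 \<Longrightarrow> 6 * int (dim (S0 r)) = 6 * (r * r + 3 * r + 6) + (r - 1) * ((r - 2) * (r - 2) + 5 * (r - 2) + 18)"
proof -
  have e: "a \<in> {a. int (superlinear_degree a) \<le> r} \<longleftrightarrow> (a 1, a (1 + 1), a (1 + 2)) \<in> {(x, y, z). weight x + weight y + weight z \<le> nat r}" if "r \<ge> 0" for a
    using that by (auto simp: superlinear_degree_eq_weights[of _ 1])
  show "fin_dim (S0 r)"
  proof (cases "r \<ge> 0")
    case True
    have "finite {a. int (superlinear_degree a) \<le> r}"
      using card_exponents(2)[OF e[OF True]] card_weight_3(1) by blast
    then show ?thesis unfolding S0_mspan by (rule fin_dim_mspan)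
  next
    case False
    then have "{a. int (superlinear_degree a) \<le> r} = {}" by auto
    then show ?thesis unfolding S0_mspan by (intro fin_dim_mspan) simp
  qed
  have d: "dim (S0 r) = card {(x, y, z). weight x + weight y + weight z \<le> nat r}" if "r \<ge> 0"
    unfolding S0_mspan dim_mspan by (rule card_exponents(1)[OF e[OF that]])
  show "r = 2 \<Longrightarrow> dim (S0 r) = 20"
    using d card_weight_3(2)[of 2] by simp
  show "6 * int (dim (S0 r)) = 6 * (r * r + 3 * r + 6) + (r - 1) * ((r - 2) * (r - 2) + 5 * (r - 2) + 18)" if r: "r \<ge> 3"
  proof -
    define m where "m = nat (r - 3)"
    have rm: "r = int m + 3" "nat r = m + 3" using r by (auto simp: m_def)
    have "int (6 * dim (S0 r)) = int (6 * (nat r * nat r + 3 * nat r + 6) + (m + 2) * ((m + 1) * (m + 1) + 5 * (m + 1) + 18))"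
      using d r card_weight_3(3)[OF rm(2)] by simp
    then show ?thesis unfolding rm by (simp add: algebra_simps)
  qed
qed

section \<open>Spaces of vector fields\<close>

definition comp_space :: "(3 \<Rightarrow> scalar_field set) \<Rightarrow> vector_field set"
  where "comp_space A = {v. \<forall>j. (\<lambda>x. v x $ j) \<in> A j}"

lemma cube_comp_space: "cube A = comp_space (\<lambda>j. A)"
  by (simp add: cube_def comp_space_def)

lemma comp_space_properties:
  assumes "\<And>j. subspace (A j)" "\<And>j. fin_dim (A j)"
  shows "subspace (comp_space A)" "fin_dim (comp_space A)" "dim (comp_space A) = (\<Sum>j\<in>UNIV. dim (A j))"
proof -
  define F :: "(3 \<Rightarrow> scalar_field) \<Rightarrow> vector_field" where "F = (\<lambda>w x. \<chi> j. w j x)"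
  have lin: "linear F"
    by (rule linearI) (simp_all add: F_def fun_eq_iff vec_eq_iff scaleR_fun_def)
  have eq: "comp_space A = F ` {w. \<forall>j. w j \<in> A j}"
  proof (intro equalityI subsetI)
    fix v assume "v \<in> comp_space A"
    then have "v = F (\<lambda>j x. v x $ j)" "(\<lambda>j x. v x $ j) \<in> {w. \<forall>j. w j \<in> A j}"
      by (auto simp: F_def comp_space_def)
    then show "v \<in> F ` {w. \<forall>j. w j \<in> A j}" by blast
  qed (auto simp: F_def comp_space_def)
  note P = dim_product[of A, OF assms]
  show "subspace (comp_space A)" unfolding eq by (rule linear_subspace_image[OF lin P(1)])
  show "fin_dim (comp_space A)" unfolding eq
    by (rule fin_dim_linear_on_image[OF P(1) linear_imp_linear_on[OF lin] P(2)])
  have "dim (comp_space A) = dim {w. \<forall>j. w j \<in> A j}" unfolding eq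
    by (rule dim_injective_image[OF P(1,2) linear_imp_linear_on[OF lin]])
      (auto simp: F_def fun_eq_iff vec_eq_iff)
  then show "dim (comp_space A) = (\<Sum>j\<in>UNIV. dim (A j))" using P(3) by simp
qed

lemma subspace_cube: "subspace A \<Longrightarrow> subspace (cube A)"
  by (auto simp: subspace_def cube_iff zero_fun_def plus_fun_def scaleR_fun_def)

lemma subspace_zero: "subspace {0 :: 'a::real_vector}"
  by simp

lemma fin_dim_zero: "fin_dim {0 :: 'a::real_vector}"
  unfolding fin_dim_def by (intro exI[of _ "{}"]) simp

abbreviation tangential_space :: "3 \<Rightarrow> scalar_field set \<Rightarrow> vector_field set"
  where "tangential_space i A \<equiv> comp_space (\<lambda>j. if j = i then {0} else A)"

lemma tangential_space_iff:
  assumes "subspace A"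
  shows "v \<in> tangential_space i A \<longleftrightarrow> v \<in> cube A \<and> (\<forall>x. v x $ i = 0)"
proof
  assume v: "v \<in> tangential_space i A"
  then have "(\<lambda>x. v x $ i) = 0" by (auto simp: comp_space_def split: if_splits)
  moreover have "(\<lambda>x. v x $ j) \<in> A" for j
    using v subspace_0[OF assms] by (cases "j = i") (auto simp: comp_space_def split: if_splits dest!: spec[of _ j])
  ultimately show "v \<in> cube A \<and> (\<forall>x. v x $ i = 0)" by (auto simp: cube_iff fun_eq_iff)
qed (auto simp: comp_space_def cube_iff fun_eq_iff)

lemma tangential_space_properties:
  assumes "subspace A" "fin_dim A"
  shows "subspace (tangential_space i A)" "fin_dim (tangential_space i A)" "dim (tangential_space i A) = 2 * dim A"
proof -
  have *: "subspace (if j = i then {0} else A)" "fin_dim (if j = i then {0} else A)" for j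
    using assms subspace_zero fin_dim_zero by auto
  note P = comp_space_properties[of "\<lambda>j. if j = i then {0} else A", OF *]
  show "subspace (tangential_space i A)" "fin_dim (tangential_space i A)" by (rule P)+
  show "dim (tangential_space i A) = 2 * dim A"
    unfolding P(3) by (simp add: sum_index3[of _ i] index3 dim_zero del: span_empty)
qed

lemma face_tangential_poly_eq:
  assumes "s \<in> {-1, 1}"
  shows "face_tangential_poly (i, s) k = tangential_space i (poly_space (- {i}) k)"
proof -
  have "v x \<bullet> face_normal (i, s) = 0 \<longleftrightarrow> v x $ i = 0" for v :: vector_field and x
    using assms by (auto simp: inner_index3[of _ _ i] face_normal_nth index3 simp del: face_normal.simps)
  then show ?thesis
    unfolding set_eq_iff tangential_space_iff[OF subspace_poly_space] face_tangential_poly_def by simp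
qed

lemma cross_space_normal_eq:
  assumes "s \<in> {-1, 1}"
  shows "cross_space (cube (poly_space UNIV k)) (\<lambda>x. face_normal (i, s)) = tangential_space i (poly_space UNIV k)"
  unfolding set_eq_iff cross_space_normal_iff[OF assms] tangential_space_iff[OF subspace_poly_space] by simp

section \<open>Linearity of the degrees of freedom\<close>

lemma subspace_Poly: "subspace Poly" by (rule subspace_mspan)

lemma linear_on_grad: "linear_on Poly grad"
  by (rule linear_onI)
    (simp_all add: fun_eq_iff vec_eq_iff grad_nth plus_fun_def scaleR_fun_def partial_add partial_scale)

lemma linear_on_surface_grad: "linear_on Poly (surface_grad f)"
proof (rule linear_onI)
  fix p q assume "p \<in> Poly" "q \<in> Poly"
  then show "surface_grad f (p + q) = surface_grad f p + surface_grad f q"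
    by (simp add: surface_grad_def fun_eq_iff linear_on_add[OF linear_on_grad] inner_add_left algebra_simps)
next
  fix a :: real and p assume "p \<in> Poly"
  then show "surface_grad f (a *\<^sub>R p) = a *\<^sub>R surface_grad f p"
    unfolding surface_grad_def linear_on_scale[OF linear_on_grad \<open>p \<in> Poly\<close>]
    by (simp add: fun_eq_iff scaleR_fun_def scaleR_diff_right)
qed

lemma linear_on_curl: "linear_on (cube Poly) curl"
proof (rule linear_onI)
  fix u v assume uv: "u \<in> cube Poly" "v \<in> cube Poly"
  then have s: "u + v \<in> cube Poly" by (simp add: subspace_add subspace_cube subspace_Poly)
  have "partial k (\<lambda>x. (u + v) x $ l) x = partial k (\<lambda>x. u x $ l) x + partial k (\<lambda>x. v x $ l) x" for k l x
    using uv by (simp add: partial_add cube_iff)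
  then show "curl (u + v) = curl u + curl v"
    unfolding fun_eq_iff vec_eq_iff plus_fun_apply vector_add_component curl_nth[OF s] curl_nth[OF uv(1)] curl_nth[OF uv(2)]
    by simp
next
  fix a :: real and u assume u: "u \<in> cube Poly"
  then have s: "a *\<^sub>R u \<in> cube Poly" by (simp add: subspace_scale subspace_cube subspace_Poly)
  have "partial k (\<lambda>x. (a *\<^sub>R u) x $ l) x = a * partial k (\<lambda>x. u x $ l) x" for k l x
    using u by (simp add: partial_scale cube_iff scaleR_fun_def)
  then show "curl (a *\<^sub>R u) = a *\<^sub>R curl u"
    unfolding fun_eq_iff vec_eq_iff scaleR_fun_def[of a "curl u"] vector_scaleR_component curl_nth[OF s] curl_nth[OF u]
    by (simp add: right_diff_distrib)
qed

lemma curl_Poly: "u \<in> cube Poly \<Longrightarrow> curl u \<in> cube Poly"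
  unfolding cube_iff[of "curl u"] curl_nth by (auto simp: cube_iff intro!: Poly_intros Poly_partial)

lemma inner_Poly: "u \<in> cube Poly \<Longrightarrow> v \<in> cube Poly \<Longrightarrow> (\<lambda>x. u x \<bullet> v x) \<in> Poly"
  unfolding inner_index3[of _ _ 1] by (intro Poly_intros) (auto simp: cube_iff)

lemma cross_const_Poly: "u \<in> cube Poly \<Longrightarrow> (\<lambda>x. cross3 (u x) n) \<in> cube Poly"
  unfolding cube_iff[of "\<lambda>x. cross3 (u x) n"] cross3_nth by (intro allI Poly_intros) (auto simp: cube_iff)

lemma linear_on_box_integral: "linear_on Poly (box_integral c h)"
  by (rule linear_onI) (simp_all add: plus_fun_def scaleR_fun_def box_integral_add box_integral_scale)

lemma linear_on_face_integral:
  assumes h: "\<forall>i. h $ i > 0"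
  shows "linear_on Poly (face_integral c h f)"
proof -
  obtain i s where f: "f = (i, s)" by (cases f)
  have hi: "h $ i > 0" "h $ i \<ge> 0" using h by (auto intro: less_imp_le)
  have e: "face_integral c h f g = box_integral c h (\<lambda>x. g (face_point c h i s x)) / (2 * h $ i)" if "g \<in> Poly" for g
    using face_integral_Poly[OF that hi(2), of c s] hi(1) unfolding f by (simp add: field_simps del: face_integral.simps)
  show ?thesis
  proof (rule linear_onI)
    fix a b assume "a \<in> Poly" "b \<in> Poly"
    then show "face_integral c h f (a + b) = face_integral c h f a + face_integral c h f b"
      by (simp add: e subspace_add[OF subspace_Poly] box_integral_add Poly_face_point add_divide_distrib)
  next
    fix k :: real and a assume "a \<in> Poly"
    then show "face_integral c h f (k *\<^sub>R a) = k *\<^sub>R face_integral c h f a"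
      using e[OF subspace_scale[OF subspace_Poly, of a k]] e[of a] by (simp add: box_integral_scale scaleR_fun_def)
  qed
qed

lemma linear_on_edge_integral:
  assumes h: "\<forall>i. h $ i > 0"
  shows "linear_on Poly (edge_integral c h e)"
proof -
  obtain i s t where eq: "e = (i, s, t)" by (cases e)
  have hi: "h $ (i + 1) \<ge> 0" "h $ (i + 2) \<ge> 0" "h $ (i + 1) > 0" "h $ (i + 2) > 0" using h by (auto intro: less_imp_le)
  let ?p = "\<lambda>x. face_point c h (i + 1) s (face_point c h (i + 2) t x)"
  have e: "edge_integral c h e g = box_integral c h (\<lambda>x. g (?p x)) / (4 * h $ (i + 1) * h $ (i + 2))" if "g \<in> Poly" for g
    using edge_integral_Poly[OF that hi(1,2), of c s t] hi(3,4) unfolding eq by (simp add: field_simps del: edge_integral.simps)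
  show ?thesis
  proof (rule linear_onI)
    fix a b assume "a \<in> Poly" "b \<in> Poly"
    then show "edge_integral c h e (a + b) = edge_integral c h e a + edge_integral c h e b"
      by (simp add: e subspace_add[OF subspace_Poly] box_integral_add Poly_face_point2 add_divide_distrib)
  next
    fix k :: real and a assume "a \<in> Poly"
    then show "edge_integral c h e (k *\<^sub>R a) = k *\<^sub>R edge_integral c h e a"
      using e[OF subspace_scale[OF subspace_Poly, of a k]] e[of a] by (simp add: box_integral_scale scaleR_fun_def)
  qed
qed

lemma linear_on_compose:
  assumes "linear_on B g" "linear_on A f" "f ` A \<subseteq> B"
  shows "linear_on A (\<lambda>x. g (f x))"
  using assms by (auto simp: linear_on_def image_subset_iff)

lemma linear_on_inner_left: "linear_on A (\<lambda>u x. u x \<bullet> (w x :: real^3))"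
  by (rule linear_onI) (simp_all add: fun_eq_iff inner_add_left scaleR_fun_def)

lemma linear_on_inner_right: "linear_on A (\<lambda>u x. w x \<bullet> (u x :: real^3))"
  by (rule linear_onI) (simp_all add: fun_eq_iff inner_add_right scaleR_fun_def)

lemma linear_on_cross_left: "linear_on A (\<lambda>u x. cross3 (u x) (w x))"
  by (rule linear_onI) (simp_all add: fun_eq_iff cross_add_left cross_mult_left scaleR_fun_def)

lemma linear_on_mult_right: "linear_on A (\<lambda>p x. w x * (p x :: real))"
  by (rule linear_onI) (simp_all add: fun_eq_iff distrib_left scaleR_fun_def)

text \<open>
  Testing against a whole space of test fields is the same as testing against a basis of it, so a
  test space of dimension \<open>d\<close> contributes at most \<open>d\<close> functionals.
\<close>

lemma functionals_of_tests:
  fixes \<beta> :: "'a::real_vector \<Rightarrow> 'b::real_vector \<Rightarrow> real"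
  assumes D: "subspace D" and T: "T \<subseteq> D" "fin_dim T" and lin: "\<And>u. u \<in> U \<Longrightarrow> linear_on D (\<beta> u)"
  shows "\<exists>L. finite L \<and> card L \<le> dim T \<and> L \<subseteq> (\<lambda>t u. \<beta> u t) ` T \<and>
    (\<forall>u\<in>U. (\<forall>l\<in>L. l u = 0) \<longrightarrow> (\<forall>t\<in>T. \<beta> u t = 0))"
proof -
  obtain B where B: "B \<subseteq> T" "finite B" "T \<subseteq> span B" "card B = dim T"
    using fin_dim_basis[OF T(2)] by metis
  let ?L = "(\<lambda>t u. \<beta> u t) ` B"
  have "\<beta> u t = 0" if u: "u \<in> U" and 0: "\<forall>l\<in>?L. l u = 0" and t: "t \<in> T" for u t
  proof -
    have "t \<in> span B" using t B by auto
    then have "t \<in> D \<and> \<beta> u t = 0"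
    proof (induction rule: span_induct_alt)
      case base
      then show ?case using linear_on_0[OF lin[OF u] D] subspace_0[OF D] by simp
    next
      case (step a b y)
      then have "b \<in> D" "\<beta> u b = 0" using B T 0 by auto
      then show ?case using step
        by (simp add: linear_on_add[OF lin[OF u]] linear_on_scale[OF lin[OF u]] subspace_add[OF D] subspace_scale[OF D])
    qed
    then show ?thesis by simp
  qed
  moreover have "card ?L \<le> dim T" using card_image_le[OF B(2), of "\<lambda>t u. \<beta> u t"] B(4) by simp
  ultimately show ?thesis using B(1,2) by (intro exI[of _ ?L]) auto
qed

section \<open>Dimensions of the test spaces\<close>

lemma card_faces: "card faces = 6"
proof -
  have "faces = UNIV \<times> {-1, 1}" by (auto simp: faces_def)
  moreover have "card ((UNIV :: 3 set) \<times> {-1, 1 :: real}) = 6" by (subst card_cartesian_product) simp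
  ultimately show ?thesis by (rule ssubst)
qed

lemma finite_card_edges: "finite edges" "card edges = 12"
proof -
  have "edges = UNIV \<times> {-1, 1} \<times> {-1, 1}" by (auto simp: edges_def)
  moreover have "finite ((UNIV :: 3 set) \<times> {-1, 1 :: real} \<times> {-1, 1 :: real})" by (intro finite_cartesian_product) auto
  moreover have "card ((UNIV :: 3 set) \<times> {-1, 1 :: real} \<times> {-1, 1 :: real}) = 12"
    by (subst card_cartesian_product, subst card_cartesian_product) simp
  ultimately show "finite edges" "card edges = 12" by (simp_all only:)
qed

lemma face_tangential_poly_properties:
  assumes "f \<in> faces"
  shows "subspace (face_tangential_poly f k)" "fin_dim (face_tangential_poly f k)"
    "k \<ge> -2 \<Longrightarrow> int (dim (face_tangential_poly f k)) = (k + 1) * (k + 2)"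
proof -
  obtain i s where f: "f = (i, s)" "s \<in> {-1, 1}" using assms by (auto simp: faces_def)
  note P = tangential_space_properties[OF subspace_poly_space fin_dim_poly_space, of i "- {i}" k]
  show "subspace (face_tangential_poly f k)" "fin_dim (face_tangential_poly f k)"
    unfolding f(1) face_tangential_poly_eq[OF f(2)] by (rule P)+
  show "int (dim (face_tangential_poly f k)) = (k + 1) * (k + 2)" if "k \<ge> -2"
    unfolding f(1) face_tangential_poly_eq[OF f(2)] P(3) using dim_poly_space_face[OF that, of i] by simp
qed

lemma face_hom_properties:
  "subspace (face_hom f k)" "fin_dim (face_hom f k)" "face_hom f k \<subseteq> Poly" "k \<ge> 0 \<Longrightarrow> int (dim (face_hom f k)) = k + 1"
  by (cases f; auto simp: subspace_hom_space fin_dim_hom_space dim_hom_space_face hom_space_Poly)+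

lemma face_test_properties:
  assumes f: "f \<in> faces" and r: "r \<ge> 2"
  shows "fin_dim (face_test r f)" "int (dim (face_test r f)) \<le> (r - 2) * (r - 1) + r"
proof -
  note H = face_hom_properties[where f=f and k="r - 1"]
  have lin: "linear_on (face_hom f (r - 1)) (surface_grad f)"
    by (rule linear_on_subset[OF linear_on_surface_grad H(3)])
  note F = face_tangential_poly_properties[OF f, of "r - 3"]
  have fs: "fin_dim (surface_grad f ` face_hom f (r - 1))"
    by (rule fin_dim_linear_on_image[OF H(1) lin H(2)])
  show "fin_dim (face_test r f)" unfolding face_test_def by (rule fin_dim_plus[OF F(2) fs])
  have "dim (face_test r f) \<le> dim (face_tangential_poly f (r - 3)) + dim (face_hom f (r - 1))"
    unfolding face_test_def using dim_plus_le[OF F(2) fs] dim_image_le[OF H(1,2) lin] by linarith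
  then show "int (dim (face_test r f)) \<le> (r - 2) * (r - 1) + r"
    using F(3) H(4) r by simp
qed

lemma cube_poly_space_properties:
  "subspace (cube (poly_space J k))" "fin_dim (cube (poly_space J k))" "dim (cube (poly_space J k)) = 3 * dim (poly_space J k)"
  "subspace (cube (hom_space J k))" "fin_dim (cube (hom_space J k))" "dim (cube (hom_space J k)) = 3 * dim (hom_space J k)"
  unfolding cube_comp_space
  using comp_space_properties[of "\<lambda>j. poly_space J k", OF subspace_poly_space fin_dim_poly_space]
    comp_space_properties[of "\<lambda>j. hom_space J k", OF subspace_hom_space fin_dim_hom_space] by simp_all

lemma cube_mono: "A \<subseteq> B \<Longrightarrow> cube A \<subseteq> cube B"
  unfolding cube_def by blast

lemma cube_poly_space_Poly: "cube (poly_space J k) \<subseteq> cube Poly" "cube (hom_space J k) \<subseteq> cube Poly"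
  by (rule cube_mono, blast intro: poly_space_Poly hom_space_Poly)+

lemma curl_grad:
  assumes "p \<in> Poly"
  shows "curl (grad p) = 0"
proof -
  have "grad p \<in> cube Poly" using assms by (simp add: cube_iff grad_nth Poly_partial)
  then show ?thesis
    by (simp add: fun_eq_iff vec_eq_iff curl_nth grad_nth partial_commute[OF assms, of "i + 2" "i + 1" for i])
qed

text \<open>
  Rank-nullity: the kernel of the curl contains the gradients of the homogeneous polynomials of degree
  \<open>k + 1\<close>, on which the gradient is injective by Euler's identity.
\<close>

lemma dim_curl_hom_space:
  assumes k: "k \<ge> 0"
  shows "int (dim (curl ` cube (hom_space UNIV k))) \<le> k * (k + 2)"
proof -
  let ?W = "cube (hom_space UNIV k)" and ?G = "grad ` hom_space UNIV (k + 1)"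
  have lin: "linear_on ?W curl" by (rule linear_on_subset[OF linear_on_curl cube_poly_space_Poly(2)])
  have ling: "linear_on (hom_space UNIV (k + 1)) grad"
    by (rule linear_on_subset[OF linear_on_grad]) (auto simp: hom_space_Poly)
  have inj: "p = 0" if p: "p \<in> hom_space UNIV (k + 1)" "grad p = 0" for p
  proof
    fix x
    have "partial j p x = 0" for j using fun_cong[OF p(2), of x] grad_nth[of p x j] by simp
    then have "of_int (k + 1) * p x = 0" using hom_space_euler[OF p(1), of x] by simp
    then show "p x = 0 x" using k by (simp add: of_int_eq_0_iff[symmetric] del: of_int_add)
  qed
  have dimG: "dim ?G = dim (hom_space UNIV (k + 1))"
    by (rule dim_injective_image[OF subspace_hom_space fin_dim_hom_space ling inj])
  have "?G \<subseteq> {v \<in> ?W. curl v = 0}"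
  proof
    fix v assume "v \<in> ?G"
    then obtain p where p: "p \<in> hom_space UNIV (k + 1)" "v = grad p" by blast
    have "partial j p \<in> hom_space UNIV k" for j
      using p(1) unfolding hom_space_mspan by (rule mspan_partial) (auto dest: deg_dec)
    then show "v \<in> {v \<in> ?W. curl v = 0}"
      using curl_grad[OF hom_space_Poly[OF p(1)]] by (simp add: p(2) cube_iff grad_nth)
  qed
  then have "dim ?G \<le> dim {v \<in> ?W. curl v = 0}"
    by (intro dim_mono fin_dim_subset[OF cube_poly_space_properties(5)[of UNIV k]]) auto
  then have "dim (hom_space UNIV (k + 1)) + dim (curl ` ?W) \<le> 3 * dim (hom_space UNIV k)"
    using rank_nullity[OF cube_poly_space_properties(4,5) lin] dimG cube_poly_space_properties(6)[of UNIV k] by linarith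
  then show ?thesis
    using dim_hom_space_box[OF k] dim_hom_space_box[of "k + 1"] k by (simp add: algebra_simps)
qed

lemma hom_space_neg: "k < 0 \<Longrightarrow> hom_space J k = {0}"
  unfolding hom_space_mspan by (simp add: mspan_def)

text \<open>
  For \<open>r = 2\<close> the bound of the general case would be negative: the homogeneous space of degree
  \<open>- 1\<close> is trivial, whereas the formula subtracts the constants as gradient potentials.
\<close>

lemma interior_test_properties:
  assumes r: "r \<ge> 2"
  shows "fin_dim (interior_test r)" "interior_test r \<subseteq> cube Poly"
    "r = 2 \<Longrightarrow> dim (interior_test r) = 0"
    "r \<ge> 3 \<Longrightarrow> 2 * int (dim (interior_test r)) \<le> (r - 4) * (r - 3) * (r - 2) + 2 * ((r - 3) * (r - 1))"
proof -
  let ?H = "cube (hom_space UNIV (r - 3))" and ?P = "cube (poly_space UNIV (r - 5))"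
  have lin: "linear_on ?H curl" by (rule linear_on_subset[OF linear_on_curl cube_poly_space_Poly(2)])
  have fH: "fin_dim (curl ` ?H)"
    by (rule fin_dim_linear_on_image[OF cube_poly_space_properties(4) lin cube_poly_space_properties(5)])
  show "fin_dim (interior_test r)"
    unfolding interior_test_def by (rule fin_dim_plus[OF cube_poly_space_properties(2) fH])
  show "interior_test r \<subseteq> cube Poly" using interior_test_degree cube_poly_space_Poly(1) by blast
  have le: "dim (interior_test r) \<le> 3 * dim (poly_space UNIV (r - 5)) + dim (curl ` ?H)"
    unfolding interior_test_def using dim_plus_le[OF cube_poly_space_properties(2) fH] cube_poly_space_properties(3) by metis
  have P: "6 * int (dim (poly_space UNIV (r - 5))) = (r - 4) * (r - 3) * (r - 2)"
    using dim_poly_space_box[of "r - 5"] r by simp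
  show "dim (interior_test r) = 0" if "r = 2"
  proof -
    have "dim ?H = 0" using that cube_poly_space_properties(6)[of UNIV "r - 3"] hom_space_neg[of "r - 3"] by (simp add: dim_zero del: span_empty)
    then have "dim (curl ` ?H) = 0"
      using dim_image_le[OF cube_poly_space_properties(4,5) lin] by simp
    then show ?thesis using le P that by simp
  qed
  show "2 * int (dim (interior_test r)) \<le> (r - 4) * (r - 3) * (r - 2) + 2 * ((r - 3) * (r - 1))" if "r \<ge> 3"
    using le P dim_curl_hom_space[of "r - 3"] that by (simp add: algebra_simps)
qed

section \<open>Dimension of the enriched space\<close>

lemma grad_S0_properties:
  assumes r: "r \<ge> 2"
  shows "subspace (grad ` S0 r)" "fin_dim (grad ` S0 r)" "dim (S0 r) \<le> dim (grad ` S0 r) + 1"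
proof -
  have set_coord: "subspace (S0 r)" unfolding S0_mspan by (rule subspace_mspan)
  have lin: "linear_on (S0 r) grad" by (rule linear_on_subset[OF linear_on_grad]) (auto simp: S0_Poly)
  show "subspace (grad ` S0 r)" by (rule subspace_linear_on_image[OF set_coord lin])
  show "fin_dim (grad ` S0 r)" by (rule fin_dim_linear_on_image[OF set_coord lin dim_S0(1)])
  have "{p \<in> S0 r. grad p = 0} \<subseteq> mspan {\<lambda>j. 0}"
  proof
    fix p assume p: "p \<in> {p \<in> S0 r. grad p = 0}"
    then have P: "p \<in> Poly" using S0_Poly by blast
    have "partial j p = (\<lambda>x. 0)" for j
      using p grad_nth[of p _ j] by (auto simp: fun_eq_iff)
    then have "p = (\<lambda>x. p 0)" using constant_if_partial_0[OF P] by blast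
    moreover have "(\<lambda>x. p 0) \<in> mspan {\<lambda>j. 0}" by (rule mspan_const) simp
    ultimately show "p \<in> mspan {\<lambda>j. 0}" by simp
  qed
  then have "dim {p \<in> S0 r. grad p = 0} \<le> 1"
    using dim_mono[OF fin_dim_mspan[of "{\<lambda>j. 0}"]] dim_mspan[of "{\<lambda>j. 0}"] by simp
  then show "dim (S0 r) \<le> dim (grad ` S0 r) + 1"
    using rank_nullity[OF set_coord dim_S0(1) lin] by simp
qed

lemma coord_mult_eq_0:
  assumes "p \<in> Poly" "\<And>x. x $ k * p x = 0"
  shows "p = (\<lambda>x. 0)"
proof (rule mcoeff_eq_0I[OF assms(1)])
  fix a
  have "(\<lambda>x. x $ k * p x) = (\<lambda>x. 0)" using assms(2) by (rule ext)
  then have "mcoeff (\<lambda>x. x $ k * p x) (a(k := Suc (a k))) = 0" by (simp only: mcoeff_zero)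
  then show "mcoeff p a = 0" by (simp add: mcoeff_coord_mult[OF assms(1)])
qed

text \<open>
  The map taking \<open>q\<close> to \<open>q \<times> x\<close> has the multiples of \<open>x\<close> as its kernel. It is injective on the fields
  whose third component does not depend on \<open>x $ 3\<close>: modulo \<open>x $ 3\<close> this component has to vanish, and
  then so do the other two. This complement already has the full dimension of the image.
\<close>

lemma koszul_space_properties:
  assumes r: "r \<ge> 2"
  defines "K \<equiv> cross_space (cube (poly_space UNIV (r - 1))) (\<lambda>x. x)"
  shows "subspace K" "fin_dim K" "2 * r * (r + 1) * (r + 2) + 3 * r * (r + 1) \<le> 6 * int (dim K)"
proof -
  let ?X = "\<lambda>v x. cross3 (v x) x"
  have K: "K = ?X ` cube (poly_space UNIV (r - 1))" by (simp add: K_def cross_space_def)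
  show "subspace K" unfolding K
    by (rule subspace_linear_on_image[OF cube_poly_space_properties(1) linear_on_cross_left])
  show fK: "fin_dim K" unfolding K
    by (rule fin_dim_linear_on_image[OF cube_poly_space_properties(1) linear_on_cross_left cube_poly_space_properties(2)])
  \<comment> \<open>a complement of the kernel, the multiples of \<open>x\<close>\<close>
  let ?A = "\<lambda>j::3. if j = 3 then poly_space (- {3}) (r - 1) else poly_space UNIV (r - 1)"
  have *: "subspace (?A j)" "fin_dim (?A j)" for j
    by (simp_all add: subspace_poly_space fin_dim_poly_space)
  note C = comp_space_properties[of ?A, OF *]
  have set_coord: "comp_space ?A \<subseteq> cube (poly_space UNIV (r - 1))"
  proof
    fix v assume v: "v \<in> comp_space ?A"
    have "poly_space (- {3}) (r - 1) \<subseteq> poly_space UNIV (r - 1)"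
      unfolding poly_space_mspan by (rule mspan_mono) auto
    then have "?A j \<subseteq> poly_space UNIV (r - 1)" for j by auto
    then show "v \<in> cube (poly_space UNIV (r - 1))" using v unfolding comp_space_def cube_iff by blast
  qed
  have inj: "v = 0" if v: "v \<in> comp_space ?A" "?X v = 0" for v
  proof -
    have "v \<in> cube Poly" using set_coord v(1) cube_poly_space_Poly(1) by blast
    then have P: "(\<lambda>x. v x $ j) \<in> Poly" for j by (simp add: cube_iff)
    have v3: "(\<lambda>x. v x $ 3) \<in> poly_space (- {3}) (r - 1)"
      using v(1) by (auto simp: comp_space_def split: if_splits dest!: spec[of _ 3])
    have X: "cross3 (v x) x $ j = 0" for x j using fun_cong[OF v(2), of x] by simp
    have e1: "x $ 3 * v x $ 2 = x $ 2 * v x $ 3" and e2: "x $ 3 * v x $ 1 = x $ 1 * v x $ 3" for x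
      using X[of x 1] X[of x 2] by (simp_all add: cross3_nth numeral_index3 mult.commute)
    have "mcoeff (\<lambda>x. v x $ 3) a = 0" for a
    proof (cases "a 3 = 0")
      case True
      \<comment> \<open>a multiple of \<open>x $ 3\<close> has no monomials without \<open>x $ 3\<close>\<close>
      have "mcoeff (\<lambda>x. v x $ 3) a = mcoeff (\<lambda>x. x $ 2 * v x $ 3) (a(2 := Suc (a 2)))"
        by (simp add: mcoeff_coord_mult[OF P])
      also have "\<dots> = mcoeff (\<lambda>x. x $ 3 * v x $ 2) (a(2 := Suc (a 2)))" by (simp only: e1)
      also have "\<dots> = 0" using True by (simp add: mcoeff_coord_mult[OF P])
      finally show ?thesis .
    next
      case False
      then show ?thesis using mspanD[OF v3[unfolded poly_space_mspan], of a] by auto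
    qed
    then have z3: "(\<lambda>x. v x $ 3) = (\<lambda>x. 0)" by (intro mcoeff_eq_0I P)
    then have "x $ 3 * v x $ 2 = 0" "x $ 3 * v x $ 1 = 0" for x
      using e1[of x] e2[of x] by (auto dest: fun_cong[of _ _ x])
    then have "(\<lambda>x. v x $ 2) = (\<lambda>x. 0)" "(\<lambda>x. v x $ 1) = (\<lambda>x. 0)"
      by (intro coord_mult_eq_0[where k=3] P; simp)+
    with z3 show "v = 0" by (simp add: fun_eq_iff vec_eq_iff forall_3)
  qed
  have "dim (?X ` comp_space ?A) = dim (comp_space ?A)"
    by (rule dim_injective_image[OF C(1,2) linear_on_cross_left inj])
  moreover have "dim (?X ` comp_space ?A) \<le> dim K"
    by (rule dim_mono[OF fK]) (use set_coord K in blast)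
  ultimately have "2 * dim (poly_space UNIV (r - 1)) + dim (poly_space (- {3::3}) (r - 1)) \<le> dim K"
    using C(3) by (simp add: sum_3)
  then show "2 * r * (r + 1) * (r + 2) + 3 * r * (r + 1) \<le> 6 * int (dim K)"
    using dim_poly_space_box[of "r - 1"] dim_poly_space_face[of "r - 1" 3] r by (simp add: algebra_simps)
qed

definition extra_space :: "int \<Rightarrow> vector_field set"
  where "extra_space r = (\<lambda>w x. \<chi> i. extra_part w i x) ` {w. \<forall>i. w i \<in> hom_space (- {i}) (r - 1)}"

lemma extra_space_properties:
  assumes r: "r \<ge> 2"
  shows "subspace (extra_space r)" "fin_dim (extra_space r)" "int (dim (extra_space r)) = 3 * r"
proof -
  let ?W = "{w. \<forall>i::3. w i \<in> hom_space (- {i}) (r - 1)}"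
  let ?E = "\<lambda>w x. (\<chi> i. extra_part w i x) :: real^3"
  note W = dim_product[of "\<lambda>i::3. hom_space (- {i}) (r - 1)", OF subspace_hom_space fin_dim_hom_space]
  have lin: "linear_on ?W ?E"
    by (rule linear_onI) (simp_all add: fun_eq_iff vec_eq_iff extra_part_def scaleR_fun_def algebra_simps)
  show "subspace (extra_space r)" unfolding extra_space_def by (rule subspace_linear_on_image[OF W(1) lin])
  show "fin_dim (extra_space r)" unfolding extra_space_def by (rule fin_dim_linear_on_image[OF W(1) lin W(2)])
  have inj: "w = 0" if w: "w \<in> ?W" "?E w = 0" for w
  proof -
    have wP: "w j \<in> Poly" for j using w(1) hom_space_Poly by blast
    have step: "w (i + 1) = w (i + 2)" for i
    proof -
      have dP: "(\<lambda>x. w (i + 1) x - w (i + 2) x) \<in> Poly" by (intro Poly_intros wP)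
      have "extra_part w i x = 0" for x using fun_cong[OF w(2), of x] by (simp add: vec_eq_iff)
      then have "(\<lambda>x. x $ (i + 2) * (w (i + 1) x - w (i + 2) x)) = (\<lambda>x. 0)"
        by (intro coord_mult_eq_0[where k="i + 1"] Poly_intros wP) (simp add: extra_part_def)
      then have "(\<lambda>x. w (i + 1) x - w (i + 2) x) = (\<lambda>x. 0)"
        by (intro coord_mult_eq_0[OF dP, where k="i + 2"]) (rule fun_cong)
      then show ?thesis by (simp add: fun_eq_iff)
    qed
    have eq: "w j = w i" for i j
      using index3_cases[of j i] step[of i] step[of "i + 1"] by (auto simp: index3)
    have "w i = (\<lambda>x. 0)" for i
    proof (rule mcoeff_eq_0I[OF wP], rule ccontr)
      fix a assume a: "mcoeff (w i) a \<noteq> 0"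
      have z: "a j = 0 \<and> int (deg a) = r - 1" for j
        using mspanD[of "w j" "{a. (\<forall>l. l \<notin> - {j} \<longrightarrow> a l = 0) \<and> int (deg a) = r - 1}" a] w(1) a eq[of i j]
        by (auto simp: hom_space_mspan)
      have "deg a = 0" using z by (simp add: deg_def)
      then show False using r z by simp
    qed
    then show ?thesis by (simp add: fun_eq_iff)
  qed
  have "dim (extra_space r) = dim ?W" unfolding extra_space_def by (rule dim_injective_image[OF W(1,2) lin inj])
  then show "int (dim (extra_space r)) = 3 * r"
    unfolding W(3) using dim_hom_space_face[of "r - 1"] r by simp
qed

lemma S1_eq: "S1 r = grad ` S0 r + cross_space (cube (poly_space UNIV (r - 1))) (\<lambda>x. x) + extra_space r"
proof -
  have "(\<lambda>x. vector [x$2 * x$3 * (w 2 x - w 3 x), x$1 * x$3 * (w 3 x - w 1 x), x$1 * x$2 * (w 1 x - w 2 x)])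
    = (\<lambda>x. (\<chi> i. extra_part w i x) :: real^3)" for w :: "3 \<Rightarrow> scalar_field"
    by (simp only: fun_eq_iff vec_eq_iff extra_vector_nth vec_lambda_beta simp_thms)
  then show ?thesis by (simp only: S1_def extra_space_def setcompr_eq_image)
qed

text \<open>
  The sum is direct. The extra fields are homogeneous of degree \<open>r + 1\<close>, while the fields \<open>q \<times> x\<close> have
  degree at most \<open>r\<close>; both are orthogonal to the position vector, so a gradient among their sums is
  zero by \<open>koszul_exact\<close>.
\<close>

lemma S1_properties:
  assumes r: "r \<ge> 2"
  shows "subspace (S1 r)" "fin_dim (S1 r)"
    "6 * int (dim (S0 r)) - 6 + 2 * r * (r + 1) * (r + 2) + 3 * r * (r + 1) + 18 * r \<le> 6 * int (dim (S1 r))"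
proof -
  let ?G = "grad ` S0 r" and ?K = "cross_space (cube (poly_space UNIV (r - 1))) (\<lambda>x. x)" and ?E = "extra_space r"
  note G = grad_S0_properties[OF r] and K = koszul_space_properties[OF r] and E = extra_space_properties[OF r]
  have "?K \<inter> ?E \<subseteq> {0}"
  proof
    fix v assume v: "v \<in> ?K \<inter> ?E"
    then obtain q where q: "q \<in> cube (poly_space UNIV (r - 1))" "v = (\<lambda>x. cross3 (q x) x)"
      by (auto simp: cross_space_def)
    obtain w where w: "\<And>i. w i \<in> hom_space (- {i}) (r - 1)" "v = (\<lambda>x. \<chi> i. extra_part w i x)"
      using v by (auto simp: extra_space_def)
    have eP: "extra_part w i \<in> Poly" for i by (rule extra_part_mspan[OF w(1)]) auto
    have "extra_part w i = (\<lambda>x. 0)" for i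
    proof (rule mcoeff_eq_0I[OF eP])
      fix a
      have "extra_part w i = koszul_part (\<lambda>j x. q x $ j) i"
        using q(2) w(2) by (simp add: fun_eq_iff vec_eq_iff cross_position_nth)
      moreover have "koszul_part (\<lambda>j x. q x $ j) i \<in> poly_space UNIV r"
        using q(1) by (intro koszul_part_degree) (simp add: cube_iff)
      ultimately have le: "mcoeff (extra_part w i) a \<noteq> 0 \<Longrightarrow> int (deg a) \<le> r"
        using mspanD[of "extra_part w i" "{a. int (deg a) \<le> r}" a] by (simp add: poly_space_UNIV)
      have "extra_part w i \<in> mspan {a. int (deg a) = r + 1}"
        by (rule extra_part_mspan[OF w(1)]) (simp add: deg_index3[of _ i] index3)
      then show "mcoeff (extra_part w i) a = 0" using le mspanD[of "extra_part w i" "{a. int (deg a) = r + 1}" a] by force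
    qed
    then show "v \<in> {0}" using w(2) by (simp add: fun_eq_iff vec_eq_iff)
  qed
  then have KE: "dim (?K + ?E) = dim ?K + dim ?E" by (intro dim_plus_direct K E)
  note sKE = subspace_plus[OF K(1) E(1)] and fKE = fin_dim_plus[OF K(2) E(2)]
  have "?G \<inter> (?K + ?E) \<subseteq> {0}"
  proof
    fix v assume v: "v \<in> ?G \<inter> (?K + ?E)"
    then obtain p where p: "p \<in> S0 r" "v = grad p" by blast
    obtain k e where ke: "k \<in> ?K" "e \<in> ?E" "v = k + e" using v by (auto elim: set_plus_elim)
    obtain q where q: "k = (\<lambda>x. cross3 (q x) x)" using ke(1) by (auto simp: cross_space_def)
    obtain w where w: "e = (\<lambda>x. \<chi> i. extra_part w i x)" using ke(2) by (auto simp: extra_space_def)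
    have vi: "v x $ i = koszul_part (\<lambda>j x. q x $ j) i x + extra_part w i x" for x i
      by (simp add: ke(3) q w cross_position_nth)
    have P: "p \<in> Poly" using p(1) by (rule S0_Poly)
    have vp: "(\<lambda>x. v x $ i) = partial i p" for i by (simp add: p(2) grad_nth)
    have "(\<lambda>x. v x $ i) = (\<lambda>x. 0)" for i
    proof (rule koszul_exact[where U="\<lambda>i x. v x $ i"])
      show "(\<lambda>x. v x $ i) \<in> Poly" for i unfolding vp by (rule Poly_partial[OF P])
      show "partial i (\<lambda>x. v x $ j) = partial j (\<lambda>x. v x $ i)" for i j unfolding vp by (rule partial_commute[OF P])
      show "(\<Sum>i\<in>UNIV. x $ i * v x $ i) = 0" for x
        unfolding vi using position_koszul_part[of x "\<lambda>j x. q x $ j"] position_extra_part[of x w]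
        by (simp add: distrib_left sum.distrib)
    qed
    then show "v \<in> {0}" by (simp add: fun_eq_iff vec_eq_iff)
  qed
  then have "dim (?G + (?K + ?E)) = dim ?G + dim (?K + ?E)" by (intro dim_plus_direct G sKE fKE)
  moreover have S: "S1 r = ?G + (?K + ?E)" unfolding S1_eq by (simp add: add.assoc)
  ultimately have d: "dim (S1 r) = dim ?G + dim ?K + dim ?E" using KE by simp
  show "subspace (S1 r)" unfolding S by (rule subspace_plus[OF G(1) sKE])
  show "fin_dim (S1 r)" unfolding S by (rule fin_dim_plus[OF G(2) fKE])
  show "6 * int (dim (S0 r)) - 6 + 2 * r * (r + 1) * (r + 2) + 3 * r * (r + 1) + 18 * r \<le> 6 * int (dim (S1 r))"
    using d G(3) K(3) E(3) by linarith
qed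

text \<open>
  The orthogonality condition imposes at most as many functionals as the dimension of the tangential
  fields of degree \<open>r - 3\<close>.
\<close>

lemma Vf_properties:
  assumes r: "r \<ge> 2" and f: "f \<in> faces"
  shows "subspace (Vf c h r f)" "fin_dim (Vf c h r f)" "r * (r - 1) \<le> int (dim (Vf c h r f))"
proof -
  obtain i s where fis: "f = (i, s)" and s: "s \<in> {-1, 1}" using f by (auto simp: faces_def)
  let ?W = "\<lambda>k. tangential_space i (poly_space UNIV k)"
  let ?\<beta> = "\<lambda>q w. box_integral c h (\<lambda>x. q x \<bullet> ((bubble_box c h x * bubble_face c h f x) *\<^sub>R w x))"
  have Vf: "Vf c h r f = {q \<in> ?W (r - 2). \<forall>w\<in>?W (r - 3). ?\<beta> q w = 0}"
    unfolding Vf_def fis cross_space_normal_eq[OF s] ..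
  note W = tangential_space_properties[OF subspace_poly_space fin_dim_poly_space, of i UNIV]
  have WP: "?W k \<subseteq> cube Poly" for k
    using tangential_space_iff[OF subspace_poly_space] cube_poly_space_Poly(1) by blast
  have bP: "(\<lambda>x. (bubble_box c h x * bubble_face c h f x) *\<^sub>R w x) \<in> cube Poly" if "w \<in> cube Poly" for w
    using that by (auto simp: cube_iff intro!: Poly_intros bubble_box_Poly bubble_face_Poly)
  have lin1: "linear_on (cube Poly) (\<lambda>q. ?\<beta> q w)" if w: "w \<in> cube Poly" for w
    by (rule linear_on_compose[OF linear_on_box_integral linear_on_inner_left]) (use inner_Poly bP[OF w] in blast)
  have lin2: "linear_on (cube Poly) (?\<beta> q)" if q: "q \<in> cube Poly" for q
  proof (rule linear_on_compose[OF linear_on_box_integral])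
    show "linear_on (cube Poly) (\<lambda>w x. q x \<bullet> ((bubble_box c h x * bubble_face c h f x) *\<^sub>R w x))"
      by (rule linear_onI) (simp_all add: fun_eq_iff inner_add_right scaleR_fun_def algebra_simps)
  qed (use inner_Poly[OF q] bP in blast)
  show "subspace (Vf c h r f)"
    unfolding subspace_def
  proof (intro conjI ballI allI)
    show "0 \<in> Vf c h r f" unfolding Vf using subspace_0[OF W(1)] by (auto simp: box_integral_zero)
  next
    fix a b assume ab: "a \<in> Vf c h r f" "b \<in> Vf c h r f"
    then have "a + b \<in> ?W (r - 2)" unfolding Vf by (auto intro: subspace_add[OF W(1)])
    moreover have "?\<beta> (a + b) w = 0" if "w \<in> ?W (r - 3)" for w
      using ab that linear_on_add[OF lin1, of w a b] WP unfolding Vf by auto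
    ultimately show "a + b \<in> Vf c h r f" unfolding Vf by blast
  next
    fix k :: real and a assume a: "a \<in> Vf c h r f"
    then have "k *\<^sub>R a \<in> ?W (r - 2)" unfolding Vf by (auto intro: subspace_scale[OF W(1)])
    moreover have "?\<beta> (k *\<^sub>R a) w = 0" if "w \<in> ?W (r - 3)" for w
      using a that linear_on_scale[OF lin1, of w a k] WP unfolding Vf by auto
    ultimately show "k *\<^sub>R a \<in> Vf c h r f" unfolding Vf by blast
  qed
  show fin: "fin_dim (Vf c h r f)" by (rule fin_dim_subset[OF W(2)[of "r - 2"]]) (auto simp: Vf)
  have "\<exists>L. finite L \<and> card L \<le> dim (?W (r - 3)) \<and> L \<subseteq> (\<lambda>t u. ?\<beta> u t) ` ?W (r - 3) \<and>
    (\<forall>u\<in>cube Poly. (\<forall>l\<in>L. l u = 0) \<longrightarrow> (\<forall>t\<in>?W (r - 3). ?\<beta> u t = 0))"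
    by (rule functionals_of_tests[OF subspace_cube[OF subspace_Poly] WP W(2) lin2])
  then obtain L where L: "finite L" "card L \<le> dim (?W (r - 3))" "L \<subseteq> (\<lambda>t u. ?\<beta> u t) ` ?W (r - 3)"
    "\<forall>u\<in>cube Poly. (\<forall>l\<in>L. l u = 0) \<longrightarrow> (\<forall>t\<in>?W (r - 3). ?\<beta> u t = 0)"
    by (elim exE conjE)
  have linL: "linear_on (?W (r - 2)) l" if l: "l \<in> L" for l
  proof -
    obtain t where t: "t \<in> ?W (r - 3)" "l = (\<lambda>u. ?\<beta> u t)" using l L(3) by blast
    show ?thesis unfolding t(2) using lin1[of t] t(1) WP by (intro linear_on_subset[OF _ WP]) auto
  qed
  have "{v \<in> ?W (r - 2). \<forall>l\<in>L. l v = 0} \<subseteq> Vf c h r f"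
    unfolding Vf using L(4) WP by blast
  then have "dim {v \<in> ?W (r - 2). \<forall>l\<in>L. l v = 0} \<le> dim (Vf c h r f)" by (rule dim_mono[OF fin])
  then have "dim (?W (r - 2)) \<le> dim (Vf c h r f) + dim (?W (r - 3))"
    using dim_le_functionals[OF W(1,2) L(1) linL] L(2) by linarith
  then have "6 * (2 * int (dim (poly_space UNIV (r - 2)))) \<le> 6 * int (dim (Vf c h r f)) + 6 * (2 * int (dim (poly_space UNIV (r - 3))))"
    unfolding W(3) by linarith
  then show "r * (r - 1) \<le> int (dim (Vf c h r f))"
    using dim_poly_space_box[of "r - 2"] dim_poly_space_box[of "r - 3"] r by (simp add: algebra_simps)
qed

text \<open>
  All degrees of freedom of the zero field vanish, so unisolvence of the pair gives uniqueness of the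
  representation as an \<open>S1\<close> field plus a bubble field.
\<close>

lemma S1_plus_bubble_direct:
  assumes r: "r \<ge> 2" and h: "\<forall>i. h $ i > 0" and q: "\<And>f. f \<in> faces \<Longrightarrow> q f \<in> Vf c h r f"
    and s: "s \<in> S1 r" and 0: "s + bubble_field c h q = 0"
  shows "s = 0" "\<forall>f\<in>faces. q f = 0"
proof -
  have "curl 0 = 0" by (rule linear_on_0[OF linear_on_curl subspace_cube[OF subspace_Poly]])
  then have d: "edge_integral c h e (\<lambda>x. 0 x \<bullet> edge_tangent e * p x) = 0"
    "face_integral c h f (\<lambda>x. cross3 (0 x) (face_normal f) \<bullet> w x) = 0"
    "face_integral c h f (\<lambda>x. cross3 (curl 0 x) (face_normal f) \<bullet> w x) = 0"
    "box_integral c h (\<lambda>x. 0 x \<bullet> w x) = 0" for e f p w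
    by (cases e; cases f; simp add: case_prod_unfold box_integral_zero)+
  show "s = 0" by (rule S1_plus_bubble_unisolvent(1)[OF r h q s 0[symmetric] d])
  show "\<forall>f\<in>faces. q f = 0" by (rule S1_plus_bubble_unisolvent(2)[OF r h q s 0[symmetric] d])
qed

lemma V_properties:
  assumes r: "r \<ge> 2" and h: "\<forall>i. h $ i > 0"
  shows "subspace (V c h r)" "fin_dim (V c h r)" "6 * (r * (r - 1)) \<le> int (dim (V c h r))"
    "S1 r \<inter> V c h r \<subseteq> {0}"
proof -
  let ?C = "\<lambda>f. (\<lambda>q x. (bubble_box c h x * bubble_face c h f x) *\<^sub>R q x) ` Vf c h r f"
  have lin: "linear_on A (\<lambda>q x. (bubble_box c h x * bubble_face c h f x) *\<^sub>R (q x :: real^3))" for f A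
    by (rule linear_onI) (simp_all add: fun_eq_iff scaleR_fun_def algebra_simps)
  have bf: "bubble_field c h q = (\<Sum>f\<in>faces. (\<lambda>x. (bubble_box c h x * bubble_face c h f x) *\<^sub>R q f x))" for q
    by (simp add: bubble_field_def fun_eq_iff fun_sum_apply scaleR_sum_right)
  have V: "V c h r = (\<Sum>f\<in>faces. ?C f)"
  proof (intro set_eqI iffI)
    fix v assume "v \<in> V c h r"
    then obtain q where "\<forall>f\<in>faces. q f \<in> Vf c h r f" "v = bubble_field c h q" unfolding V_iff by blast
    then show "v \<in> (\<Sum>f\<in>faces. ?C f)" unfolding set_sum_alt[OF finite_faces] bf by blast
  next
    fix v assume "v \<in> (\<Sum>f\<in>faces. ?C f)"
    then obtain y where y: "v = sum y faces" "\<forall>f\<in>faces. y f \<in> ?C f" unfolding set_sum_alt[OF finite_faces] by blast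
    then have "\<forall>f\<in>faces. \<exists>q. q \<in> Vf c h r f \<and> y f = (\<lambda>x. (bubble_box c h x * bubble_face c h f x) *\<^sub>R q x)" by blast
    then obtain q where q: "\<forall>f\<in>faces. q f \<in> Vf c h r f \<and> y f = (\<lambda>x. (bubble_box c h x * bubble_face c h f x) *\<^sub>R q f x)" by metis
    then have "v = bubble_field c h q" unfolding bf y(1) by (intro sum.cong) auto
    with q show "v \<in> V c h r" unfolding V_iff by blast
  qed
  have zero: "\<forall>f\<in>faces. q f = 0" if "\<And>f. f \<in> faces \<Longrightarrow> q f \<in> Vf c h r f" "bubble_field c h q = 0" for q
    by (rule S1_plus_bubble_direct(2)[OF r h that(1) subspace_0[OF S1_properties(1)[OF r]]])
      (simp_all add: that(2))
  have C: "subspace (?C f)" "fin_dim (?C f)" if "f \<in> faces" for f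
    using subspace_linear_on_image[OF Vf_properties(1)[OF r that] lin]
      fin_dim_linear_on_image[OF Vf_properties(1)[OF r that] lin Vf_properties(2)[OF r that]] by blast+
  show "subspace (V c h r)" "fin_dim (V c h r)"
    unfolding V using subspace_fin_dim_sum[of faces ?C] finite_faces C by blast+
  have dimC: "dim (?C f) = dim (Vf c h r f)" if f: "f \<in> faces" for f
  proof (rule dim_injective_image[OF Vf_properties(1,2)[OF r f] lin])
    fix q assume q: "q \<in> Vf c h r f" "(\<lambda>x. (bubble_box c h x * bubble_face c h f x) *\<^sub>R q x) = 0"
    \<comment> \<open>the field for a single face is a bubble field with all other faces contributing zero\<close>
    let ?q = "\<lambda>g. if g = f then q else 0"
    have "bubble_field c h ?q = (\<Sum>g\<in>faces. 0)"
      unfolding bf using q(2) by (intro sum.cong) (auto simp: fun_eq_iff)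
    then have "bubble_field c h ?q = 0" by simp
    with zero[of ?q] q(1) subspace_0[OF Vf_properties(1)[OF r]] have "\<forall>g\<in>faces. ?q g = 0" by auto
    then show "q = 0" using f by auto
  qed
  have "dim (V c h r) = (\<Sum>f\<in>faces. dim (?C f))"
    unfolding V
  proof (rule dim_sum_direct[OF finite_faces C])
    fix y assume y: "\<And>f. f \<in> faces \<Longrightarrow> y f \<in> ?C f" "(\<Sum>f\<in>faces. y f) = 0"
    then have "\<forall>f\<in>faces. \<exists>q. q \<in> Vf c h r f \<and> y f = (\<lambda>x. (bubble_box c h x * bubble_face c h f x) *\<^sub>R q x)" by blast
    then obtain q where q: "\<And>f. f \<in> faces \<Longrightarrow> q f \<in> Vf c h r f"
      "\<And>f. f \<in> faces \<Longrightarrow> y f = (\<lambda>x. (bubble_box c h x * bubble_face c h f x) *\<^sub>R q f x)" by metis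
    have "bubble_field c h q = (\<Sum>f\<in>faces. y f)" unfolding bf using q(2) by (intro sum.cong) auto
    then have b0: "bubble_field c h q = 0" using y(2) by (rule trans)
    have "\<forall>f\<in>faces. q f = 0" by (rule zero[OF q(1) b0])
    then have q0: "q f = 0" if "f \<in> faces" for f using that by blast
    show "\<forall>f\<in>faces. y f = 0"
    proof (intro ballI ext)
      fix f x assume "f \<in> faces"
      then show "y f x = 0 x" by (simp only: q(2) q0 zero_fun_apply scaleR_zero_right)
    qed
  qed
  also have "\<dots> = (\<Sum>f\<in>faces. dim (Vf c h r f))" using dimC by simp
  finally have "int (dim (V c h r)) = (\<Sum>f\<in>faces. int (dim (Vf c h r f)))" by simp
  also have "\<dots> \<ge> (\<Sum>f\<in>faces. r * (r - 1))" by (intro sum_mono Vf_properties(3)[OF r])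
  finally show "6 * (r * (r - 1)) \<le> int (dim (V c h r))" by (simp add: card_faces)
  show "S1 r \<inter> V c h r \<subseteq> {0}"
  proof
    fix v assume v: "v \<in> S1 r \<inter> V c h r"
    then have "v \<in> V c h r" by blast
    then obtain q where q: "\<And>f. f \<in> faces \<Longrightarrow> q f \<in> Vf c h r f" "v = bubble_field c h q" unfolding V_iff by blast
    have n: "- v \<in> S1 r" using v subspace_neg[OF S1_properties(1)[OF r]] by blast
    have "- v + bubble_field c h q = 0" using q(2) by simp
    then have "- v = 0" using S1_plus_bubble_direct(1)[where q=q, OF r h q(1) n] by blast
    then show "v \<in> {0}" by simp
  qed
qed

section \<open>Unisolvence\<close>

lemma Splus1_Poly:
  assumes r: "r \<ge> 2" and h: "\<forall>i. h $ i > 0"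
  shows "Splus1 c h r \<subseteq> cube Poly"
proof
  fix u assume "u \<in> Splus1 c h r"
  then obtain s v where sv: "s \<in> S1 r" "v \<in> V c h r" "u = s + v" unfolding Splus1_def by (auto elim: set_plus_elim)
  then obtain q where q: "\<And>f. f \<in> faces \<Longrightarrow> q f \<in> Vf c h r f" "v = bubble_field c h q" unfolding V_iff by blast
  have "v \<in> cube Poly" unfolding q(2) by (rule bubble_field_Poly[OF r h q(1)])
  then show "u \<in> cube Poly" unfolding sv(3) using S1_Poly[OF r sv(1)] subspace_add[OF subspace_cube[OF subspace_Poly]] by blast
qed

lemma Splus1_unisolvent:
  assumes r: "r \<ge> 2" and h: "\<forall>i. h $ i > 0" and u: "u \<in> Splus1 c h r"
    and dofs: "\<forall>e\<in>edges. \<forall>q \<in> edge_poly e (r - 1). edge_integral c h e (\<lambda>x. u x \<bullet> edge_tangent e * q x) = 0"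
    "\<forall>f\<in>faces. \<forall>q \<in> face_test r f. face_integral c h f (\<lambda>x. cross3 (u x) (face_normal f) \<bullet> q x) = 0"
    "\<forall>f\<in>faces. \<forall>q \<in> face_tangential_poly f (r - 2).
      face_integral c h f (\<lambda>x. cross3 (curl u x) (face_normal f) \<bullet> q x) = 0"
    "\<forall>q \<in> interior_test r. box_integral c h (\<lambda>x. u x \<bullet> q x) = 0"
  shows "u = 0"
proof -
  obtain s v where sv: "s \<in> S1 r" "v \<in> V c h r" "u = s + v" using u unfolding Splus1_def by (auto elim: set_plus_elim)
  obtain q where q: "\<And>f. f \<in> faces \<Longrightarrow> q f \<in> Vf c h r f" "v = bubble_field c h q" using sv(2) unfolding V_iff by blast
  have us: "u = s + bubble_field c h q" using sv(3) q(2) by simp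
  note dofs' = bspec[OF bspec[OF dofs(1)]] bspec[OF bspec[OF dofs(2)]] bspec[OF bspec[OF dofs(3)]] bspec[OF dofs(4)]
  have "s = 0" by (rule S1_plus_bubble_unisolvent(1)[OF r h q(1) sv(1) us dofs'])
  moreover have "\<forall>f\<in>faces. q f = 0" by (rule S1_plus_bubble_unisolvent(2)[OF r h q(1) sv(1) us dofs'])
  then have "bubble_field c h q = 0" by (simp add: bubble_field_def fun_eq_iff)
  ultimately show ?thesis using us by simp
qed

text \<open>
  The degrees of freedom separate the points of the space, so there are at least as many of them as
  its dimension.
\<close>

lemma dim_Splus1_le:
  assumes r: "r \<ge> 2" and h: "\<forall>i. h $ i > 0"
  shows "dim (Splus1 c h r) \<le> (\<Sum>e\<in>edges. dim (edge_poly e (r - 1)))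
      + (\<Sum>f\<in>faces. dim (face_test r f))
      + (\<Sum>f\<in>faces. dim (face_tangential_poly f (r - 2)))
      + dim (interior_test r)"
proof -
  let ?U = "Splus1 c h r"
  have UP: "?U \<subseteq> cube Poly" by (rule Splus1_Poly[OF r h])
  have sU: "subspace ?U" and fU: "fin_dim ?U"
    unfolding Splus1_def using subspace_plus fin_dim_plus S1_properties[OF r] V_properties[OF r h] by blast+
  note sc = subspace_cube[OF subspace_Poly]
  let ?b1 = "\<lambda>e u q. edge_integral c h e (\<lambda>x. u x \<bullet> edge_tangent e * q x)"
  let ?b2 = "\<lambda>f u q. face_integral c h f (\<lambda>x. cross3 (u x) (face_normal f) \<bullet> q x)"
  let ?b3 = "\<lambda>f u q. ?b2 f (curl u) q"
  let ?b4 = "\<lambda>u q. box_integral c h (\<lambda>x. u x \<bullet> q x)"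
  have tP: "(\<lambda>x. a :: real^3) \<in> cube Poly" for a by (simp add: cube_iff Poly_const)
  have p1: "(\<lambda>x. u x \<bullet> edge_tangent e * q x) \<in> Poly" if "u \<in> cube Poly" "q \<in> Poly" for e u q
    using Poly_mult[OF inner_Poly[OF that(1) tP] that(2)] .
  have p2: "(\<lambda>x. cross3 (u x) (face_normal f) \<bullet> q x) \<in> Poly" if "u \<in> cube Poly" "q \<in> cube Poly" for f u q
    using inner_Poly[OF cross_const_Poly[OF that(1)] that(2)] .
  have l1: "linear_on (cube Poly) (\<lambda>u. ?b1 e u q)" if "q \<in> Poly" for e q
  proof (rule linear_on_compose[OF linear_on_edge_integral[OF h]])
    show "linear_on (cube Poly) (\<lambda>u x. u x \<bullet> edge_tangent e * q x)"
      by (rule linear_onI) (simp_all add: fun_eq_iff scaleR_fun_def inner_add_left distrib_right)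
  qed (use p1[OF _ that] in blast)
  have r1: "linear_on Poly (?b1 e u)" if "u \<in> cube Poly" for e u
    by (rule linear_on_compose[OF linear_on_edge_integral[OF h] linear_on_mult_right]) (use p1[OF that] in blast)
  have l2: "linear_on (cube Poly) (\<lambda>u. ?b2 f u q)" if "q \<in> cube Poly" for f q
  proof (rule linear_on_compose[OF linear_on_face_integral[OF h]])
    show "linear_on (cube Poly) (\<lambda>u x. cross3 (u x) (face_normal f) \<bullet> q x)"
      by (rule linear_onI) (simp_all add: fun_eq_iff scaleR_fun_def inner_add_left cross_add_left cross_mult_left)
  qed (use p2[OF _ that] in blast)
  have r2: "linear_on (cube Poly) (?b2 f u)" if "u \<in> cube Poly" for f u
    by (rule linear_on_compose[OF linear_on_face_integral[OF h] linear_on_inner_right]) (use p2[OF that] in blast)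
  have l3: "linear_on (cube Poly) (\<lambda>u. ?b3 f u q)" if "q \<in> cube Poly" for f q
    by (rule linear_on_compose[OF l2[OF that] linear_on_curl]) (use curl_Poly in blast)
  have r3: "linear_on (cube Poly) (?b3 f u)" if "u \<in> cube Poly" for f u
    by (rule r2[OF curl_Poly[OF that]])
  have l4: "linear_on (cube Poly) (\<lambda>u. ?b4 u q)" if "q \<in> cube Poly" for q
    by (rule linear_on_compose[OF linear_on_box_integral linear_on_inner_left]) (use inner_Poly that in blast)
  have r4: "linear_on (cube Poly) (?b4 u)" if "u \<in> cube Poly" for u
    by (rule linear_on_compose[OF linear_on_box_integral linear_on_inner_right]) (use inner_Poly that in blast)
  have t1: "edge_poly e k \<subseteq> Poly" "fin_dim (edge_poly e k)" for e k
    by (cases e; auto simp: poly_space_Poly fin_dim_poly_space)+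
  have t3: "face_tangential_poly f k \<subseteq> cube Poly" for f k
  proof -
    have "face_poly f k \<subseteq> Poly" by (cases f) (auto intro: poly_space_Poly)
    from cube_mono[OF this] show ?thesis by (auto simp: face_tangential_poly_def)
  qed
  have t2: "face_test r f \<subseteq> cube Poly" for f
  proof
    fix v assume "v \<in> face_test r f"
    then obtain a p where ap: "a \<in> face_tangential_poly f (r - 3)" "p \<in> face_hom f (r - 1)" "v = a + surface_grad f p"
      unfolding face_test_def by (auto elim: set_plus_elim)
    have "p \<in> Poly" using face_hom_properties(3) ap(2) by blast
    then have "grad p \<in> cube Poly" by (simp add: cube_iff grad_nth Poly_partial)
    then have "surface_grad f p \<in> cube Poly"
      using inner_Poly[OF _ tP, of "grad p" "face_normal f"] unfolding surface_grad_def
      by (auto simp: cube_iff intro!: Poly_intros)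
    then show "v \<in> cube Poly" unfolding ap(3) using t3 ap(1) subspace_add[OF sc] by blast
  qed
  let ?P = "\<lambda>\<beta> T L. finite L \<and> card L \<le> dim T \<and> L \<subseteq> (\<lambda>t u. \<beta> u t) ` T \<and>
    (\<forall>u\<in>cube Poly. (\<forall>l\<in>L. l u = 0) \<longrightarrow> (\<forall>t\<in>T. \<beta> u t = 0))"
  have "\<forall>e. \<exists>L. ?P (?b1 e) (edge_poly e (r - 1)) L"
    by (intro allI functionals_of_tests[OF subspace_Poly t1 r1])
  from choice[OF this] obtain L1 where L1: "\<forall>e. ?P (?b1 e) (edge_poly e (r - 1)) (L1 e)" ..
  have "\<forall>f\<in>faces. \<exists>L. ?P (?b2 f) (face_test r f) L"
    by (intro ballI functionals_of_tests[OF sc t2 face_test_properties(1)[OF _ r] r2])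
  from bchoice[OF this] obtain L2 where L2: "\<forall>f\<in>faces. ?P (?b2 f) (face_test r f) (L2 f)" ..
  have "\<forall>f\<in>faces. \<exists>L. ?P (?b3 f) (face_tangential_poly f (r - 2)) L"
    by (intro ballI functionals_of_tests[OF sc t3 face_tangential_poly_properties(2) r3])
  from bchoice[OF this] obtain L3 where L3: "\<forall>f\<in>faces. ?P (?b3 f) (face_tangential_poly f (r - 2)) (L3 f)" ..
  have "\<exists>L. ?P ?b4 (interior_test r) L"
    by (rule functionals_of_tests[OF sc interior_test_properties(2,1)[OF r] r4])
  then obtain L4 where L4: "?P ?b4 (interior_test r) L4" ..
  let ?L1 = "\<Union>e\<in>edges. L1 e" and ?L2 = "\<Union>f\<in>faces. L2 f" and ?L3 = "\<Union>f\<in>faces. L3 f"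
  let ?L = "?L1 \<union> ?L2 \<union> ?L3 \<union> L4"
  have finL: "finite ?L"
    by (intro finite_UnI finite_UN_I finite_card_edges(1) finite_faces) (use L1 L2 L3 L4 in blast)+
  have linL: "linear_on ?U l" if l: "l \<in> ?L" for l
  proof -
    have "linear_on (cube Poly) l"
      using l
    proof (elim UnE UN_E)
      fix e assume "l \<in> L1 e"
      then obtain q where "q \<in> edge_poly e (r - 1)" "l = (\<lambda>u. ?b1 e u q)" using L1 by blast
      then show ?thesis using l1[of q e] t1(1) by blast
    next
      fix f assume f: "f \<in> faces" "l \<in> L2 f"
      then obtain q where "q \<in> face_test r f" "l = (\<lambda>u. ?b2 f u q)" using L2 by blast
      then show ?thesis using l2[of q f] t2 by blast
    next
      fix f assume f: "f \<in> faces" "l \<in> L3 f"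
      then obtain q where "q \<in> face_tangential_poly f (r - 2)" "l = (\<lambda>u. ?b3 f u q)" using L3 by blast
      then show ?thesis using l3[of q f] t3 by blast
    next
      assume "l \<in> L4"
      then obtain q where "q \<in> interior_test r" "l = (\<lambda>u. ?b4 u q)" using L4 by blast
      then show ?thesis using l4[of q] interior_test_properties(2)[OF r] by blast
    qed
    then show ?thesis by (rule linear_on_subset[OF _ UP])
  qed
  have "u = 0" if u: "u \<in> ?U" and 0: "\<forall>l\<in>?L. l u = 0" for u
  proof (rule Splus1_unisolvent[OF r h u]; intro ballI)
    have uP: "u \<in> cube Poly" using u UP by blast
    show "?b1 e u q = 0" if "e \<in> edges" "q \<in> edge_poly e (r - 1)" for e q
    proof -
      have "\<forall>l\<in>L1 e. l u = 0" using 0 that(1) by blast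
      with L1 uP that(2) show ?thesis by blast
    qed
    show "?b2 f u q = 0" if "f \<in> faces" "q \<in> face_test r f" for f q
    proof -
      have "\<forall>l\<in>L2 f. l u = 0" using 0 that(1) by blast
      with bspec[OF L2 that(1)] uP that(2) show ?thesis by blast
    qed
    show "?b3 f u q = 0" if "f \<in> faces" "q \<in> face_tangential_poly f (r - 2)" for f q
    proof -
      have "\<forall>l\<in>L3 f. l u = 0" using 0 that(1) by blast
      with bspec[OF L3 that(1)] uP that(2) show ?thesis by blast
    qed
    show "?b4 u q = 0" if "q \<in> interior_test r" for q
    proof -
      have "\<forall>l\<in>L4. l u = 0" using 0 by blast
      with L4 uP that show ?thesis by blast
    qed
  qed
  then have "{u \<in> ?U. \<forall>l\<in>?L. l u = 0} \<subseteq> {0}" by blast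
  then have "dim {u \<in> ?U. \<forall>l\<in>?L. l u = 0} \<le> dim {0 :: vector_field}"
    by (rule dim_mono[OF fin_dim_zero])
  then have "dim {u \<in> ?U. \<forall>l\<in>?L. l u = 0} = 0"
    by (simp only: dim_zero le_zero_eq)
  with dim_le_functionals[OF sU fU finL linL] have "dim ?U \<le> card ?L"
    by (simp only: add_0)
  also have "\<dots> \<le> card ?L1 + card ?L2 + card ?L3 + card L4"
    using card_Un_le[of "?L1 \<union> ?L2 \<union> ?L3" L4] card_Un_le[of "?L1 \<union> ?L2" ?L3] card_Un_le[of ?L1 ?L2] by linarith
  also have "card ?L1 \<le> (\<Sum>e\<in>edges. dim (edge_poly e (r - 1)))"
    by (rule order_trans[OF card_UN_le[OF finite_card_edges(1)] sum_mono]) (use L1 in blast)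
  also have "card ?L2 \<le> (\<Sum>f\<in>faces. dim (face_test r f))"
    by (rule order_trans[OF card_UN_le[OF finite_faces] sum_mono]) (use L2 in blast)
  also have "card ?L3 \<le> (\<Sum>f\<in>faces. dim (face_tangential_poly f (r - 2)))"
    by (rule order_trans[OF card_UN_le[OF finite_faces] sum_mono]) (use L3 in blast)
  also have "card L4 \<le> dim (interior_test r)" using L4 by blast
  finally show ?thesis by simp
qed

text \<open>
  With the dimension formulas both sides become cubic polynomials in \<open>r\<close>, and these agree. The factor
  six clears the denominators; \<open>r = 2\<close> is separate because the formulas for \<open>S0\<close> and for the
  interior tests start at \<open>r = 3\<close>.
\<close>

lemma dim_Splus1_ge:
  assumes r: "r \<ge> 2" and h: "\<forall>i. h $ i > 0"
  shows "(\<Sum>e\<in>edges. dim (edge_poly e (r - 1)))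
      + (\<Sum>f\<in>faces. dim (face_test r f))
      + (\<Sum>f\<in>faces. dim (face_tangential_poly f (r - 2)))
      + dim (interior_test r) \<le> dim (Splus1 c h r)"
proof -
  have "int (dim (edge_poly e (r - 1))) = r" for e
    using r by (cases e) (simp add: dim_poly_space_edge)
  then have e: "int (\<Sum>e\<in>edges. dim (edge_poly e (r - 1))) = 12 * r" by (simp add: finite_card_edges)
  have "int (\<Sum>f\<in>faces. dim (face_test r f)) \<le> (\<Sum>f\<in>faces. (r - 2) * (r - 1) + r)"
    unfolding of_nat_sum by (intro sum_mono face_test_properties(2) r)
  then have f: "int (\<Sum>f\<in>faces. dim (face_test r f)) \<le> 6 * ((r - 2) * (r - 1) + r)" by (simp add: card_faces)
  have "int (\<Sum>f\<in>faces. dim (face_tangential_poly f (r - 2))) = (\<Sum>f\<in>faces. (r - 2 + 1) * (r - 2 + 2))"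
    unfolding of_nat_sum using r by (intro sum.cong face_tangential_poly_properties(3)) auto
  then have g: "int (\<Sum>f\<in>faces. dim (face_tangential_poly f (r - 2))) = 6 * ((r - 1) * r)" by (simp add: card_faces)
  have d: "dim (Splus1 c h r) = dim (S1 r) + dim (V c h r)"
    unfolding Splus1_def by (intro dim_plus_direct S1_properties[OF r] V_properties[OF r h])
  note S1_properties(3)[OF r] V_properties(3)[OF r h, of c]
  then have low: "6 * int (dim (S0 r)) - 6 + 2 * r * (r + 1) * (r + 2) + 3 * r * (r + 1) + 18 * r + 36 * (r * (r - 1)) \<le> 6 * int (dim (Splus1 c h r))"
    unfolding d by simp
  have "6 * (int (\<Sum>e\<in>edges. dim (edge_poly e (r - 1))) + int (\<Sum>f\<in>faces. dim (face_test r f))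
      + int (\<Sum>f\<in>faces. dim (face_tangential_poly f (r - 2))) + int (dim (interior_test r))) \<le> 6 * int (dim (Splus1 c h r))"
  proof (cases "r = 2")
    case True
    then show ?thesis using e f g low dim_S0(2)[OF True] interior_test_properties(3)[OF r True] by simp
  next
    case False
    then have r3: "r \<ge> 3" using r by simp
    define P1 P2 P3 P4 where "P1 = (r - 2) * (r - 1)" and "P2 = (r - 1) * r"
      and "P3 = (r - 4) * (r - 3) * (r - 2)" and "P4 = (r - 3) * (r - 1)"
    define Q1 Q2 Q3 Q4 where "Q1 = 6 * (r * r + 3 * r + 6) + (r - 1) * ((r - 2) * (r - 2) + 5 * (r - 2) + 18)"
      and "Q2 = 2 * r * (r + 1) * (r + 2)" and "Q3 = 3 * r * (r + 1)" and "Q4 = r * (r - 1)"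
    have id: "6 * (12 * r + 6 * (P1 + r) + 6 * P2) + 3 * (P3 + 2 * P4) = Q1 - 6 + Q2 + Q3 + 18 * r + 36 * Q4"
      unfolding P1_def P2_def P3_def P4_def Q1_def Q2_def Q3_def Q4_def by (simp add: algebra_simps)
    have *: "6 * (e' + f' + g' + i') \<le> 6 * d'"
      if "e' = 12 * r" "f' \<le> 6 * (P1 + r)" "g' = 6 * P2" "6 * s' - 6 + Q2 + Q3 + 18 * r + 36 * Q4 \<le> 6 * d'"
        "6 * s' = Q1" "2 * i' \<le> P3 + 2 * P4" for e' f' g' i' d' s' :: int
    proof -
      have "6 * (e' + f' + g' + i') = (6 * e' + 6 * f' + 6 * g') + 6 * i'" by (simp only: distrib_left)
      also have "6 * e' + 6 * f' + 6 * g' \<le> 6 * (12 * r + 6 * (P1 + r) + 6 * P2)" using that(1-3) by presburger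
      also have "6 * i' \<le> 3 * (P3 + 2 * P4)" using that(6) by presburger
      also note id
      also have "Q1 - 6 + Q2 + Q3 + 18 * r + 36 * Q4 \<le> 6 * d'" using that(4) by (simp only: that(5))
      finally show ?thesis by simp
    qed
    show ?thesis
      by (rule *[OF e f[folded P1_def] g[folded P2_def] low[folded Q2_def Q3_def Q4_def]
        dim_S0(3)[OF r3, folded Q1_def] interior_test_properties(4)[OF r r3, folded P3_def P4_def]])
  qed
  then show ?thesis
    by (simp only: mult_le_cancel_left_pos zero_less_numeral of_nat_add[symmetric] of_nat_le_iff)
qed

theorem theorem3p1:
  fixes r :: int and c h :: "real^3"
  assumes "r \<ge> 2"
    and "\<forall>i. h $ i > 0"
  shows "(\<Sum>e\<in>edges. dim (edge_poly e (r - 1)))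
      + (\<Sum>f\<in>faces. dim (face_test r f))
      + (\<Sum>f\<in>faces. dim (face_tangential_poly f (r - 2)))
      + dim (interior_test r)
      = dim (Splus1 c h r) \<and>
    (\<forall>u \<in> Splus1 c h r.
      (\<forall>e\<in>edges. \<forall>q \<in> edge_poly e (r - 1).
        edge_integral c h e (\<lambda>x. u x \<bullet> edge_tangent e * q x) = 0) \<and>
      (\<forall>f\<in>faces. \<forall>q \<in> face_test r f.
        face_integral c h f (\<lambda>x. cross3 (u x) (face_normal f) \<bullet> q x) = 0) \<and>
      (\<forall>f\<in>faces. \<forall>q \<in> face_tangential_poly f (r - 2).
        face_integral c h f (\<lambda>x. cross3 (curl u x) (face_normal f) \<bullet> q x) = 0) \<and>
      (\<forall>q \<in> interior_test r. box_integral c h (\<lambda>x. u x \<bullet> q x) = 0)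
      \<longrightarrow> u = 0)"
proof (intro conjI ballI impI, goal_cases)
  case 1
  show "(\<Sum>e\<in>edges. dim (edge_poly e (r - 1)))
      + (\<Sum>f\<in>faces. dim (face_test r f))
      + (\<Sum>f\<in>faces. dim (face_tangential_poly f (r - 2)))
      + dim (interior_test r)
      = dim (Splus1 c h r)"
    by (rule antisym[OF dim_Splus1_ge[OF assms] dim_Splus1_le[OF assms]])
next
  case (2 u)
  then show ?case by (elim conjE) (rule Splus1_unisolvent[OF assms])
qed

end
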